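(* If $(\mathbf u_h,p_h,\lambda_h)\in\mathbf V_h\times Q_h^0\times\Sigma_h$ satisfies $$(a_h+i_h)(\mathbf u_h,\mathbf v_h)+b_h(p_h,\mathbf v_h)+b_h(q_h,\mathbf u_h)+c_h(\lambda_h,\mathbf v_h)+c_h(\mu_h,\mathbf u_h)+j_h(\lambda_h,\mu_h)=(\mathbf f,\mathbf v_h)_{\Omega_h}$$ for all $(\mathbf v_h,q_h,\mu_h)\in\mathbf V_h\times Q_h^0\times\Sigma_h$, then $\nabla\cdot\mathbf u_h=0$ in $\Omega_h^{\mathcal T}$.
   Context: Geometry and meshes. $d\in\{2,3\}$ and $k\ge d$ is an integer. $\Omega\subset\mathbb R^d$ is a bounded open domain with smooth boundary $\Gamma$, $\Omega=\{\phi<0\}$ for a smooth level set function $\phi$ that is approximately a signed distance function. $\Omega$ is embedded in a polytopal domain $\Omega^{\rm ext}$ with a shape-regular, quasi-uniform family of simplicial meshes $\widetilde{\mathcal T}_h^{\rm ext}$ of mesh size $h$. The active macro mesh is $\widetilde{\mathcal T}_h=\{T\in\widetilde{\mathcal T}_h^{\rm ext}:\operatorname{meas}_d(T\cap\Omega)>0\}$, with union $\Omega_h^{\widetilde{\mathcal T}}$. $\widetilde{\mathcal T}_h^{\rm Al}$ is its Alfeld split (each macro simplex is split by connecting its vertices to its barycenter), and $\widetilde{\mathcal T}_h^{\rm Al,\Gamma}=\{K\in\widetilde{\mathcal T}_h^{\rm Al}:\operatorname{meas}_{d-1}(K\cap\Gamma)>0\}$, with union $\widetilde\Omega_h^\Gamma$.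 $\phi_h$ is the continuous piecewise linear interpolant of $\phi$ on $\widetilde{\mathcal T}_h^{\rm Al}$, $\widetilde\Omega_h=\{\phi_h<0\}$, $\widetilde\Gamma_h=\partial\widetilde\Omega_h$. Mesh deformation ($\lesssim$: constants independent of $h$ and the cut configuration). $\boldsymbol\Phi_h$ is the isoparametric mesh deformation of degree $k$ associated with $\phi$: it is continuous and injective on $\Omega_h^{\widetilde{\mathcal T}}$, a vector polynomial of degree $k$ on each $\tilde K\in\widetilde{\mathcal T}_h^{\rm Al}$, and the identity on elements whose closure does not meet $\Omega_h^\Gamma:=\boldsymbol\Phi_h(\widetilde\Omega_h^\Gamma)$. With $K=\boldsymbol\Phi_h(\tilde K)$, $|\boldsymbol\Phi_h|_{W^{m,\infty}(\tilde K)}\lesssim1$, $|\boldsymbol\Phi_h^{-1}|_{W^{m,\infty}(K)}\lesssim 1$ for $0\le m\le k+1$, $\|D\boldsymbol\Phi_h-\mathbf I\|_{L^\infty(\Omega_h^{\widetilde{\mathcal T}})}\lesssim h$ (in particular the Jacobian determinants are positive), and $\|\phi-\phi_h\circ\boldsymbol\Phi_h^{-1}\|_{W^{m,\infty}(\Omega_h^\Gamma)}\lesssim h^{k+1-m}$ for $m=0,1$. Set $\Omega_h=\boldsymbol\Phi_h(\widetilde\Omega_h)$, $\Gamma_h=\boldsymbol\Phi_h(\widetilde\Gamma_h)=\partial\Omega_h$, $\mathcal T_h^{\rm Al}=\boldsymbol\Phi_h(\widetilde{\mathcal T}_h^{\rm Al})$ with union $\Omega_h^{\mathcal T}$, $\mathcal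 T_h^{\rm Al,\Gamma}=\boldsymbol\Phi_h(\widetilde{\mathcal T}_h^{\rm Al,\Gamma})$; it is understood that $\Omega_h\subset\Omega_h^{\mathcal T}$ and $\Gamma_h\subset\Omega_h^\Gamma$. $\mathbf n_h$ is the outward unit normal of $\Gamma_h$, extended to $\Omega_h^\Gamma$ by $\mathbf n_h=\nabla(\phi_h\circ\boldsymbol\Phi_h^{-1})/|\nabla(\phi_h\circ\boldsymbol\Phi_h^{-1})|$. Spaces. $\hat T$ is the reference simplex. For $K=\boldsymbol\Phi_h(\tilde K)\in\mathcal T_h^{\rm Al}$, $\varphi_K=\boldsymbol\Phi_h\circ\varphi_{\tilde K}:\hat T\to K$ with $\varphi_{\tilde K}:\hat T\to\tilde K$ affine, $F_K=D\varphi_K$, $J_K=\det F_K$. Lagrange nodes of $\mathcal T_h^{\rm Al}$ are $\boldsymbol\Phi_h$-images of the degree-$k$ Lagrange nodes of $\widetilde{\mathcal T}_h^{\rm Al}$. $\mathbf V_h$: all $\mathbf v_h\in \mathbf L^2(\Omega_h^{\mathcal T})$ with $\mathbf v_h|_K=(J_K^{-1}F_K\hat{\mathbf v}_h)\circ\varphi_K^{-1}$, $\hat{\mathbf v}_h\in[\mathbb P^k(\hat T)]^d$, for every $K\in\mathcal T_h^{\rm Al}$, single-valued at all Lagrange nodes of $\mathcal T_h^{\rm Al}$; one has $\mathbf V_h\subset\mathbf H(\mathrm{div};\Omega_h^{\mathcal T})$. $Q_h=\{q_h\in L^2(\Omega_h^{\mathcal T}):q_h|_K\circ\varphi_K\in\mathbb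 P^{k-1}(\hat T)\ \forall K\in\mathcal T_h^{\rm Al}\}$, $Q_h^0=Q_h\cap L^2_0(\Omega_h^{\mathcal T})$. $\Sigma_h=\{\lambda_h\in C(\Omega_h^\Gamma):\lambda_h|_K\circ\varphi_K\in\mathbb P^{k_\lambda}(\hat T)\ \forall K\in\mathcal T_h^{\rm Al,\Gamma}\}$, $k_\lambda\in\{k-1,k\}$. Gradients of functions in $\mathbf V_h$ are taken piecewise on $\mathcal T_h^{\rm Al}$. Ghost penalty. $\widetilde{\mathcal T}_h^\Gamma=\{T\in\widetilde{\mathcal T}_h:\operatorname{meas}_{d-1}(T\cap\Gamma)>0\}$, $\widetilde{\mathcal T}_h^{\rm gp}=\{T\in\widetilde{\mathcal T}_h:\exists T'\in\widetilde{\mathcal T}_h^\Gamma,\ \operatorname{meas}_{d-1}(T\cap T')>0\}$. $\widetilde{\mathcal F}_h^{\rm Al,gp}$: facets $\tilde K_1\cap\tilde K_2$ of $\widetilde{\mathcal T}_h^{\rm Al}$ with $\tilde K_1\ne\tilde K_2$ each contained in an element of $\widetilde{\mathcal T}_h^{\rm gp}$; $\mathcal F_h^{\rm Al,gp}=\boldsymbol\Phi_h(\widetilde{\mathcal F}_h^{\rm Al,gp})$. For $F=K_1\cap K_2\in\mathcal F_h^{\rm Al,gp}$, $\omega_F=K_1\cup K_2$, and $[\![\mathbf v_h]\!]_\omega|_{K_i}=\mathbf v_h|_{K_i}-\mathcal E^{\mathcal R}(\mathbf v_h\circ\boldsymbol\Phi_h|_{\tilde K_j})\circ\boldsymbol\Phi_h^{-1}$,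 $\{i,j\}=\{1,2\}$, where $\mathcal E^{\mathcal R}$ is the canonical global extension of rational functions. Forms ($\gamma_n,\gamma_{\rm gp},\gamma_\lambda>0$ fixed parameters; $\mathbf f$ a given source term, extended to $\Omega_h$): $a_h(\mathbf u,\mathbf v)=\int_{\Omega_h}\nabla\mathbf u:\nabla\mathbf v-\int_{\Gamma_h}(\mathbf n_h\cdot\nabla\mathbf u)\cdot\mathbf v-\int_{\Gamma_h}(\mathbf n_h\cdot\nabla\mathbf v)\cdot\mathbf u+\frac{\gamma_n}{h}\int_{\Gamma_h}\mathbf u\cdot\mathbf v$; $b_h(q,\mathbf v)=-\int_{\Omega_h^{\mathcal T}}q\,\nabla\cdot\mathbf v$; $c_h(\mu,\mathbf v)=\int_{\Gamma_h}\mu\,\mathbf n_h\cdot\mathbf v$; $i_h(\mathbf u,\mathbf v)=\gamma_{\rm gp}\sum_{F\in\mathcal F_h^{\rm Al,gp}}h^{-2}\int_{\omega_F}[\![\mathbf u]\!]_\omega\cdot[\![\mathbf v]\!]_\omega$; $j_h(\lambda,\mu)=h\gamma_\lambda\int_{\Omega_h^\Gamma}(\mathbf n_h\cdot\nabla\lambda)(\mathbf n_h\cdot\nabla\mu)$.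
   Formalization: The claim is proved for all sufficiently small mesh sizes h, with a threshold depending only on the level set function, the background domain, k and the hidden constants; for coarse meshes it can fail, e.g. when the discrete domain is empty and u_h(x)=x. *)

theory Defs
  imports "HOL-Analysis.Analysis"
begin

section \<open>Calculus\<close>

definition grad :: "(real^'n \<Rightarrow> real) \<Rightarrow> real^'n \<Rightarrow> real^'n" where
  "grad g x = (\<chi> i. frechet_derivative g (at x) (axis i 1))"

definition divergence :: "(real^'n \<Rightarrow> real^'n) \<Rightarrow> real^'n \<Rightarrow> real" where
  "divergence v x = trace (jacobian v (at x))"

text \<open>Iterated partial derivative in the directions listed (the last one is taken first).\<close>

primrec pderivs :: "'n list \<Rightarrow> (real^'n \<Rightarrow> 'b::real_normed_vector) \<Rightarrow> real^'n \<Rightarrow> 'b" where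
  "pderivs [] g = g"
| "pderivs (i # is) g = (\<lambda>x. frechet_derivative (pderivs is g) (at x) (axis i 1))"

definition smooth :: "(real^'n \<Rightarrow> real) \<Rightarrow> bool" where
  "smooth g \<longleftrightarrow> (\<forall>is x. pderivs is g differentiable (at x))"

text \<open>\<open>Winf_le m S g c\<close> states that the seminorm of order \<open>m\<close> of \<open>g\<close> in the space
  \<open>W^{m,\<infinity>}(S)\<close> is at most \<open>c\<close>. It is only used for open \<open>S\<close> on which \<open>g\<close> has continuous
  derivatives of order \<open>m\<close>, where the essential supremum is the supremum.\<close>

definition Winf_le ::
  "nat \<Rightarrow> (real^'n) set \<Rightarrow> (real^'n \<Rightarrow> 'b::real_normed_vector) \<Rightarrow> real \<Rightarrow> bool" where
  "Winf_le m S g c \<longleftrightarrow> (\<forall>is x. length is = m \<and> x \<in> S \<longrightarrow> norm (pderivs is g x) \<le> c)"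

definition square_integrable :: "(real^'n) set \<Rightarrow> (real^'n \<Rightarrow> real^'n) \<Rightarrow> bool" where
  "square_integrable S f \<longleftrightarrow>
     f \<in> borel_measurable (lebesgue_on S) \<and> (\<lambda>x. (norm (f x))\<^sup>2) integrable_on S"

text \<open>One-sided limit from inside \<open>K\<close>. Piecewise smooth functions are represented by ordinary
  functions whose values on the mesh skeleton (a null set) are irrelevant; their values there,
  seen from an element \<open>K\<close>, are taken by this trace.\<close>

definition inner_trace :: "(real^'n) set \<Rightarrow> (real^'n \<Rightarrow> 'b::t2_space) \<Rightarrow> real^'n \<Rightarrow> 'b" where
  "inner_trace K g x = Lim (at x within interior K) g"

text \<open>\<open>m\<close>-dimensional Hausdorff measure, \<open>m \<ge> 1\<close>, up to its normalising constant:
  it is only used to tell null sets from sets of positive measure.\<close>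

definition hausdorff_content :: "nat \<Rightarrow> real \<Rightarrow> (real^'n) set \<Rightarrow> ennreal" where
  "hausdorff_content m \<delta> A =
     (INF U \<in> {U :: nat \<Rightarrow> (real^'n) set.
                A \<subseteq> (\<Union>i. U i) \<and> (\<forall>i. bounded (U i) \<and> diameter (U i) \<le> \<delta>)}.
        \<Sum>i. ennreal (diameter (U i) ^ m))"

definition hausdorff :: "nat \<Rightarrow> (real^'n) set \<Rightarrow> ennreal" where
  "hausdorff m A = (SUP \<delta> \<in> {0<..}. hausdorff_content m \<delta> A)"

text \<open>Integral with respect to \<open>(d-1)\<close>-dimensional Lebesgue measure over a subset \<open>P\<close> of a
  hyperplane with unit normal \<open>\<nu>\<close>: the \<open>d\<close>-dimensional integral over the right prism of height 1
  with base \<open>P\<close>, the integrand being constant in direction \<open>\<nu>\<close>.\<close>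

definition plane_integral ::
  "real^'n \<Rightarrow> (real^'n) set \<Rightarrow> (real^'n \<Rightarrow> real) \<Rightarrow> real" where
  "plane_integral \<nu> P g =
     integral ((\<lambda>(x, t). x + t *\<^sub>R \<nu>) ` (P \<times> {0..1}))
       (\<lambda>y. g (THE x. x \<in> P \<and> (\<exists>t. y = x + t *\<^sub>R \<nu>)))"


section \<open>Polynomials and rational functions\<close>

definition polys :: "nat \<Rightarrow> (real^'n \<Rightarrow> real) set" where
  "polys k = {p. \<exists>c. p = (\<lambda>x. \<Sum>\<alpha> | (\<Sum>i\<in>UNIV. \<alpha> i) \<le> k. c \<alpha> * (\<Prod>i\<in>UNIV. (x $ i) ^ \<alpha> i))}"

definition vpolys :: "nat \<Rightarrow> (real^'n \<Rightarrow> real^'n) set" where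
  "vpolys k = {p. \<forall>i. (\<lambda>x. p x $ i) \<in> polys k}"

text \<open>Canonical extension of a function that is rational on \<open>S\<close> (a set with nonempty interior)
  to all points where some representation as a quotient has no pole.\<close>

definition rat_ext :: "(real^'n) set \<Rightarrow> (real^'n \<Rightarrow> real) \<Rightarrow> real^'n \<Rightarrow> real" where
  "rat_ext S r x =
     (THE y. \<exists>p q. real_polynomial_function p \<and> real_polynomial_function q \<and>
        (\<forall>z\<in>S. q z \<noteq> 0 \<and> r z = p z / q z) \<and> q x \<noteq> 0 \<and> y = p x / q x)"

definition vrat_ext :: "(real^'n) set \<Rightarrow> (real^'n \<Rightarrow> real^'n) \<Rightarrow> real^'n \<Rightarrow> real^'n" where
  "vrat_ext S r x = (\<chi> i. rat_ext S (\<lambda>z. r z $ i) x)"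


section \<open>Domains and simplices\<close>

definition polytopal_domain :: "(real^'n) set \<Rightarrow> bool" where
  "polytopal_domain S \<longleftrightarrow> open S \<and> connected S \<and> S \<noteq> {} \<and> S = interior (closure S) \<and>
     (\<exists>\<P>. finite \<P> \<and> (\<forall>P\<in>\<P>. polytope P) \<and> closure S = \<Union>\<P>)"

text \<open>\<open>\<phi>\<close> describes a bounded domain \<open>\<Omega> = {\<phi> < 0}\<close> and is an approximate signed distance
  function: in a neighbourhood of \<open>\<Gamma> = \<partial>\<Omega>\<close> the size of its gradient is comparable to 1 and its
  second derivatives are bounded. As \<open>\<phi>\<close> is smooth with nonvanishing gradient on \<open>\<Gamma>\<close>, the
  boundary \<open>\<Gamma>\<close> is smooth.\<close>

definition level_set_function :: "(real^'n \<Rightarrow> real) \<Rightarrow> bool" where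
  "level_set_function \<phi> \<longleftrightarrow> smooth \<phi> \<and>
     bounded {x. \<phi> x < 0} \<and> connected {x. \<phi> x < 0} \<and> {x. \<phi> x < 0} \<noteq> {} \<and>
     (\<exists>U c. open U \<and> frontier {x. \<phi> x < 0} \<subseteq> U \<and> 0 < c \<and>
        (\<forall>x\<in>U. c \<le> norm (grad \<phi> x) \<and> norm (grad \<phi> x) \<le> 1 / c) \<and>
        Winf_le 2 U \<phi> (1 / c))"

definition vertices :: "(real^'n) set \<Rightarrow> (real^'n) set" where
  "vertices T = {v. v extreme_point_of T}"

definition barycenter :: "(real^'n) set \<Rightarrow> real^'n" where
  "barycenter T = (1 / real (card (vertices T))) *\<^sub>R (\<Sum>v\<in>vertices T. v)"

definition alfeld_split :: "(real^'n) set \<Rightarrow> (real^'n) set set" where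
  "alfeld_split T = (\<lambda>v. convex hull (insert (barycenter T) (vertices T - {v}))) ` vertices T"

definition lagrange_nodes :: "nat \<Rightarrow> (real^'n) set \<Rightarrow> (real^'n) set" where
  "lagrange_nodes k K =
     {\<Sum>v\<in>vertices K. (real (\<alpha> v) / real k) *\<^sub>R v |\<alpha> :: real^'n \<Rightarrow> nat. (\<Sum>v\<in>vertices K. \<alpha> v) = k}"

definition ref_simplex :: "(real^'n) set" where
  "ref_simplex = convex hull (insert 0 Basis)"

text \<open>An affine parametrisation of the simplex \<open>K\<close>; nothing below depends on the choice.\<close>

definition ref_map :: "(real^'n) set \<Rightarrow> real^'n \<Rightarrow> real^'n" where
  "ref_map K = (SOME a. (\<exists>A b. a = (\<lambda>x. A *v x + b)) \<and> a ` ref_simplex = K)"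


section \<open>Unfitted discretisation\<close>

text \<open>Data of the discretisation: background macro mesh, level set function \<open>\<phi>\<close>, its piecewise
  linear interpolant \<open>\<phi>\<^sub>h\<close>, and mesh deformation \<open>\<Phi>\<^sub>h\<close>. Throughout, elements and facets of deformed
  meshes are denoted by the undeformed ones: \<open>K\<close> stands for the curved element \<open>\<Phi>\<^sub>h(K)\<close>.\<close>

record ('n::finite) disc =
  bg_mesh :: "(real^'n) set set"
  lset :: "real^'n \<Rightarrow> real"
  lset_h :: "real^'n \<Rightarrow> real"
  deform :: "real^'n \<Rightarrow> real^'n"

definition mesh_size :: "('n::finite) disc \<Rightarrow> real" where
  "mesh_size D = Max (diameter ` bg_mesh D)"

definition \<Omega> :: "('n::finite) disc \<Rightarrow> (real^'n) set" where
  "\<Omega> D = {x. lset D x < 0}"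

definition \<Gamma> :: "('n::finite) disc \<Rightarrow> (real^'n) set" where
  "\<Gamma> D = frontier (\<Omega> D)"

definition macro :: "('n::finite) disc \<Rightarrow> (real^'n) set set" where
  "macro D = {T \<in> bg_mesh D. measure lebesgue (T \<inter> \<Omega> D) > 0}"

definition alf :: "('n::finite) disc \<Rightarrow> (real^'n) set set" where
  "alf D = (\<Union>T\<in>macro D. alfeld_split T)"

definition alf_cut :: "('n::finite) disc \<Rightarrow> (real^'n) set set" where
  "alf_cut D = {K \<in> alf D. hausdorff (CARD('n) - 1) (K \<inter> \<Gamma> D) > 0}"

definition inv_deform :: "('n::finite) disc \<Rightarrow> real^'n \<Rightarrow> real^'n" where
  "inv_deform D = inv_into (\<Union>(macro D)) (deform D)"

definition \<Omega>t_h :: "('n::finite) disc \<Rightarrow> (real^'n) set" where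
  "\<Omega>t_h D = {x \<in> \<Union>(macro D). lset_h D x < 0}"

definition \<Gamma>t_h :: "('n::finite) disc \<Rightarrow> (real^'n) set" where
  "\<Gamma>t_h D = frontier (\<Omega>t_h D)"

definition \<Omega>_h :: "('n::finite) disc \<Rightarrow> (real^'n) set" where
  "\<Omega>_h D = deform D ` \<Omega>t_h D"

definition \<Gamma>_h :: "('n::finite) disc \<Rightarrow> (real^'n) set" where
  "\<Gamma>_h D = deform D ` \<Gamma>t_h D"

definition \<Omega>_mesh :: "('n::finite) disc \<Rightarrow> (real^'n) set" where
  "\<Omega>_mesh D = deform D ` \<Union>(macro D)"

definition \<Omega>_cut :: "('n::finite) disc \<Rightarrow> (real^'n) set" where
  "\<Omega>_cut D = deform D ` \<Union>(alf_cut D)"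

definition pl_interpolant ::
  "(real^'n) set set \<Rightarrow> (real^'n \<Rightarrow> real) \<Rightarrow> (real^'n \<Rightarrow> real) \<Rightarrow> bool" where
  "pl_interpolant \<K> g gh \<longleftrightarrow>
     (\<forall>K\<in>\<K>. (\<exists>a b. \<forall>x\<in>K. gh x = a \<bullet> x + b) \<and> (\<forall>v\<in>vertices K. gh v = g v))"

text \<open>Properties of the background mesh, with \<open>C\<close> bounding the shape-regularity and
  quasi-uniformity constants.\<close>

definition background_mesh :: "real \<Rightarrow> (real^'n) set \<Rightarrow> ('n::finite) disc \<Rightarrow> bool" where
  "background_mesh C \<Omega>ext D \<longleftrightarrow>
     triangulation (bg_mesh D) \<and> (\<forall>T\<in>bg_mesh D. int CARD('n) simplex T) \<and>
     \<Union>(bg_mesh D) = closure \<Omega>ext \<and>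
     (\<forall>T\<in>bg_mesh D. mesh_size D \<le> C * diameter T \<and> (\<exists>z. cball z (diameter T / C) \<subseteq> T))"

text \<open>Properties of the isoparametric mesh deformation of degree \<open>k\<close>, with all hidden constants
  bounded by \<open>C\<close>.\<close>

definition mesh_deformation :: "real \<Rightarrow> nat \<Rightarrow> ('n::finite) disc \<Rightarrow> bool" where
  "mesh_deformation C k D \<longleftrightarrow>
     continuous_on (\<Union>(macro D)) (deform D) \<and> inj_on (deform D) (\<Union>(macro D)) \<and>
     (\<forall>K\<in>alf D. \<exists>P\<in>vpolys k. \<forall>x\<in>K. deform D x = P x) \<and>
     (\<forall>K\<in>alf D. deform D ` K \<inter> \<Omega>_cut D = {} \<longrightarrow> (\<forall>x\<in>K. deform D x = x)) \<and>
     (\<forall>K\<in>alf D. \<forall>m\<le>k+1.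
        Winf_le m (interior K) (deform D) C \<and>
        Winf_le m (interior (deform D ` K)) (inv_deform D) C) \<and>
     (\<forall>K\<in>alf D. \<forall>x\<in>interior K.
        onorm (\<lambda>y. frechet_derivative (deform D) (at x) y - y) \<le> C * mesh_size D) \<and>
     (\<forall>K\<in>alf_cut D. \<forall>m\<le>1. \<forall>l\<le>m.
        Winf_le l (interior (deform D ` K)) (\<lambda>x. lset D x - lset_h D (inv_deform D x))
          (C * mesh_size D ^ (k + 1 - m)))"

definition admissible :: "real \<Rightarrow> nat \<Rightarrow> (real^'n) set \<Rightarrow> ('n::finite) disc \<Rightarrow> bool" where
  "admissible C k \<Omega>ext D \<longleftrightarrow>
     background_mesh C \<Omega>ext D \<and> pl_interpolant (alf D) (lset D) (lset_h D) \<and>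
     mesh_deformation C k D \<and> \<Gamma>_h D \<subseteq> \<Omega>_cut D"


section \<open>Discrete spaces\<close>

definition elem_map :: "('n::finite) disc \<Rightarrow> (real^'n) set \<Rightarrow> real^'n \<Rightarrow> real^'n" where
  "elem_map D K = deform D \<circ> ref_map K"

text \<open>Piecewise Piola-mapped polynomials; single-valuedness at a Lagrange node means that the
  one-sided limits from all adjacent elements agree.\<close>

definition V_h :: "nat \<Rightarrow> ('n::finite) disc \<Rightarrow> (real^'n \<Rightarrow> real^'n) set" where
  "V_h k D = {v.
     (\<forall>K\<in>alf D. \<exists>w\<in>vpolys k. \<forall>x\<in>interior ref_simplex.
        v (elem_map D K x) =
          (1 / det (jacobian (elem_map D K) (at x))) *\<^sub>R (jacobian (elem_map D K) (at x) *v w x)) \<and>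
     (\<forall>z\<in>(\<Union>K\<in>alf D. lagrange_nodes k K). \<forall>K\<in>alf D. \<forall>K'\<in>alf D. z \<in> K \<inter> K' \<longrightarrow>
        inner_trace (deform D ` K) v (deform D z) = inner_trace (deform D ` K') v (deform D z))}"

definition Q_h :: "nat \<Rightarrow> ('n::finite) disc \<Rightarrow> (real^'n \<Rightarrow> real) set" where
  "Q_h k D = {q. \<forall>K\<in>alf D. \<exists>w\<in>polys (k - 1). \<forall>x\<in>interior ref_simplex. q (elem_map D K x) = w x}"

definition Q0_h :: "nat \<Rightarrow> ('n::finite) disc \<Rightarrow> (real^'n \<Rightarrow> real) set" where
  "Q0_h k D = {q \<in> Q_h k D. integral (\<Omega>_mesh D) q = 0}"

definition \<Sigma>_h :: "nat \<Rightarrow> ('n::finite) disc \<Rightarrow> (real^'n \<Rightarrow> real) set" where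
  "\<Sigma>_h kl D = {l. continuous_on (\<Omega>_cut D) l \<and>
     (\<forall>K\<in>alf_cut D. \<exists>w\<in>polys kl. \<forall>x\<in>ref_simplex. l (elem_map D K x) = w x)}"


section \<open>Integration over the discrete boundary\<close>

definition n_h :: "('n::finite) disc \<Rightarrow> real^'n \<Rightarrow> real^'n" where
  "n_h D x = sgn (grad (\<lambda>y. lset_h D (inv_deform D y)) x)"

text \<open>The constant unit normal \<open>\<nabla>\<phi>\<^sub>h / |\<nabla>\<phi>\<^sub>h|\<close> on an undeformed element.\<close>

definition flat_normal :: "('n::finite) disc \<Rightarrow> (real^'n) set \<Rightarrow> real^'n" where
  "flat_normal D K = sgn (THE a. \<exists>b. \<forall>x\<in>K. lset_h D x = a \<bullet> x + b)"

text \<open>Surface integral over \<open>\<Gamma>\<^sub>h\<close>, the image under \<open>\<Phi>\<^sub>h\<close> of the planar pieces \<open>K \<inter> {\<phi>\<^sub>h = 0}\<close> of the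
  boundary of \<open>{\<phi>\<^sub>h < 0}\<close>: on each piece the surface element is \<open>|det D\<Phi>\<^sub>h| |D\<Phi>\<^sub>h\<^sup>-\<^sup>T \<nu>|\<close> times the
  planar one. Only elements meeting \<open>{\<phi>\<^sub>h < 0}\<close> contribute, so that a piece lying in a common facet
  of two elements is counted once. The integrand \<open>g K\<close> may depend on the element \<open>K\<close>, which thus
  lies on the side of \<open>\<Omega>\<^sub>h\<close>; traces of piecewise functions are taken from there.\<close>

definition surf_integral ::
  "('n::finite) disc \<Rightarrow> ((real^'n) set \<Rightarrow> real^'n \<Rightarrow> real) \<Rightarrow> real" where
  "surf_integral D g =
     (\<Sum>K | K \<in> alf D \<and> (\<exists>x\<in>K. lset_h D x < 0).
        plane_integral (flat_normal D K) {x \<in> K. lset_h D x = 0}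
          (\<lambda>x. g K (deform D x) *
             inner_trace K (\<lambda>z. \<bar>det (jacobian (deform D) (at z))\<bar> *
               norm (transpose (matrix_inv (jacobian (deform D) (at z))) *v flat_normal D K)) x))"

definition surf_integral_tr :: "('n::finite) disc \<Rightarrow> (real^'n \<Rightarrow> real) \<Rightarrow> real" where
  "surf_integral_tr D g = surf_integral D (\<lambda>K. inner_trace (deform D ` K) g)"


section \<open>Forms\<close>

text \<open>The inner product of matrices is the Frobenius product; \<open>n \<cdot> \<nabla>u\<close> is the derivative of \<open>u\<close> in
  direction \<open>n\<close>.\<close>

definition a_h :: "real \<Rightarrow> ('n::finite) disc \<Rightarrow> (real^'n \<Rightarrow> real^'n) \<Rightarrow> (real^'n \<Rightarrow> real^'n) \<Rightarrow> real" where
  "a_h \<gamma>n D u v =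
     integral (\<Omega>_h D) (\<lambda>x. jacobian u (at x) \<bullet> jacobian v (at x))
     - surf_integral_tr D (\<lambda>x. frechet_derivative u (at x) (n_h D x) \<bullet> v x)
     - surf_integral_tr D (\<lambda>x. frechet_derivative v (at x) (n_h D x) \<bullet> u x)
     + \<gamma>n / mesh_size D * surf_integral_tr D (\<lambda>x. u x \<bullet> v x)"

definition b_h :: "('n::finite) disc \<Rightarrow> (real^'n \<Rightarrow> real) \<Rightarrow> (real^'n \<Rightarrow> real^'n) \<Rightarrow> real" where
  "b_h D q v = - integral (\<Omega>_mesh D) (\<lambda>x. q x * divergence v x)"

definition c_h :: "('n::finite) disc \<Rightarrow> (real^'n \<Rightarrow> real) \<Rightarrow> (real^'n \<Rightarrow> real^'n) \<Rightarrow> real" where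
  "c_h D \<mu> v =
     surf_integral D (\<lambda>K x. \<mu> x * inner_trace (deform D ` K) (\<lambda>y. n_h D y \<bullet> v y) x)"

definition macro_cut :: "('n::finite) disc \<Rightarrow> (real^'n) set set" where
  "macro_cut D = {T \<in> macro D. hausdorff (CARD('n) - 1) (T \<inter> \<Gamma> D) > 0}"

definition macro_gp :: "('n::finite) disc \<Rightarrow> (real^'n) set set" where
  "macro_gp D = {T \<in> macro D. \<exists>T'\<in>macro_cut D. hausdorff (CARD('n) - 1) (T \<inter> T') > 0}"

text \<open>Ordered pairs of distinct elements sharing a facet, each contained in an element of
  \<open>macro_gp\<close>; the two orderings of a pair belong to the same facet.\<close>

definition gp_pairs :: "('n::finite) disc \<Rightarrow> ((real^'n) set \<times> (real^'n) set) set" where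
  "gp_pairs D = {(K, K'). K \<in> alf D \<and> K' \<in> alf D \<and> K \<noteq> K' \<and>
     K \<inter> K' facet_of K \<and> K \<inter> K' facet_of K' \<and>
     (\<exists>T\<in>macro_gp D. K \<subseteq> T) \<and> (\<exists>T\<in>macro_gp D. K' \<subseteq> T)}"

definition gp_facets :: "('n::finite) disc \<Rightarrow> (real^'n) set set" where
  "gp_facets D = (\<lambda>(K, K'). K \<inter> K') ` gp_pairs D"

text \<open>The jump on \<open>K\<close> across the facet shared by \<open>K\<close> and \<open>K'\<close>.\<close>

definition patch_jump ::
  "('n::finite) disc \<Rightarrow> (real^'n) set \<Rightarrow> (real^'n \<Rightarrow> real^'n) \<Rightarrow> real^'n \<Rightarrow> real^'n" where
  "patch_jump D K' v x = v x - vrat_ext (interior K') (v \<circ> deform D) (inv_deform D x)"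

text \<open>The integral over the patch of a facet \<open>F\<close> is the sum over its two elements, that is, over
  the two ordered pairs belonging to \<open>F\<close>.\<close>

definition i_h :: "real \<Rightarrow> ('n::finite) disc \<Rightarrow> (real^'n \<Rightarrow> real^'n) \<Rightarrow> (real^'n \<Rightarrow> real^'n) \<Rightarrow> real" where
  "i_h \<gamma>gp D u v =
     \<gamma>gp * (\<Sum>F\<in>gp_facets D. 1 / (mesh_size D)\<^sup>2 *
       (\<Sum>(K, K') | (K, K') \<in> gp_pairs D \<and> K \<inter> K' = F.
          integral (deform D ` K) (\<lambda>x. patch_jump D K' u x \<bullet> patch_jump D K' v x)))"

definition j_h :: "real \<Rightarrow> ('n::finite) disc \<Rightarrow> (real^'n \<Rightarrow> real) \<Rightarrow> (real^'n \<Rightarrow> real) \<Rightarrow> real" where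
  "j_h \<gamma>l D l \<mu> = mesh_size D * \<gamma>l *
     integral (\<Omega>_cut D) (\<lambda>x. (n_h D x \<bullet> grad l x) * (n_h D x \<bullet> grad \<mu> x))"

end

theory Submission
  imports Defs
begin

text \<open>
  The Piola transform turns \<open>u\<close> into a piecewise polynomial field \<open>w\<close> of degree \<open>k\<close> on the undeformed
  mesh with \<open>(\<nabla> \<cdot> u) \<circ> \<Phi> = (\<nabla> \<cdot> w) / det D\<Phi>\<close>. Hence \<open>b\<^sub>h(q, u)\<close> and \<open>c\<^sub>h(\<mu>, u)\<close> are integrals of \<open>w\<close> over flat
  simplices and planar pieces, without Jacobians. As \<open>w\<close> has continuous normal components, the
  divergence theorem on \<open>{\<phi>\<^sub>h < 0}\<close> and \<open>c\<^sub>h(1, u) = 0\<close> show that \<open>\<nabla> \<cdot> w\<close> has vanishing integral over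
  \<open>{\<phi>\<^sub>h < 0}\<close>. Testing with \<open>q \<circ> \<Phi> = Q - c\<close>, where \<open>Q\<close> is piecewise polynomial of degree \<open>k - 1\<close> and the
  constant \<open>c\<close> restores the mean value condition weighted by \<open>det D\<Phi>\<close>, shows that \<open>\<nabla> \<cdot> w\<close> is \<open>O(h)\<close>-close to
  a constant \<open>m\<close>, relative to \<open>m\<close>. For small \<open>h\<close> both facts together force \<open>m = 0\<close> and \<open>\<nabla> \<cdot> w = 0\<close>.\<close>

section \<open>Determinants\<close>

text \<open>The divergence of \<open>u\<close> cannot itself serve as the pressure test function:
  pulled back it is \<nabla> \<cdot> w divided by the Jacobian determinant \<open>J\<close>, which
  is rational and not polynomial. Only the numerator is available, and nothing gives it mean zero:
  no boundary condition acts on the outer boundary of the active mesh, and the multiplier sees the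
  flux only through the discrete interface inside it. The constant \<open>m\<close> that survives is
  the real obstacle. The pressure tests say that \<nabla> \<cdot> w - m J is orthogonal to all
  piecewise polynomials of degree \<open>k - 1\<close>. As \<nabla> \<cdot> w - m is one of them,
  its squared L2 norm is at most (m \<eta>)^2 A, where \<eta> bounds |J - 1| and A is the measure of
  the active mesh. Zero mean over the negative set of the discrete level set function then bounds
  |m| times the measure of that set by |m| \<eta> A. A is bounded by the measure of the closure of
  \<open>\<Omega>ext\<close>, and for small mesh size the negative set contains a fixed ball, so
  \<eta> can be fixed before any mesh is given; hence the threshold \<open>h0\<close> depends only
  on \<open>C\<close>, \<open>\<phi>\<close>, \<open>\<Omega>ext\<close> and the dimension.\<close>

lemma det_identity_plus_rank_one:
  fixes p \<nu> :: "real^'n"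
  shows "det (matrix (\<lambda>x. x + (\<nu> \<bullet> x) *\<^sub>R p)) = 1 + \<nu> \<bullet> p"
proof (cases "\<nu> = 0")
  case True
  then show ?thesis by (simp flip: id_def)
next
  case False
  \<comment> \<open>The coordinate is arbitrary. An orthogonal map takes the axis direction
    \<open>e\<close> to \<nu>, and conjugation preserves the determinant; in these coordinates the
    matrix is the identity with one column replaced, which Cramer's rule evaluates.\<close>
  define k :: 'n where "k = undefined"
  define e :: "real^'n" where "e = norm \<nu> *\<^sub>R axis k 1"
  have "norm e = norm \<nu>" by (simp add: e_def)
  then obtain T where T: "orthogonal_transformation T" "T e = \<nu>"
    using orthogonal_transformation_exists by metis
  have linT: "linear T" and injT: "inj T" and surjT: "surj T"
    using T(1) orthogonal_transformation_linear orthogonal_transformation_inj orthogonal_transformation_surj by blast+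
  obtain q where q: "T q = p" by (metis surjD[OF surjT])
  define f where "f = (\<lambda>x. x + (\<nu> \<bullet> x) *\<^sub>R p)"
  define g where "g = (\<lambda>x. x + (e \<bullet> x) *\<^sub>R q)"
  have inner: "T x \<bullet> T y = x \<bullet> y" for x y using T by (simp add: orthogonal_transformation_def)
  have linf: "linear f" unfolding f_def by (intro linearI) (auto simp: algebra_simps inner_simps)
  have ling: "linear g" unfolding g_def by (intro linearI) (auto simp: algebra_simps inner_simps)
  have "f (T x) = T (g x)" for x
    using T(2) q inner[of e x] by (simp add: f_def g_def linear_add[OF linT] linear_scale[OF linT])
  then have "f \<circ> T = T \<circ> g" by (auto simp: fun_eq_iff)
  then have "matrix f ** matrix T = matrix T ** matrix g"
    using matrix_compose[OF linT linf] matrix_compose[OF ling linT] by simp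
  then have "det (matrix f) * det (matrix T) = det (matrix T) * det (matrix g)"
    by (metis det_mul)
  moreover have "det (matrix T) \<noteq> 0" using det_nz_iff_inj[OF linT] injT by simp
  ultimately have fg: "det (matrix f) = det (matrix g)" by simp
  define x where "x = axis k 1 + norm \<nu> *\<^sub>R q"
  have "e \<bullet> axis j 1 = (if j = k then norm \<nu> else 0)" for j
    by (simp add: e_def inner_axis) (simp add: axis_def)
  then have "matrix g = (\<chi> i j. if j = k then (mat 1 *v x)$i else (mat 1 :: real^'n^'n)$i$j)"
    by (simp add: vec_eq_iff matrix_def g_def x_def) (auto simp: axis_def mat_def)
  then have "det (matrix g) = x $ k" using cramer_lemma[of k "mat 1" x] by simp
  also have "\<dots> = 1 + \<nu> \<bullet> p"
  proof -
    have "e \<bullet> q = norm \<nu> * q $ k" by (simp add: e_def inner_axis')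
    then show ?thesis using inner[of e q] T(2) q by (simp add: x_def axis_def)
  qed
  finally show ?thesis using fg by (simp add: f_def)
qed

text \<open>Normal components of Piola-transformed vectors only see the tangential part of the
  matrices: the cofactor of \<open>A\<close> applied to \<open>\<nu>\<close> depends only on \<open>A\<close> restricted to the
  orthogonal complement of \<open>\<nu>\<close>.\<close>

lemma piola_normal_component_eq:
  fixes A B :: "real^'n^'n" and \<nu> a b :: "real^'n"
  assumes "det A \<noteq> 0" "det B \<noteq> 0" "\<nu> \<noteq> 0"
    and tang: "\<And>t. \<nu> \<bullet> t = 0 \<Longrightarrow> A *v t = B *v t"
    and eq: "(1 / det A) *\<^sub>R (A *v a) = (1 / det B) *\<^sub>R (B *v b)"
  shows "\<nu> \<bullet> a = \<nu> \<bullet> b"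
proof -
  define c where "c = (1 / (\<nu> \<bullet> \<nu>)) *\<^sub>R (A *v \<nu> - B *v \<nu>)"
  have nn: "\<nu> \<bullet> \<nu> \<noteq> 0" using assms by simp
  obtain B' where B': "B ** B' = mat 1" "B' ** B = mat 1"
    using assms by (metis invertible_def invertible_det_nz)
  define q where "q = B' *v c"
  \<comment> \<open>\<open>A\<close> and \<open>B\<close> agree on the orthogonal complement of
    \<nu>, so \<open>A\<close> is \<open>B\<close> composed with a rank-one perturbation of the
    identity. The factor \<open>1 + \<nu> \<bullet> q\<close> then appears both in det A / det B and
    in the normal component of the perturbed vector, and cancels.\<close>
  have Ax: "A *v x = B *v (x + (\<nu> \<bullet> x) *\<^sub>R q)" for x
  proof -
    define s where "s = (\<nu> \<bullet> x) / (\<nu> \<bullet> \<nu>)"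
    define t where "t = x - s *\<^sub>R \<nu>"
    have "\<nu> \<bullet> t = 0" using nn by (simp add: t_def s_def inner_simps)
    then have "A *v t = B *v t" by (rule tang)
    then have "A *v x = B *v x + s *\<^sub>R (A *v \<nu> - B *v \<nu>)"
      by (simp add: t_def matrix_vector_mult_diff_distrib matrix_vector_mult_scaleR algebra_simps)
    also have "s *\<^sub>R (A *v \<nu> - B *v \<nu>) = (\<nu> \<bullet> x) *\<^sub>R c" by (simp add: s_def c_def)
    also have "c = B *v q" by (simp add: q_def matrix_vector_mul_assoc B')
    finally show ?thesis by (simp add: matrix_vector_right_distrib matrix_vector_mult_scaleR)
  qed
  define f where "f = (\<lambda>x. x + (\<nu> \<bullet> x) *\<^sub>R q)"
  have linf: "linear f" unfolding f_def by (intro linearI) (auto simp: algebra_simps inner_simps)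
  have "A = B ** matrix f"
  proof -
    have "A *v x = (B ** matrix f) *v x" for x
      using Ax[of x] linf by (simp add: f_def flip: matrix_vector_mul_assoc)
    then show ?thesis by (metis matrix_eq)
  qed
  then have dA: "det A = det B * (1 + \<nu> \<bullet> q)"
    using det_identity_plus_rank_one[of \<nu> q] by (simp add: det_mul f_def)
  have nz: "1 + \<nu> \<bullet> q \<noteq> 0" using dA assms by auto
  have "(1 / det A) *\<^sub>R (B' *v (A *v a)) = (1 / det B) *\<^sub>R (B' *v (B *v b))"
    using eq by (metis matrix_vector_mult_scaleR)
  then have "(1 / det A) *\<^sub>R (a + (\<nu> \<bullet> a) *\<^sub>R q) = (1 / det B) *\<^sub>R b"
    by (simp add: Ax matrix_vector_mul_assoc B')
  then have "\<nu> \<bullet> ((1 / det A) *\<^sub>R (a + (\<nu> \<bullet> a) *\<^sub>R q)) = \<nu> \<bullet> ((1 / det B) *\<^sub>R b)"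
    by simp
  then have "((\<nu> \<bullet> a) * (1 + \<nu> \<bullet> q)) / det A = (\<nu> \<bullet> b) / det B"
    by (simp add: inner_simps algebra_simps add_divide_distrib)
  then show ?thesis using nz assms(2) by (simp add: dA)
qed

text \<open>A permutation other than the identity moves at least two indices, so after
  differentiating one factor of its Leibniz product an off-diagonal zero of the identity matrix
  remains. Only the identity permutation contributes, and it gives the trace.\<close>

lemma has_derivative_det_mat_1:
  "(det has_derivative trace) (at (mat 1 :: real^'n^'n))"
proof -
  let ?P = "{p. p permutes (UNIV :: 'n set)}"
  let ?I = "mat 1 :: real^'n^'n"
  have fin: "finite ?P" by (simp add: finite_permutations)
  have "((\<lambda>X :: real^'n^'n. \<Sum>p\<in>?P. of_int (sign p) * (\<Prod>i\<in>UNIV. X$i$p i)) has_derivative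
      (\<lambda>H. \<Sum>p\<in>?P. of_int (sign p) * (\<Sum>i\<in>UNIV. H$i$p i * (\<Prod>j\<in>UNIV - {i}. ?I$j$p j)))) (at ?I)"
    by (intro has_derivative_sum has_derivative_mult_right has_derivative_prod
        bounded_linear_imp_has_derivative bounded_linear_compose[OF bounded_linear_vec_nth bounded_linear_vec_nth])
  moreover have "(\<Sum>p\<in>?P. of_int (sign p) * (\<Sum>i\<in>UNIV. H$i$p i * (\<Prod>j\<in>UNIV - {i}. ?I$j$p j))) = trace H"
    for H :: "real^'n^'n"
  proof -
    have "of_int (sign p) * (\<Sum>i\<in>UNIV. H$i$p i * (\<Prod>j\<in>UNIV - {i}. ?I$j$p j)) = (if p = id then trace H else 0)"
      if p: "p permutes UNIV" for p
    proof (cases "p = id")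
      case True then show ?thesis by (simp add: trace_def mat_def)
    next
      case False
      then obtain a where a: "p a \<noteq> a" by (auto simp: fun_eq_iff)
      have pa: "p (p a) \<noteq> p a" using a p by (metis permutes_def)
      have "\<exists>j\<in>UNIV - {i}. ?I$j$p j = 0" for i
      proof (cases "i = a")
        case True
        then show ?thesis using a pa by (auto simp: mat_def intro!: bexI[of _ "p a"])
      next
        case False
        then show ?thesis using a by (auto simp: mat_def intro!: bexI[of _ a])
      qed
      then have "(\<Prod>j\<in>UNIV - {i}. ?I$j$p j) = 0" for i
        by (intro prod_zero) auto
      then have "(\<Sum>i\<in>UNIV. H$i$p i * (\<Prod>j\<in>UNIV - {i}. ?I$j$p j)) = 0"
        by (simp only: mult_zero_right sum.neutral_const)
      then show ?thesis by (simp only: False if_False mult_zero_right)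
    qed
    then have "(\<Sum>p\<in>?P. of_int (sign p) * (\<Sum>i\<in>UNIV. H$i$p i * (\<Prod>j\<in>UNIV - {i}. ?I$j$p j)))
      = (\<Sum>p\<in>?P. if p = id then trace H else 0)" by (intro sum.cong) auto
    then show ?thesis using fin by (simp add: permutes_id)
  qed
  ultimately show ?thesis by (simp add: det_def[abs_def])
qed

lemma bounded_linear_matrix_mult_left: "bounded_linear (\<lambda>X :: real^'n^'n. A ** X)"
  by (intro linear_conv_bounded_linear[THEN iffD1] linearI)
     (auto simp: vec_eq_iff matrix_matrix_mult_def sum.distrib sum_distrib_left algebra_simps)

lemma bounded_linear_trace: "bounded_linear (trace :: real^'n^'n \<Rightarrow> real)"
  by (intro linear_conv_bounded_linear[THEN iffD1] linearI) (auto simp: trace_def sum.distrib sum_distrib_left)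

text \<open>Jacobi's formula, reduced to the derivative at the identity by writing det (F y) as det
  (F x) times det (B F y), with \<open>B\<close> the inverse of \<open>F x\<close>.\<close>

lemma has_derivative_det:
  fixes F :: "'a::real_normed_vector \<Rightarrow> real^'n^'n"
  assumes F: "(F has_derivative F') (at x)" and B: "B ** F x = mat 1"
  shows "((\<lambda>y. det (F y)) has_derivative (\<lambda>h. det (F x) * trace (B ** F' h))) (at x)"
proof -
  have FB: "F x ** B = mat 1" using B by (simp add: matrix_left_right_inverse)
  have "((\<lambda>y. det (F x) * det (B ** F y)) has_derivative (\<lambda>h. det (F x) * trace (B ** F' h))) (at x)"
    by (intro has_derivative_mult_right has_derivative_compose[OF
        bounded_linear.has_derivative[OF bounded_linear_matrix_mult_left F]])
      (use has_derivative_det_mat_1 B in simp)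
  moreover have "det (F x) * det (B ** F y) = det (F y)" for y
    by (metis FB det_mul matrix_mul_assoc matrix_mul_lid)
  ultimately show ?thesis by simp
qed

section \<open>Polynomials\<close>

text \<open>Total degree at most \<open>k\<close>, generated by multiplication with coordinates.
  Closure under affine substitution, differences and derivatives becomes rule induction instead of
  manipulation of the coefficient sums in \<open>polys\<close>; \<open>polys_iff_pdeg\<close>
  identifies the two notions.\<close>

inductive pdeg :: "nat \<Rightarrow> (real^'n \<Rightarrow> real) \<Rightarrow> bool" where
  pdeg_const: "pdeg k (\<lambda>x. c)"
| pdeg_add: "pdeg k p \<Longrightarrow> pdeg k q \<Longrightarrow> pdeg k (\<lambda>x. p x + q x)"
| pdeg_coord: "pdeg k p \<Longrightarrow> pdeg (Suc k) (\<lambda>x. x $ i * p x)"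

lemma pdeg_mono: "pdeg k p \<Longrightarrow> k \<le> l \<Longrightarrow> pdeg l p"
proof (induction arbitrary: l rule: pdeg.induct)
  case (pdeg_coord k p i)
  then obtain l' where "l = Suc l'" "k \<le> l'" by (metis Suc_le_D Suc_le_mono)
  then show ?case using pdeg_coord.IH pdeg.pdeg_coord by blast
qed (auto intro: pdeg.intros)

lemma pdeg_cmult: "pdeg k p \<Longrightarrow> pdeg k (\<lambda>x. c * p x)"
proof (induction rule: pdeg.induct)
  case (pdeg_coord k p i)
  then show ?case using pdeg.pdeg_coord[of k "\<lambda>x. c * p x" i] by (simp add: mult.left_commute)
qed (auto intro: pdeg.intros simp: distrib_left)

lemma pdeg_minus: "pdeg k p \<Longrightarrow> pdeg k q \<Longrightarrow> pdeg k (\<lambda>x. p x - q x)"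
  using pdeg_add[OF _ pdeg_cmult[of k q "-1"]] by simp

lemma pdeg_sum: "(\<And>i. i \<in> I \<Longrightarrow> pdeg k (p i)) \<Longrightarrow> pdeg k (\<lambda>x. \<Sum>i\<in>I. p i x)"
  by (induction I rule: infinite_finite_induct) (auto intro: pdeg.intros)

lemma pdeg_affine_mult: "pdeg k p \<Longrightarrow> pdeg (Suc k) (\<lambda>x. (a \<bullet> x + b) * p x)"
proof -
  assume p: "pdeg k p"
  have "pdeg (Suc k) (\<lambda>x. (\<Sum>i\<in>UNIV. a $ i * (x $ i * p x)) + b * p x)"
    by (intro pdeg_add pdeg_sum pdeg_cmult pdeg_coord p pdeg_mono[OF p]) auto
  also have "(\<lambda>x. (\<Sum>i\<in>UNIV. a $ i * (x $ i * p x)) + b * p x) = (\<lambda>x. (a \<bullet> x + b) * p x)"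
    by (auto simp: inner_vec_def distrib_right sum_distrib_right mult.assoc)
  finally show ?thesis .
qed

lemma pdeg_affine_compose:
  "pdeg k p \<Longrightarrow> pdeg k (\<lambda>x. p (A *v x + b))"
proof (induction rule: pdeg.induct)
  case (pdeg_coord k p i)
  then have "pdeg (Suc k) (\<lambda>x. (row i A \<bullet> x + b $ i) * p (A *v x + b))"
    by (intro pdeg_affine_mult)
  then show ?case by (simp add: matrix_vector_mul_component row_def)
qed (auto intro: pdeg.intros)

text \<open>Discrete product rule: (x_i + t_i) p(x + t) - x_i p(x) is x_i (p(x + t) - p(x)) + t_i
  p(x + t). Degree 0 is treated apart, since with truncated subtraction the induction hypothesis
  would give degree 1 for the first term.\<close>

lemma pdeg_shift_difference:
  "pdeg k p \<Longrightarrow> pdeg (k - 1) (\<lambda>x. p (x + t) - p x)"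
proof (induction rule: pdeg.induct)
  case (pdeg_coord k p i)
  have "pdeg k (\<lambda>x. x $ i * (p (x + t) - p x))"
  proof (cases k)
    case 0
    then obtain c where "p = (\<lambda>x. c)"
    proof -
      have "\<exists>c. p = (\<lambda>x. c)" if "pdeg 0 p" for p :: "real^'n \<Rightarrow> real"
        using that by (induction "0::nat" p rule: pdeg.induct) auto
      then show ?thesis using that pdeg_coord 0 by blast
    qed
    then show ?thesis by (auto intro: pdeg.intros)
  next
    case (Suc k')
    then show ?thesis using pdeg.pdeg_coord[OF pdeg_coord.IH] by simp
  qed
  moreover have "pdeg k (\<lambda>x. t $ i * p (x + t))"
    using pdeg_affine_compose[OF pdeg_coord.hyps, of "mat 1" t] by (intro pdeg_cmult) simp
  ultimately have "pdeg k (\<lambda>x. x $ i * (p (x + t) - p x) + t $ i * p (x + t))"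
    by (rule pdeg_add)
  then show ?case by (simp add: algebra_simps)
next
  case (pdeg_add k p q)
  then show ?case using pdeg.pdeg_add[OF pdeg_add.IH] by (simp add: algebra_simps)
qed (auto intro: pdeg.intros)

definition monomial :: "('n::finite \<Rightarrow> nat) \<Rightarrow> real^'n \<Rightarrow> real" where
  "monomial \<alpha> x = (\<Prod>i\<in>UNIV. (x $ i) ^ \<alpha> i)"

lemma finite_degree_le: "finite {\<alpha> :: 'n::finite \<Rightarrow> nat. (\<Sum>i\<in>UNIV. \<alpha> i) \<le> k}"
proof (rule finite_subset)
  show "{\<alpha>. (\<Sum>i\<in>UNIV. \<alpha> i) \<le> k} \<subseteq> {\<alpha> :: 'n \<Rightarrow> nat. \<alpha> ` UNIV \<subseteq> {..k}}"
    by (force intro: order_trans[OF member_le_sum])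
  show "finite {\<alpha> :: 'n \<Rightarrow> nat. \<alpha> ` UNIV \<subseteq> {..k}}"
    using finite_set_of_finite_funs[of "UNIV :: 'n set" "{..k}" 0] by (simp add: image_subset_iff)
qed

lemma monomial_upd_Suc: "monomial (\<alpha>(i := Suc (\<alpha> i))) x = x $ i * monomial \<alpha> x"
proof -
  have "monomial (\<alpha>(i := Suc (\<alpha> i))) x = (x $ i) ^ Suc (\<alpha> i) * (\<Prod>j\<in>UNIV - {i}. (x $ j) ^ \<alpha> j)"
    unfolding monomial_def by (subst prod.remove[of _ i]) (auto intro!: prod.cong)
  also have "\<dots> = x $ i * monomial \<alpha> x"
    unfolding monomial_def by (subst (2) prod.remove[of _ i]) auto
  finally show ?thesis .
qed

lemma sum_upd_Suc: "(\<Sum>j\<in>UNIV. (\<alpha>(i := Suc (\<alpha> i))) j) = Suc (\<Sum>j\<in>UNIV. \<alpha> (j::'n::finite))"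
  by (simp add: sum.remove[of UNIV i])

lemma pdeg_monomial: "pdeg (\<Sum>i\<in>UNIV. \<alpha> i) (monomial \<alpha>)"
proof (induction "\<Sum>i\<in>UNIV. \<alpha> i" arbitrary: \<alpha>)
  case 0
  then have "monomial \<alpha> = (\<lambda>x. 1)" by (auto simp: monomial_def)
  then show ?case by (auto intro: pdeg.intros)
next
  case (Suc n)
  then obtain i where i: "\<alpha> i \<noteq> 0" by (metis sum.neutral nat.distinct(1))
  define \<beta> where "\<beta> = \<alpha>(i := \<alpha> i - 1)"
  have \<alpha>: "\<alpha> = \<beta>(i := Suc (\<beta> i))" using i by (auto simp: \<beta>_def)
  have "n = (\<Sum>i\<in>UNIV. \<beta> i)" using Suc(2) sum_upd_Suc[of \<beta> i] \<alpha> by simp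
  then have "pdeg n (monomial \<beta>)" using Suc(1) by blast
  then have "pdeg (Suc n) (\<lambda>x. x $ i * monomial \<beta> x)" by (rule pdeg_coord)
  moreover have "(\<lambda>x. x $ i * monomial \<beta> x) = monomial \<alpha>"
    by (subst \<alpha>) (simp add: monomial_upd_Suc fun_eq_iff)
  ultimately show ?case using Suc(2) by simp
qed

lemma polys_iff_pdeg:
  fixes p :: "real^'n \<Rightarrow> real"
  shows "p \<in> polys k \<longleftrightarrow> pdeg k p"
proof
  assume "p \<in> polys k"
  then obtain c where p: "p = (\<lambda>x. \<Sum>\<alpha> | (\<Sum>i\<in>UNIV. \<alpha> i) \<le> k. c \<alpha> * monomial \<alpha> x)"
    by (auto simp: polys_def monomial_def)
  show "pdeg k p" unfolding p
    by (intro pdeg_sum pdeg_cmult pdeg_mono[OF pdeg_monomial]) auto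
next
  assume "pdeg k p"
  then show "p \<in> polys k"
  proof (induction rule: pdeg.induct)
    case (pdeg_const k a)
    have "(\<Sum>\<alpha> | (\<Sum>i\<in>UNIV. \<alpha> i) \<le> k. (if \<alpha> = (\<lambda>_. 0) then a else 0) * monomial \<alpha> x) = a" for x :: "real^'n"
    proof -
      have "(\<Sum>\<alpha> | (\<Sum>i\<in>UNIV. \<alpha> i) \<le> k. (if \<alpha> = (\<lambda>_. 0) then a else 0) * monomial \<alpha> x)
        = (\<Sum>\<alpha> :: 'n \<Rightarrow> nat | (\<Sum>i\<in>UNIV. \<alpha> i) \<le> k. if \<alpha> = (\<lambda>_. 0) then a else 0)"
        by (intro sum.cong) (auto simp: monomial_def)
      also have "\<dots> = a" by (subst sum.delta[OF finite_degree_le]) simp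
      finally show ?thesis .
    qed
    then show ?case unfolding polys_def monomial_def[symmetric]
      by (intro CollectI exI[of _ "\<lambda>\<alpha>. if \<alpha> = (\<lambda>_. 0) then a else 0"]) (simp add: fun_eq_iff)
  next
    case (pdeg_add k p q)
    then obtain c c' where "p = (\<lambda>x. \<Sum>\<alpha> | (\<Sum>i\<in>UNIV. \<alpha> i) \<le> k. c \<alpha> * monomial \<alpha> x)"
       "q = (\<lambda>x. \<Sum>\<alpha> | (\<Sum>i\<in>UNIV. \<alpha> i) \<le> k. c' \<alpha> * monomial \<alpha> x)"
      by (auto simp: polys_def monomial_def)
    then show ?case unfolding polys_def monomial_def[symmetric]
      by (intro CollectI exI[of _ "\<lambda>\<alpha>. c \<alpha> + c' \<alpha>"]) (simp add: fun_eq_iff distrib_right sum.distrib)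
  next
    case (pdeg_coord k p i)
    then obtain c where p: "p = (\<lambda>x. \<Sum>\<alpha> | (\<Sum>i\<in>UNIV. \<alpha> i) \<le> k. c \<alpha> * monomial \<alpha> x)"
      by (auto simp: polys_def monomial_def)
    \<comment> \<open>Multiplication by x_i raises one exponent, so coefficients are read off one
      step lower. The guard stops truncated subtraction from giving a coefficient to monomials free
      of x_i.\<close>
    define c' where "c' \<alpha> = (if \<alpha> i = 0 then 0 else c (\<alpha>(i := \<alpha> i - 1)))" for \<alpha>
    let ?up = "\<lambda>\<alpha>::'n \<Rightarrow> nat. \<alpha>(i := Suc (\<alpha> i))"
    have "(\<Sum>\<alpha> | (\<Sum>i\<in>UNIV. \<alpha> i) \<le> Suc k. c' \<alpha> * monomial \<alpha> x) = x $ i * p x" for x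
    proof -
      have "(\<Sum>\<alpha> | (\<Sum>i\<in>UNIV. \<alpha> i) \<le> Suc k. c' \<alpha> * monomial \<alpha> x)
          = (\<Sum>\<alpha> \<in> ?up ` {\<alpha>. (\<Sum>i\<in>UNIV. \<alpha> i) \<le> k}. c' \<alpha> * monomial \<alpha> x)"
      proof (rule sum.mono_neutral_right)
        show "finite {\<alpha> :: 'n \<Rightarrow> nat. (\<Sum>i\<in>UNIV. \<alpha> i) \<le> Suc k}" by (rule finite_degree_le)
        show "?up ` {\<alpha>. (\<Sum>i\<in>UNIV. \<alpha> i) \<le> k} \<subseteq> {\<alpha>. (\<Sum>i\<in>UNIV. \<alpha> i) \<le> Suc k}"
          by (auto simp: sum_upd_Suc simp del: fun_upd_apply)
        show "\<forall>\<alpha>\<in>{\<alpha>. (\<Sum>i\<in>UNIV. \<alpha> i) \<le> Suc k} - ?up ` {\<alpha>. (\<Sum>i\<in>UNIV. \<alpha> i) \<le> k}. c' \<alpha> * monomial \<alpha> x = 0"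
        proof
          fix \<alpha> assume \<alpha>: "\<alpha> \<in> {\<alpha>. (\<Sum>i\<in>UNIV. \<alpha> i) \<le> Suc k} - ?up ` {\<alpha>. (\<Sum>i\<in>UNIV. \<alpha> i) \<le> k}"
          have "\<alpha> i = 0"
          proof (rule ccontr)
            assume "\<alpha> i \<noteq> 0"
            then have eq: "\<alpha> = ?up (\<alpha>(i := \<alpha> i - 1))" by auto
            have "(\<Sum>j\<in>UNIV. (\<alpha>(i := \<alpha> i - 1)) j) \<le> k"
              using sum_upd_Suc[of "\<alpha>(i := \<alpha> i - 1)" i] \<alpha> eq by (simp del: fun_upd_apply)
            then have "\<alpha> \<in> ?up ` {\<alpha>. (\<Sum>i\<in>UNIV. \<alpha> i) \<le> k}" using eq by blast
            then show False using \<alpha> by blast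
          qed
          then show "c' \<alpha> * monomial \<alpha> x = 0" by (simp add: c'_def)
        qed
      qed
      also have "\<dots> = (\<Sum>\<alpha> | (\<Sum>i\<in>UNIV. \<alpha> i) \<le> k. c' (?up \<alpha>) * monomial (?up \<alpha>) x)"
      proof (rule sum.reindex_cong[OF _ refl])
        show "inj_on ?up {\<alpha>. (\<Sum>i\<in>UNIV. \<alpha> i) \<le> k}"
        proof (rule inj_onI)
          fix \<alpha> \<beta> :: "'n \<Rightarrow> nat" assume *: "?up \<alpha> = ?up \<beta>"
          show "\<alpha> = \<beta>"
          proof
            fix j show "\<alpha> j = \<beta> j" using fun_cong[OF *, of j] by (cases "j = i") auto
          qed
        qed
      qed simp
      also have "\<dots> = (\<Sum>\<alpha> | (\<Sum>i\<in>UNIV. \<alpha> i) \<le> k. x $ i * (c \<alpha> * monomial \<alpha> x))"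
        unfolding monomial_upd_Suc by (intro sum.cong) (auto simp: c'_def)
      finally show ?thesis by (simp add: p sum_distrib_left)
    qed
    then show ?case unfolding polys_def monomial_def[symmetric]
      by (intro CollectI exI[of _ c']) (simp add: fun_eq_iff)
  qed
qed

lemma pdeg_along_line:
  assumes "pdeg k p"
  obtains a where "\<And>s. p (y + s *\<^sub>R t) = (\<Sum>i\<le>k. a i * s ^ i)"
proof -
  have "\<exists>a. \<forall>s. p (y + s *\<^sub>R t) = (\<Sum>i\<le>k. a i * s ^ i)"
    using assms
  proof (induction rule: pdeg.induct)
    case (pdeg_const k c)
    have "c = (\<Sum>i\<le>k. (if i = 0 then c else 0) * s ^ i)" for s :: real
    proof -
      have "(\<Sum>i\<le>k. (if i = 0 then c else 0) * s ^ i) = (\<Sum>i\<le>k. if i = 0 then c else 0)"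
        by (intro sum.cong) auto
      then show ?thesis by (simp add: sum.delta)
    qed
    then show ?case by (intro exI[of _ "\<lambda>i. if i = 0 then c else 0"]) blast
  next
    case (pdeg_add k p q)
    then obtain a b where "\<forall>s. p (y + s *\<^sub>R t) = (\<Sum>i\<le>k. a i * s ^ i)" "\<forall>s. q (y + s *\<^sub>R t) = (\<Sum>i\<le>k. b i * s ^ i)"
      by auto
    then show ?case by (intro exI[of _ "\<lambda>i. a i + b i"]) (simp add: distrib_right sum.distrib)
  next
    case (pdeg_coord k p j)
    then obtain a where a: "\<forall>s. p (y + s *\<^sub>R t) = (\<Sum>i\<le>k. a i * s ^ i)" by auto
    define b where "b i = y $ j * (if i \<le> k then a i else 0) + t $ j * (case i of 0 \<Rightarrow> 0 | Suc i \<Rightarrow> a i)" for i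
    have "(\<Sum>i\<le>Suc k. b i * s ^ i) = (y + s *\<^sub>R t) $ j * p (y + s *\<^sub>R t)" for s
    proof -
      have "(\<Sum>i\<le>Suc k. (if i \<le> k then a i else 0) * s ^ i) = (\<Sum>i\<le>k. a i * s ^ i)" by simp
      moreover have "(\<Sum>i\<le>Suc k. (case i of 0 \<Rightarrow> 0 | Suc i \<Rightarrow> a i) * s ^ i) = s * (\<Sum>i\<le>k. a i * s ^ i)"
        by (subst sum.atMost_Suc_shift) (simp add: sum_distrib_left ac_simps)
      moreover have "(\<Sum>i\<le>Suc k. b i * s ^ i) = y $ j * (\<Sum>i\<le>Suc k. (if i \<le> k then a i else 0) * s ^ i)
          + t $ j * (\<Sum>i\<le>Suc k. (case i of 0 \<Rightarrow> 0 | Suc i \<Rightarrow> a i) * s ^ i)"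
        unfolding b_def distrib_right sum.distrib sum_distrib_left by (simp add: mult.assoc)
      ultimately show ?thesis using a by (simp add: algebra_simps)
    qed
    then show ?case by (intro exI[of _ b]) simp
  qed
  then show ?thesis using that by blast
qed

text \<open>Along the line, \<open>p\<close> minus its value at \<open>y\<close> is a univariate
  polynomial that vanishes at every natural number, so all its coefficients are zero.\<close>

lemma pdeg_periodic_imp_constant:
  assumes "pdeg k p" and "\<And>s. p (y + (s + 1) *\<^sub>R t) = p (y + s *\<^sub>R t)"
  shows "p (y + s *\<^sub>R t) = p y"
proof -
  obtain a where a: "\<And>s. p (y + s *\<^sub>R t) = (\<Sum>i\<le>k. a i * s ^ i)"
    using pdeg_along_line[OF assms(1)] by metis
  define c where "c i = (if i = 0 then a 0 - p y else a i)" for i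
  have c: "(\<Sum>i\<le>k. c i * s ^ i) = p (y + s *\<^sub>R t) - p y" for s
    unfolding a by (simp add: c_def sum.atMost_shift)
  have "p (y + real n *\<^sub>R t) = p y" for n
  proof (induction n)
    case (Suc n)
    then show ?case using assms(2)[of "real n"] by (simp add: add.commute)
  qed simp
  then have "range real \<subseteq> {x. (\<Sum>i\<le>k. c i * x ^ i) = 0}" using c by auto
  then have "infinite {x. (\<Sum>i\<le>k. c i * x ^ i) = 0}"
    using infinite_super[of "range real"] by (simp add: infinite_UNIV_nat finite_image_iff inj_on_def)
  then have "\<forall>i\<le>k. c i = 0" using polyfun_rootbound_finite by blast
  then have "(\<Sum>i\<le>k. c i * s ^ i) = 0" by simp
  then show ?thesis using c by simp
qed

text \<open>Differences in the directions \<open>t j\<close> lower the degree and vanish on the smaller lattice, so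
  by induction \<open>p\<close> is periodic along the spanned subspace, hence constant there.\<close>

lemma pdeg_zero_on_lattice:
  fixes t :: "'i \<Rightarrow> real^'n"
  assumes "pdeg k p" "finite J"
    and "\<And>m :: 'i \<Rightarrow> nat. sum m J \<le> k \<Longrightarrow> p (z + (\<Sum>j\<in>J. real (m j) *\<^sub>R t j)) = 0"
  shows "p (z + (\<Sum>j\<in>J. s j *\<^sub>R t j)) = 0"
  using assms
proof (induction k arbitrary: p s)
  case 0
  have "\<exists>c. p = (\<lambda>x. c)" using \<open>pdeg 0 p\<close> by (induction "0::nat" p rule: pdeg.induct) auto
  then show ?case using 0(3)[of "\<lambda>_. 0"] by auto
next
  case (Suc k)
  \<comment> \<open>If \<open>m\<close> has sum at most \<open>k\<close>, both \<open>m\<close> and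
    \<open>m\<close> raised by one at \<open>i\<close> lie in the lattice of size
    \<open>Suc k\<close>. Hence the difference \<open>q\<close> vanishes on the lattice of size
    \<open>k\<close> and the induction hypothesis applies to it.\<close>
  have per: "p (z + (\<Sum>j\<in>J. s j *\<^sub>R t j) + t i) = p (z + (\<Sum>j\<in>J. s j *\<^sub>R t j))" if i: "i \<in> J" for i s
  proof -
    define q where "q x = p (x + t i) - p x" for x
    have "pdeg k q" using pdeg_shift_difference[OF Suc(2), of "t i"] by (simp add: q_def[abs_def])
    moreover have "q (z + (\<Sum>j\<in>J. real (m j) *\<^sub>R t j)) = 0" if m: "sum m J \<le> k" for m
    proof -
      have "(\<Sum>j\<in>J. real ((m(i := Suc (m i))) j) *\<^sub>R t j) = (\<Sum>j\<in>J. real (m j) *\<^sub>R t j) + t i"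
        using i Suc(3) by (simp add: sum.remove[of J i] algebra_simps)
      moreover have "sum (m(i := Suc (m i))) J \<le> Suc k"
        using i m Suc(3) by (simp add: sum.remove[of J i])
      ultimately show ?thesis using Suc(4)[of "m(i := Suc (m i))"] Suc(4)[of m] m
        by (simp add: q_def add.assoc)
    qed
    ultimately have "q (z + (\<Sum>j\<in>J. s j *\<^sub>R t j)) = 0" using Suc(1,3) by blast
    then show ?thesis by (simp add: q_def)
  qed
  have line: "p (z + (\<Sum>j\<in>J. s j *\<^sub>R t j) + r *\<^sub>R t i) = p (z + (\<Sum>j\<in>J. s j *\<^sub>R t j))" if i: "i \<in> J" for i s r
  proof (rule pdeg_periodic_imp_constant[OF Suc(2)])
    fix r
    have "(\<Sum>j\<in>J. (s(i := s i + r)) j *\<^sub>R t j) = (\<Sum>j\<in>J. s j *\<^sub>R t j) + r *\<^sub>R t i"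
      using i Suc(3) by (simp add: sum.remove[of J i] algebra_simps)
    then show "p (z + (\<Sum>j\<in>J. s j *\<^sub>R t j) + (r + 1) *\<^sub>R t i) = p (z + (\<Sum>j\<in>J. s j *\<^sub>R t j) + r *\<^sub>R t i)"
      using per[OF i, of "s(i := s i + r)"] by (simp add: algebra_simps)
  qed
  \<comment> \<open>The coefficients \<open>s j\<close> are switched on one direction at a time,
    starting from the lattice point \<open>z\<close>; \<open>line\<close> shows that no step changes
    the value.\<close>
  have "p (z + (\<Sum>j\<in>J. (if j \<in> I then s j else 0) *\<^sub>R t j)) = 0" if "finite I" "I \<subseteq> J" for I
    using that
  proof (induction I rule: finite_induct)
    case empty
    then show ?case using Suc(4)[of "\<lambda>_. 0"] by simp
  next
    case (insert i I)
    have "(\<Sum>j\<in>J. (if j \<in> insert i I then s j else 0) *\<^sub>R t j)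
        = (\<Sum>j\<in>J. (if j \<in> I then s j else 0) *\<^sub>R t j) + s i *\<^sub>R t i"
    proof -
      have iJ: "i \<in> J" using insert by auto
      have "(\<Sum>j\<in>J - {i}. (if j \<in> insert i I then s j else 0) *\<^sub>R t j)
        = (\<Sum>j\<in>J - {i}. (if j \<in> I then s j else 0) *\<^sub>R t j)"
        by (intro sum.cong) auto
      then show ?thesis using iJ \<open>i \<notin> I\<close> Suc(3) by (simp add: sum.remove[of J i])
    qed
    then show ?case using line[of i "\<lambda>j. if j \<in> I then s j else 0" "s i"] insert by (simp add: add.assoc)
  qed
  from this[OF Suc(3) order_refl] show ?case by simp
qed

section \<open>Derivatives of polynomials and the Piola transform\<close>

lemma grad_unique: "(p has_derivative (\<lambda>h. g \<bullet> h)) (at x) \<Longrightarrow> grad p x = g"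
  by (auto simp: grad_def vec_eq_iff inner_axis dest!: frechet_derivative_at[symmetric])

lemma has_derivative_coord_mult:
  assumes "(p has_derivative (\<lambda>h. g \<bullet> h)) (at x)"
  shows "((\<lambda>x. x $ i * p x) has_derivative (\<lambda>h. (p x *\<^sub>R axis i 1 + x $ i *\<^sub>R g) \<bullet> h)) (at x)"
proof -
  have "((\<lambda>x. x $ i * p x) has_derivative (\<lambda>h. x $ i * (g \<bullet> h) + h $ i * p x)) (at x)"
    by (intro has_derivative_mult assms bounded_linear_imp_has_derivative bounded_linear_vec_nth)
  then show ?thesis by (simp add: inner_simps inner_axis' algebra_simps)
qed

lemma pdeg_has_derivative:
  fixes p :: "real^'n \<Rightarrow> real"
  assumes "pdeg k p"
  shows "(p has_derivative (\<lambda>h. grad p x \<bullet> h)) (at x)" and "pdeg (k - 1) (\<lambda>x. grad p x $ i)"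
proof -
  have *: "(\<forall>x. (p has_derivative (\<lambda>h. grad p x \<bullet> h)) (at x)) \<and> (\<forall>i. pdeg (k - 1) (\<lambda>x. grad p x $ i))"
    using assms
  proof (induction rule: pdeg.induct)
    case (pdeg_const k c)
    have "((\<lambda>_. c) has_derivative (\<lambda>h. 0 \<bullet> h)) (at x)" for x :: "real^'n" by simp
    from grad_unique[OF this] this show ?case by (auto intro: pdeg.intros)
  next
    case (pdeg_add k p q)
    have d: "((\<lambda>x. p x + q x) has_derivative (\<lambda>h. (grad p x + grad q x) \<bullet> h)) (at x)" for x
      using pdeg_add.IH has_derivative_add by (fastforce simp: inner_add_left)
    show ?case unfolding grad_unique[OF d] using pdeg_add.IH d by (auto intro!: pdeg.intros)
  next
    case (pdeg_coord k p i)
    have d: "((\<lambda>x. x $ i * p x) has_derivative (\<lambda>h. (p x *\<^sub>R axis i 1 + x $ i *\<^sub>R grad p x) \<bullet> h)) (at x)" for x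
      using pdeg_coord.IH by (intro has_derivative_coord_mult) auto
    have "pdeg k (\<lambda>x. (p x *\<^sub>R axis i 1 + x $ i *\<^sub>R grad p x) $ j)" for j
    proof -
      have "pdeg k (\<lambda>x. x $ i * grad p x $ j)"
      proof (cases k)
        case 0
        have "\<exists>c. p = (\<lambda>x. c)" using \<open>pdeg k p\<close> unfolding 0
          by (induction "0::nat" p rule: pdeg.induct) auto
        then obtain c where "p = (\<lambda>x. c)" by blast
        then have "grad p x = 0" for x using grad_unique[of p 0 x] by simp
        then show ?thesis by (auto intro: pdeg.intros)
      next
        case (Suc k')
        then show ?thesis using pdeg_coord.IH pdeg.pdeg_coord[of k' "\<lambda>x. grad p x $ j" i] by simp
      qed
      then show ?thesis using pdeg_add[OF pdeg_cmult[OF pdeg_coord.hyps, of "axis i 1 $ j"]] by (simp add: mult.commute)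
    qed
    then show ?case unfolding grad_unique[OF d] using d by simp
  qed
  then show "(p has_derivative (\<lambda>h. grad p x \<bullet> h)) (at x)" "pdeg (k - 1) (\<lambda>x. grad p x $ i)" by auto
qed

text \<open>Needed in \<open>divergence_piola\<close>, where the derivative of the Jacobian in
  direction \<open>h\<close>, applied to \<open>g\<close>, has to be exchanged with the one in
  direction \<open>g\<close>, applied to \<open>h\<close>.\<close>

lemma pdeg_grad_symmetric:
  fixes p :: "real^'n \<Rightarrow> real"
  assumes "pdeg k p"
  shows "grad (\<lambda>x. grad p x $ i) x $ j = grad (\<lambda>x. grad p x $ j) x $ i"
  using assms
proof (induction arbitrary: i j rule: pdeg.induct)
  case (pdeg_const k c)
  have "grad (\<lambda>_. c) x = 0" for x :: "real^'n" and c by (rule grad_unique) simp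
  then show ?case by simp
next
  case (pdeg_add k p q)
  have d: "grad (\<lambda>x. p x + q x) x = grad p x + grad q x" if "pdeg k p" "pdeg k q" for k p q and x :: "real^'n"
    using has_derivative_add[OF pdeg_has_derivative(1)[OF that(1)] pdeg_has_derivative(1)[OF that(2)]]
    by (intro grad_unique) (simp add: inner_add_left)
  show ?case
    using pdeg_add.IH d[OF pdeg_has_derivative(2)[OF pdeg_add.hyps(1)] pdeg_has_derivative(2)[OF pdeg_add.hyps(2)]]
    by (simp add: d[OF pdeg_add.hyps])
next
  case (pdeg_coord k p m)
  note dp = pdeg_has_derivative(1)[OF pdeg_coord.hyps] 
  note d1 = grad_unique[OF has_derivative_coord_mult[OF dp]]
  note d2 = pdeg_has_derivative(1)[OF pdeg_has_derivative(2)[OF pdeg_coord.hyps]]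
  have "grad (\<lambda>x. grad (\<lambda>x. x $ m * p x) x $ i) x
      = (axis m 1 $ i) *\<^sub>R grad p x + (grad p x $ i *\<^sub>R axis m 1 + x $ m *\<^sub>R grad (\<lambda>x. grad p x $ i) x)" for i
  proof (rule grad_unique)
    have "((\<lambda>x. axis m 1 $ i * p x + x $ m * grad p x $ i) has_derivative
      (\<lambda>h. axis m 1 $ i * (grad p x \<bullet> h) + (grad p x $ i *\<^sub>R axis m 1 + x $ m *\<^sub>R grad (\<lambda>x. grad p x $ i) x) \<bullet> h)) (at x)"
      by (intro has_derivative_add has_derivative_mult_right dp has_derivative_coord_mult d2)
    moreover have "(\<lambda>x. grad (\<lambda>x. x $ m * p x) x $ i) = (\<lambda>x. axis m 1 $ i * p x + x $ m * grad p x $ i)"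
      by (rule ext, subst d1) (simp add: mult.commute)
    ultimately show "((\<lambda>x. grad (\<lambda>x. x $ m * p x) x $ i) has_derivative
      (\<lambda>h. ((axis m 1 $ i) *\<^sub>R grad p x + (grad p x $ i *\<^sub>R axis m 1 + x $ m *\<^sub>R grad (\<lambda>x. grad p x $ i) x)) \<bullet> h)) (at x)"
      by (simp add: inner_add_left)
  qed
  then show ?case using pdeg_coord.IH by (simp add: axis_def)
qed

lemma pdeg_continuous_on: "pdeg k p \<Longrightarrow> continuous_on S p"
  by (meson continuous_at_imp_continuous_on has_derivative_continuous pdeg_has_derivative(1))

lemma vpolys_has_derivative:
  fixes P :: "real^'n \<Rightarrow> real^'n"
  assumes "P \<in> vpolys k"
  shows "(P has_derivative (\<lambda>h. jacobian P (at x) *v h)) (at x)"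
    and "jacobian P (at x) $ i $ j = grad (\<lambda>x. P x $ i) x $ j"
    and "pdeg (k - 1) (\<lambda>x. jacobian P (at x) $ i $ j)"
proof -
  have pd: "pdeg k (\<lambda>x. P x $ i)" for i using assms by (auto simp: vpolys_def polys_iff_pdeg)
  have "(P has_derivative (\<lambda>h. \<chi> i. grad (\<lambda>x. P x $ i) x \<bullet> h)) (at x)" for x
    by (subst has_derivative_componentwise_within)
       (auto simp: Basis_vec_def inner_axis intro!: pdeg_has_derivative(1)[OF pd])
  then have diff: "P differentiable (at x)" for x by (auto simp: differentiable_def)
  then show "(P has_derivative (\<lambda>h. jacobian P (at x) *v h)) (at x)" using jacobian_works by blast
  have J: "jacobian P (at x) $ i $ j = grad (\<lambda>x. P x $ i) x $ j" for x i j
  proof -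
    have "(P has_derivative (\<lambda>h. jacobian P (at x) *v h)) (at x)" using diff jacobian_works by blast
    then have "((\<lambda>x. P x $ i) has_derivative (\<lambda>h. (jacobian P (at x) *v h) $ i)) (at x)"
      by (rule bounded_linear.has_derivative[OF bounded_linear_vec_nth])
    then have "((\<lambda>x. P x $ i) has_derivative (\<lambda>h. jacobian P (at x) $ i \<bullet> h)) (at x)"
      by (simp add: matrix_vector_mul_component)
    then show ?thesis using grad_unique by fastforce
  qed
  then show "jacobian P (at x) $ i $ j = grad (\<lambda>x. P x $ i) x $ j" .
  show "pdeg (k - 1) (\<lambda>x. jacobian P (at x) $ i $ j)"
    unfolding J by (rule pdeg_has_derivative(2)[OF pd])
qed

lemma pdeg_divergence: "w \<in> vpolys k \<Longrightarrow> pdeg (k - 1) (divergence w)"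
  unfolding divergence_def[abs_def] trace_def by (intro pdeg_sum vpolys_has_derivative(3))

lemma continuous_on_jacobian: "P \<in> vpolys k \<Longrightarrow> continuous_on S (\<lambda>x. jacobian P (at x))"
  by (subst vec_lambda_eta[symmetric], intro continuous_on_vec_lambda,
      subst vec_lambda_eta[symmetric], intro continuous_on_vec_lambda)
     (rule pdeg_continuous_on[OF vpolys_has_derivative(3)])

lemma continuous_on_vpolys: "P \<in> vpolys k \<Longrightarrow> continuous_on S P"
  by (meson continuous_at_imp_continuous_on has_derivative_continuous vpolys_has_derivative(1))

lemma continuous_on_det:
  "continuous_on S F \<Longrightarrow> continuous_on S (\<lambda>x. det (F x :: real^'n^'n))"
  unfolding det_def by (intro continuous_intros)

lemma bounded_bilinear_matrix_vector_mult:
  "bounded_bilinear (\<lambda>(A :: real^'n^'n) x. A *v x)"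
  by (intro bilinear_conv_bounded_bilinear[THEN iffD1])
     (auto simp: bilinear_def matrix_vector_right_distrib matrix_vector_mult_add_rdistrib
       matrix_vector_mult_scaleR scaleR_matrix_vector_assoc intro!: linearI)

lemma trace_rank_one:
  fixes f :: "real^'n \<Rightarrow> real"
  assumes "linear f"
  shows "trace (matrix (\<lambda>h. f h *\<^sub>R w)) = f w"
proof -
  have "f w = f (\<Sum>i\<in>UNIV. w $ i *\<^sub>R axis i 1)" by (simp add: basis_expansion flip: scalar_mult_eq_scaleR)
  also have "\<dots> = (\<Sum>i\<in>UNIV. w $ i * f (axis i 1))" by (simp add: linear_sum[OF assms] linear_scale[OF assms])
  finally show ?thesis by (simp add: trace_def matrix_def mult.commute)
qed

lemma trace_matrix_combination:
  fixes f :: "real^'n \<Rightarrow> real^'n"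
  shows "trace (matrix (\<lambda>h. c *\<^sub>R (A *v h) - c *\<^sub>R f h)) = c * trace A - c * trace (matrix f)"
  by (simp add: trace_def matrix_def sum_subtractf sum_distrib_left matrix_vector_mult_basis column_def)

text \<open>Piola identity. Differentiating J w / det J produces, besides the term with the
  derivative of \<open>w\<close>, one term from J and one from 1 / det J. After multiplication by
  the inverse of J their traces are, up to the factor 1 / det J, the trace of h \<mapsto> B (DJ[h]
  w) and minus tr (B DJ[w]); by symmetry of second derivatives they cancel.\<close>

theorem divergence_piola:
  fixes P w u :: "real^'n \<Rightarrow> real^'n"
  assumes P: "P \<in> vpolys k" and w: "w \<in> vpolys k'"
    and S: "open S" "z \<in> S" and inj: "inj_on P S"
    and dz: "det (jacobian P (at z)) \<noteq> 0"
    and u: "\<And>x. x \<in> S \<Longrightarrow> u (P x) = (1 / det (jacobian P (at x))) *\<^sub>R (jacobian P (at x) *v w x)"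
  shows "divergence u (P z) = divergence w z / det (jacobian P (at z))"
proof -
  define J where "J x = jacobian P (at x)" for x
  define W where "W = jacobian w (at z)"
  define J' where "J' h = (\<chi> i j. grad (\<lambda>x. J x $ i $ j) z \<bullet> h)" for h
  obtain B where B: "B ** J z = mat 1" "J z ** B = mat 1"
    using dz by (metis J_def invertible_def invertible_det_nz)
  have Jder: "(J has_derivative J') (at z)"
    unfolding J'_def
    by (subst has_derivative_componentwise_within)
       (auto simp: Basis_vec_def inner_axis J_def intro!: pdeg_has_derivative(1)[OF vpolys_has_derivative(3)[OF P]])
  have J'lin: "linear J'" using Jder by (rule has_derivative_linear)
  have J'sym: "J' h *v g = J' g *v h" for h g
  proof -
    have "pdeg k (\<lambda>x. P x $ i)" for i using P by (auto simp: vpolys_def polys_iff_pdeg)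
    then have sym: "grad (\<lambda>x. J x $ i $ j) z $ l = grad (\<lambda>x. J x $ i $ l) z $ j" for i j l
      unfolding J_def vpolys_has_derivative(2)[OF P] by (rule pdeg_grad_symmetric)
    have "(J' h *v g) $ i = (\<Sum>j\<in>UNIV. \<Sum>l\<in>UNIV. grad (\<lambda>x. J x $ i $ j) z $ l * h $ l * g $ j)" for i h g
      by (simp add: J'_def matrix_vector_mult_def inner_vec_def sum_distrib_right)
    then have "(J' h *v g) $ i = (J' g *v h) $ i" for i
      by (simp only:) (subst sum.swap, subst sym, simp add: mult_ac)
    then show ?thesis by (simp add: vec_eq_iff)
  qed
  define v where "v x = (1 / det (J x)) *\<^sub>R (J x *v w x)" for x
  define v' where "v' h = (1 / det (J z)) *\<^sub>R (J z *v (W *v h) + J' h *v w z)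
      - (trace (B ** J' h) / det (J z)) *\<^sub>R (J z *v w z)" for h
  have "((\<lambda>x. J x *v w x) has_derivative (\<lambda>h. J z *v (W *v h) + J' h *v w z)) (at z)"
    using bounded_bilinear.FDERIV[OF bounded_bilinear_matrix_vector_mult Jder vpolys_has_derivative(1)[OF w]]
    by (simp add: W_def)
  note dw = this
  have "((\<lambda>x. 1 / det (J x)) has_derivative (\<lambda>h. - (trace (B ** J' h) / det (J z)))) (at z)"
    by (rule has_derivative_eq_rhs, rule has_derivative_divide[OF has_derivative_const has_derivative_det[OF Jder B(1)]])
       (use dz in \<open>auto simp: J_def field_simps fun_eq_iff\<close>)
  from has_derivative_scaleR[OF this dw] have vder: "(v has_derivative v') (at z)"
    unfolding v_def v'_def by (rule has_derivative_eq_rhs) (simp add: fun_eq_iff)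
  define g where "g = inv_into S P"
  have gP: "g (P x) = x" if "x \<in> S" for x using inj that by (simp add: g_def)
  have gder: "(g has_derivative ((*v) B)) (at (P z))"
    using vpolys_has_derivative(1)[OF P, of z] B
    by (intro has_derivative_inverse_strong[OF S continuous_on_vpolys[OF P] gP])
       (auto simp: J_def fun_eq_iff matrix_vector_mul_assoc)
  have "((\<lambda>y. v (g y)) has_derivative (\<lambda>h. v' (B *v h))) (at (P z))"
    using has_derivative_compose[OF gder, of v v'] vder gP S by simp
  moreover have "open (P ` S)" by (rule invariance_of_domain[OF continuous_on_vpolys[OF P] S(1) inj])
  moreover have "v (g y) = u y" if "y \<in> P ` S" for y
    using that by (auto simp: gP u v_def J_def)
  ultimately have uder: "(u has_derivative (\<lambda>h. v' (B *v h))) (at (P z))"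
    using S(2) by (metis (no_types, lifting) has_derivative_transform_within_open imageI)
  have v'lin: "linear v'" using vder by (rule has_derivative_linear)
  have "jacobian u (at (P z)) = matrix (v' \<circ> (*v) B)"
    using frechet_derivative_at[OF uder, symmetric] by (simp add: jacobian_def o_def)
  also have "\<dots> = matrix v' ** B"
    using matrix_compose[OF matrix_vector_mul_linear v'lin] by simp
  finally have "divergence u (P z) = trace (B ** matrix v')"
    unfolding divergence_def by (simp only:) (rule trace_mul_sym)
  also have "B ** matrix v' = matrix (\<lambda>h. B *v v' h)"
    using matrix_compose[OF v'lin matrix_vector_mul_linear[of B]] by (simp add: o_def)
  also have "(\<lambda>h. B *v v' h) = (\<lambda>h. (1 / det (J z)) *\<^sub>R ((W + B ** J' (w z)) *v h)
      - (1 / det (J z)) *\<^sub>R (trace (B ** J' h) *\<^sub>R w z))"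
  proof
    fix h
    have BJ: "B *v (J z *v x) = x" for x by (simp add: matrix_vector_mul_assoc B)
    have "B *v v' h = (1 / det (J z)) *\<^sub>R (W *v h + B *v (J' (w z) *v h))
      - (trace (B ** J' h) / det (J z)) *\<^sub>R w z"
      unfolding v'_def J'sym[of h "w z"]
      by (simp only: matrix_vector_mult_diff_distrib matrix_vector_mult_scaleR matrix_vector_right_distrib BJ)
    then show "B *v v' h = (1 / det (J z)) *\<^sub>R ((W + B ** J' (w z)) *v h)
      - (1 / det (J z)) *\<^sub>R (trace (B ** J' h) *\<^sub>R w z)"
      by (simp add: matrix_vector_mult_add_rdistrib matrix_vector_mul_assoc)
  qed
  also have "trace (matrix \<dots>) = (1 / det (J z)) * trace (W + B ** J' (w z))
      - (1 / det (J z)) * trace (matrix (\<lambda>h. trace (B ** J' h) *\<^sub>R w z))"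
    by (rule trace_matrix_combination)
  \<comment> \<open>This is the contribution of 1 / det J. It equals the term that
    \<open>J'sym\<close> produced from the derivative of J, so only the trace of \<open>W\<close> is
    left.\<close>
  also have "trace (matrix (\<lambda>h. trace (B ** J' h) *\<^sub>R w z)) = trace (B ** J' (w z))"
    by (rule trace_rank_one[OF linear_compose[OF J'lin linear_compose[OF
       bounded_linear.linear[OF bounded_linear_matrix_mult_left] bounded_linear.linear[OF bounded_linear_trace]], unfolded o_def]])
  finally show ?thesis by (simp add: trace_add divergence_def W_def J_def add_divide_distrib)
qed

section \<open>Change of variables\<close>

text \<open>The change of variables theorem of the library requires a well-ordered index type. The index
  types \<open>2\<close> and \<open>3\<close> are well-ordered, and any \<open>'n\<close> with 2 or 3 elements is reindexed by one of them.\<close>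

definition reindex :: "('m \<Rightarrow> 'n) \<Rightarrow> real^'n \<Rightarrow> real^'m" where
  "reindex \<sigma> x = (\<chi> i. x $ \<sigma> i)"

lemma linear_reindex: "linear (reindex \<sigma>)"
  by (intro linearI) (auto simp: reindex_def vec_eq_iff)

lemma prod_Basis_vec: "(\<Prod>b\<in>Basis. x \<bullet> b) = (\<Prod>i\<in>UNIV. (x :: real^'n) $ i)"
proof -
  have B: "(Basis :: (real^'n) set) = range (\<lambda>i. axis i 1)"
    by (auto simp: Basis_vec_def)
  have inj: "inj (\<lambda>i. axis i 1 :: real^'n)" by (auto simp: inj_def axis_eq_axis)
  show ?thesis unfolding B by (simp add: prod.reindex[OF inj] inner_axis)
qed

context
  fixes \<sigma> :: "'m::finite \<Rightarrow> 'n::finite"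
  assumes \<sigma>: "bij \<sigma>"
begin

lemma reindex_inverse: "reindex (inv \<sigma>) (reindex \<sigma> x) = x" "reindex \<sigma> (reindex (inv \<sigma>) y) = y"
  using \<sigma> by (auto simp: reindex_def vec_eq_iff bij_is_surj bij_is_inj surj_f_inv_f)

lemma reindex_vimage: "reindex \<sigma> -` S = reindex (inv \<sigma>) ` S"
proof (intro equalityI subsetI)
  fix x assume "x \<in> reindex \<sigma> -` S"
  then show "x \<in> reindex (inv \<sigma>) ` S" using reindex_inverse(1)[of x] by (metis imageI vimageE)
next
  fix x assume "x \<in> reindex (inv \<sigma>) ` S"
  then show "x \<in> reindex \<sigma> -` S" using reindex_inverse(2) by auto
qed

text \<open>A box goes to the box with permuted side lengths, which has the same volume, and box
  volumes determine Lebesgue measure.\<close>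

lemma lborel_reindex: "lborel = distr lborel borel (reindex \<sigma>)"
proof (rule lborel_eqI)
  have [measurable]: "reindex \<sigma> \<in> borel \<rightarrow>\<^sub>M borel"
    by (intro borel_measurable_continuous_onI linear_continuous_on linear_conv_bounded_linear[THEN iffD1] linear_reindex)
  fix l u :: "real^'m" assume le: "\<And>b. b \<in> Basis \<Longrightarrow> l \<bullet> b \<le> u \<bullet> b"
  have le': "l $ i \<le> u $ i" for i using le[of "axis i 1"] by (simp add: inner_axis)
  have "reindex \<sigma> -` box l u = box (reindex (inv \<sigma>) l) (reindex (inv \<sigma>) u)"
  proof -
    have "(\<forall>i. Q i (\<sigma> i)) \<longleftrightarrow> (\<forall>j. Q (inv \<sigma> j) j)" for Q
      using \<sigma> by (metis bij_inv_eq_iff)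
    from this[of "\<lambda>i j. l $ i < _ $ j \<and> _ $ j < u $ i"] show ?thesis
      by (auto simp: mem_box_cart reindex_def)
  qed
  then have "emeasure (distr lborel borel (reindex \<sigma>)) (box l u)
    = emeasure lborel (box (reindex (inv \<sigma>) l) (reindex (inv \<sigma>) u))"
    by (simp add: emeasure_distr)
  also have "\<dots> = (\<Prod>b\<in>Basis. (reindex (inv \<sigma>) u - reindex (inv \<sigma>) l) \<bullet> b)"
    using le' by (intro emeasure_lborel_box) (auto simp: Basis_vec_def inner_axis reindex_def)
  also have "\<dots> = ennreal (\<Prod>i\<in>UNIV. (u - l) $ i)"
  proof -
    have "(\<Prod>i\<in>UNIV. (reindex (inv \<sigma>) u - reindex (inv \<sigma>) l) $ i) = (\<Prod>i\<in>UNIV. (u - l) $ inv \<sigma> i)"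
      by (simp add: reindex_def)
    also have "\<dots> = (\<Prod>i\<in>UNIV. (u - l) $ i)"
      by (rule prod.reindex_bij_betw) (use \<sigma> in \<open>simp add: bij_imp_bij_inv\<close>)
    finally show ?thesis unfolding prod_Basis_vec by simp
  qed
  finally show "emeasure (distr lborel borel (reindex \<sigma>)) (box l u) = (\<Prod>b\<in>Basis. (u - l) \<bullet> b)"
    by (simp add: prod_Basis_vec)
qed simp

lemma lebesgue_reindex:
  shows measurable_lebesgue_reindex: "reindex \<sigma> \<in> lebesgue \<rightarrow>\<^sub>M lebesgue"
    and "lebesgue = distr lebesgue lebesgue (reindex \<sigma>)"
proof -
  have m[measurable]: "reindex \<sigma> \<in> borel \<rightarrow>\<^sub>M borel"
    by (intro borel_measurable_continuous_onI linear_continuous_on linear_conv_bounded_linear[THEN iffD1] linear_reindex)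
  have eq: "distr lebesgue lborel (reindex \<sigma>) = lborel"
    using lborel_reindex by (simp add: distr_completion cong: distr_cong)
  show "reindex \<sigma> \<in> lebesgue \<rightarrow>\<^sub>M lebesgue"
    by (simp add: completion.measurable_completion2 eq measurable_completion)
  have "lebesgue = completion (distr lebesgue lborel (reindex \<sigma>))" by (simp add: eq)
  also have "\<dots> = distr lebesgue lebesgue (reindex \<sigma>)"
    by (subst completion.completion_distr_eq) (auto simp: eq measurable_completion)
  finally show "lebesgue = distr lebesgue lebesgue (reindex \<sigma>)" .
qed

lemma sets_lebesgue_reindex: "S \<in> sets lebesgue \<Longrightarrow> reindex (inv \<sigma>) ` S \<in> sets lebesgue"
  using measurable_sets[OF measurable_lebesgue_reindex, of S] by (simp add: reindex_vimage)

lemma absolutely_integrable_reindex: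
  fixes f :: "real^'m \<Rightarrow> real"
  assumes "f absolutely_integrable_on S"
  shows "(\<lambda>x. f (reindex \<sigma> x)) absolutely_integrable_on (reindex (inv \<sigma>) ` S)"
    and "integral (reindex (inv \<sigma>) ` S) (\<lambda>x. f (reindex \<sigma> x)) = integral S f"
proof -
  have ind: "indicat_real (reindex (inv \<sigma>) ` S) x = indicat_real S (reindex \<sigma> x)" for x
    using reindex_vimage[of S] by (auto simp: indicator_def)
  define F where "F = (\<lambda>x. indicat_real S x *\<^sub>R f x)"
  have F: "integrable lebesgue F" using assms by (simp add: set_integrable_def F_def)
  have "integrable (distr lebesgue lebesgue (reindex \<sigma>)) F"
    using F lebesgue_reindex(2) by simp
  then have I: "integrable lebesgue (\<lambda>x. F (reindex \<sigma> x))"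
    by (rule integrable_distr[OF measurable_lebesgue_reindex])
  then show abs: "(\<lambda>x. f (reindex \<sigma> x)) absolutely_integrable_on (reindex (inv \<sigma>) ` S)"
    by (simp add: set_integrable_def F_def ind)
  have "integral\<^sup>L lebesgue (\<lambda>x. F (reindex \<sigma> x)) = integral\<^sup>L (distr lebesgue lebesgue (reindex \<sigma>)) F"
    by (rule integral_distr[symmetric, OF measurable_lebesgue_reindex]) (use F in auto)
  also have "\<dots> = integral\<^sup>L lebesgue F" using lebesgue_reindex(2) by simp
  finally show "integral (reindex (inv \<sigma>) ` S) (\<lambda>x. f (reindex \<sigma> x)) = integral S f"
    using set_lebesgue_integral_eq_integral(2)[OF abs] set_lebesgue_integral_eq_integral(2)[OF assms]
    by (simp add: set_lebesgue_integral_def F_def ind)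
qed

end

lemma change_of_variables_wellorder:
  fixes f :: "real^'m::{finite,wellorder} \<Rightarrow> real" and g :: "real^'m::_ \<Rightarrow> real^'m::_"
  assumes "S \<in> sets lebesgue"
    and "\<And>x. x \<in> S \<Longrightarrow> (g has_derivative g' x) (at x within S)" and "inj_on g S"
    and "(\<lambda>x. \<bar>det (matrix (g' x))\<bar> * f(g x)) absolutely_integrable_on S"
  shows "f absolutely_integrable_on (g ` S)"
    and "integral (g ` S) f = integral S (\<lambda>x. \<bar>det (matrix (g' x))\<bar> * f(g x))"
proof -
  \<comment> \<open>\<open>has_absolute_integral_change_of_variables\<close> speaks of vector-valued
    integrands, so the scalar one is passed as a \<open>real^1\<close>-valued function.\<close>
  have vec: "(\<lambda>x. \<bar>det (matrix (g' x))\<bar> *\<^sub>R (vec (f (g x)) :: real^1))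
     = (\<lambda>x. vec (\<bar>det (matrix (g' x))\<bar> * f (g x)))" by (auto simp: vec_eq_iff)
  have "f absolutely_integrable_on (g ` S) \<and> integral (g ` S) f = integral S (\<lambda>x. \<bar>det (matrix (g' x))\<bar> * f(g x))"
    using has_absolute_integral_change_of_variables[OF assms(1-3), of "\<lambda>x. vec (f x) :: real^1"
        "vec (integral S (\<lambda>x. \<bar>det (matrix (g' x))\<bar> * f(g x)))"] assms(4)
    unfolding vec absolutely_integrable_on_1_iff integral_on_1_eq
    by (simp add: vec_eq_iff)
  then show "f absolutely_integrable_on (g ` S)"
    "integral (g ` S) f = integral S (\<lambda>x. \<bar>det (matrix (g' x))\<bar> * f(g x))" by auto
qed

text \<open>Conjugation by \<sigma> is a sign-preserving bijection between the permutations of the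
  two index types, so the two Leibniz sums agree term by term.\<close>

lemma det_reindex:
  assumes \<sigma>: "bij (\<sigma> :: 'm::finite \<Rightarrow> 'n::finite)" and "linear g"
  shows "det (matrix (\<lambda>x. reindex \<sigma> (g (reindex (inv \<sigma>) x)))) = det (matrix g)"
proof -
  have "reindex (inv \<sigma>) (axis j 1) = axis (\<sigma> j) 1" for j
    using \<sigma> by (auto simp: reindex_def vec_eq_iff axis_def) (metis bij_inv_eq_iff)+
  then have "matrix (\<lambda>x. reindex \<sigma> (g (reindex (inv \<sigma>) x))) $ i $ j = matrix g $ \<sigma> i $ \<sigma> j" for i j
    by (simp add: matrix_def reindex_def)
  note M = this
  let ?c = "\<lambda>p. \<sigma> \<circ> p \<circ> inv \<sigma>"
  have "det (matrix (\<lambda>x. reindex \<sigma> (g (reindex (inv \<sigma>) x))))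
      = (\<Sum>p | p permutes (UNIV :: 'm set). of_int (sign p) * (\<Prod>i\<in>UNIV. matrix g $ \<sigma> i $ \<sigma> (p i)))"
    by (simp add: det_def M)
  also have "\<dots> = (\<Sum>p | p permutes (UNIV :: 'n set). of_int (sign p) * (\<Prod>i\<in>UNIV. matrix g $ i $ p i))"
  proof (rule sum.reindex_bij_witness[of _ "\<lambda>p. inv \<sigma> \<circ> p \<circ> \<sigma>" ?c])
    fix p assume p: "p \<in> {p. p permutes (UNIV :: 'm set)}"
    then have bp: "bij p" by (simp add: permutes_bij)
    have "bij (?c p)" using bp \<sigma> by (intro bij_comp bij_imp_bij_inv) auto
    then show "?c p \<in> {p. p permutes UNIV}" by (auto intro: bij_imp_permutes)
    show "inv \<sigma> \<circ> ?c p \<circ> \<sigma> = p" using \<sigma> by (auto simp: fun_eq_iff bij_is_inj)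
    have "map_permutation UNIV \<sigma> p = ?c p"
      using \<sigma> by (simp add: map_permutation_def bij_is_surj fun_eq_iff)
    then have s: "sign (?c p) = sign p"
      using sign_map_permutation[of \<sigma> UNIV p] p \<sigma> by (simp add: bij_is_inj)
    have "(\<Prod>i\<in>UNIV. matrix g $ i $ (?c p) i) = (\<Prod>i\<in>UNIV. matrix g $ \<sigma> i $ \<sigma> (p i))"
      using prod.reindex_bij_betw[OF \<sigma>, of "\<lambda>i. matrix g $ i $ (?c p) i"] \<sigma> by (simp add: bij_is_inj)
    then show "of_int (sign (?c p)) * (\<Prod>i\<in>UNIV. matrix g $ i $ (?c p) i)
      = of_int (sign p) * (\<Prod>i\<in>UNIV. matrix g $ \<sigma> i $ \<sigma> (p i))" by (simp add: s)
  next
    fix p assume p: "p \<in> {p. p permutes (UNIV :: 'n set)}"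
    then have "bij p" by (simp add: permutes_bij)
    then have "bij (inv \<sigma> \<circ> p \<circ> \<sigma>)" using \<sigma> by (intro bij_comp bij_imp_bij_inv) auto
    then show "inv \<sigma> \<circ> p \<circ> \<sigma> \<in> {p. p permutes UNIV}" by (auto intro: bij_imp_permutes)
    show "?c (inv \<sigma> \<circ> p \<circ> \<sigma>) = p" using \<sigma> by (auto simp: fun_eq_iff bij_is_surj surj_f_inv_f)
  qed
  finally show ?thesis by (simp add: det_def)
qed

lemma change_of_variables_transfer:
  fixes f :: "real^'n \<Rightarrow> real" and g :: "real^'n \<Rightarrow> real^'n" and \<sigma> :: "'n \<Rightarrow> 'm::{finite,wellorder}"
  assumes \<sigma>: "bij \<sigma>" and S: "S \<in> sets lebesgue"
    and der: "\<And>x. x \<in> S \<Longrightarrow> (g has_derivative g' x) (at x within S)" and inj: "inj_on g S"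
    and int: "(\<lambda>x. \<bar>det (matrix (g' x))\<bar> * f(g x)) absolutely_integrable_on S"
  shows "f absolutely_integrable_on (g ` S)"
    and "integral (g ` S) f = integral S (\<lambda>x. \<bar>det (matrix (g' x))\<bar> * f(g x))"
proof -
  have \<sigma>': "bij (inv \<sigma>)" and ii: "inv (inv \<sigma>) = \<sigma>" using \<sigma> by (simp_all add: bij_imp_bij_inv inv_inv_eq)
  let ?R = "reindex (inv \<sigma>)" and ?R' = "reindex \<sigma>"
  note RR' = reindex_inverse[OF \<sigma>', unfolded ii]
  define T where "T = ?R ` S"
  define G where "G y = ?R (g (?R' y))" for y
  define F where "F y = f (?R' y)" for y
  define G' where "G' y h = ?R (g' (?R' y) (?R' h))" for y h
  have R'T: "?R' y \<in> S" if "y \<in> T" for y using that RR' by (auto simp: T_def)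
  have T: "T \<in> sets lebesgue" unfolding T_def by (rule sets_lebesgue_reindex[OF \<sigma> S])
  have linb: "bounded_linear ?R" "bounded_linear ?R'"
    by (simp_all add: linear_conv_bounded_linear[symmetric] linear_reindex)
  have derG: "(G has_derivative G' y) (at y within T)" if "y \<in> T" for y
  proof -
    have "(g has_derivative g' (?R' y)) (at (?R' y) within ?R' ` T)"
      using der[OF R'T[OF that]] by (rule has_derivative_subset) (auto simp: R'T)
    from bounded_linear.has_derivative[OF linb(1) has_derivative_in_compose[OF bounded_linear_imp_has_derivative[OF linb(2)] this]]
    show ?thesis by (simp add: G_def[abs_def] G'_def[abs_def])
  qed
  have injG: "inj_on G T"
  proof (rule inj_onI)
    fix x y assume "x \<in> T" "y \<in> T" "G x = G y"
    then have "g (?R' x) = g (?R' y)" unfolding G_def by (metis RR'(1))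
    then have "?R' x = ?R' y" using inj R'T \<open>x \<in> T\<close> \<open>y \<in> T\<close> by (meson inj_onD)
    then show "x = y" by (metis RR'(2))
  qed
  have GF: "F (G y) = f (g (?R' y))" for y by (simp add: F_def G_def RR')
  have dG: "det (matrix (G' y)) = det (matrix (g' (?R' y)))" if "y \<in> T" for y
    using det_reindex[OF \<sigma>', of "g' (?R' y)"] der[OF R'T[OF that], THEN has_derivative_linear]
    by (simp add: G'_def[abs_def] ii)
  let ?h = "\<lambda>x. \<bar>det (matrix (g' x))\<bar> * f (g x)"
  have "(\<lambda>y. ?h (?R' y)) absolutely_integrable_on T" "integral T (\<lambda>y. ?h (?R' y)) = integral S ?h"
    using absolutely_integrable_reindex[OF \<sigma> int] by (simp_all add: T_def)
  moreover have "?h (?R' y) = \<bar>det (matrix (G' y))\<bar> * F (G y)" if "y \<in> T" for y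
    using dG[OF that] GF by simp
  ultimately have int': "(\<lambda>y. \<bar>det (matrix (G' y))\<bar> * F (G y)) absolutely_integrable_on T"
    and eq: "integral T (\<lambda>y. \<bar>det (matrix (G' y))\<bar> * F (G y)) = integral S ?h"
    by (simp_all cong: set_integrable_cong integral_cong)
  note cv = change_of_variables_wellorder[OF T derG injG int']
  have im: "?R' ` (G ` T) = g ` S"
    by (auto simp: G_def T_def image_image RR')
  have "(\<lambda>x. F (?R x)) = f" by (auto simp: F_def RR')
  then show "f absolutely_integrable_on (g ` S)" "integral (g ` S) f = integral S ?h"
    using absolutely_integrable_reindex[OF \<sigma>' cv(1)] cv(2) eq im by (simp_all add: ii)
qed

lemma change_of_variables_dim_2_3:
  fixes f :: "real^'n \<Rightarrow> real" and g :: "real^'n \<Rightarrow> real^'n"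
  assumes "CARD('n) \<in> {2, 3}" and "S \<in> sets lebesgue"
    and "\<And>x. x \<in> S \<Longrightarrow> (g has_derivative g' x) (at x within S)" and "inj_on g S"
    and "(\<lambda>x. \<bar>det (matrix (g' x))\<bar> * f(g x)) absolutely_integrable_on S"
  shows "f absolutely_integrable_on (g ` S)"
    and "integral (g ` S) f = integral S (\<lambda>x. \<bar>det (matrix (g' x))\<bar> * f(g x))"
proof -
  have "\<exists>\<sigma> :: 'n \<Rightarrow> 2. bij \<sigma>" if "CARD('n) = 2"
    using finite_same_card_bij[of "UNIV :: 'n set" "UNIV :: 2 set"] that by auto
  moreover have "\<exists>\<sigma> :: 'n \<Rightarrow> 3. bij \<sigma>" if "CARD('n) = 3"
    using finite_same_card_bij[of "UNIV :: 'n set" "UNIV :: 3 set"] that by auto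
  ultimately show "f absolutely_integrable_on (g ` S)"
    and "integral (g ` S) f = integral S (\<lambda>x. \<bar>det (matrix (g' x))\<bar> * f(g x))"
    using assms(1) change_of_variables_transfer[OF _ assms(2-5)] by (metis insertE singletonD)+
qed

section \<open>Integrals over hyperplanes and the divergence theorem\<close>

lemma absolutely_integrable_bounded_support:
  fixes f :: "'a::euclidean_space \<Rightarrow> real"
  assumes "f \<in> borel_measurable borel" "bounded B"
    and "\<And>x. x \<in> B \<Longrightarrow> \<bar>f x\<bar> \<le> M" "\<And>x. x \<notin> B \<Longrightarrow> f x = 0"
  shows "f absolutely_integrable_on UNIV"
proof -
  obtain r where r: "B \<subseteq> cball 0 r" using assms(2) by (metis bounded_subset_ballD ball_subset_cball order_trans)
  show ?thesis
  proof (rule measurable_bounded_by_integrable_imp_absolutely_integrable)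
    show "f \<in> borel_measurable (lebesgue_on UNIV)"
      using assms(1) by (simp add: lebesgue_on_UNIV_eq measurable_completion)
    have "(\<lambda>x. if x \<in> cball 0 r then \<bar>M\<bar> else 0 :: real) integrable_on UNIV"
      unfolding integrable_restrict_UNIV
      by (intro integrable_on_const) simp
    then show "(\<lambda>x. if x \<in> cball 0 r then \<bar>M\<bar> else 0 :: real) integrable_on UNIV" .
    show "norm (f x) \<le> (if x \<in> cball 0 r then \<bar>M\<bar> else 0)" for x
      using assms(3,4)[of x] r by (cases "x \<in> B") auto
  qed auto
qed

lemma dominated_convergence_almost_everywhere:
  fixes f :: "nat \<Rightarrow> 'n::euclidean_space \<Rightarrow> real"
  assumes "negligible N" and "\<And>k. (f k) integrable_on UNIV" and "h integrable_on UNIV"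
    and "\<And>k x. \<bar>f k x\<bar> \<le> h x" and "\<And>x. x \<notin> N \<Longrightarrow> (\<lambda>k. f k x) \<longlonglongrightarrow> g x"
  shows "g integrable_on UNIV" "(\<lambda>k. integral UNIV (f k)) \<longlonglongrightarrow> integral UNIV g"
proof -
  define f' where "f' k x = (if x \<in> N then 0 else f k x)" for k x
  define g' where "g' x = (if x \<in> N then 0 else g x)" for x
  have "f' k integrable_on UNIV" for k
    by (rule integrable_spike[OF assms(2)[of k] assms(1)]) (simp add: f'_def)
  moreover have "norm (f' k x) \<le> h x" for k x
    using assms(4)[of k x] by (auto simp: f'_def)
  moreover have "(\<lambda>k. f' k x) \<longlonglongrightarrow> g' x" for x
    using assms(5)[of x] by (auto simp: f'_def g'_def)
  ultimately have "g' integrable_on UNIV" "(\<lambda>k. integral UNIV (f' k)) \<longlonglongrightarrow> integral UNIV g'"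
    using dominated_convergence[of f' UNIV h g'] assms(3) by auto
  moreover have "integral UNIV (f' k) = integral UNIV (f k)" for k
    by (rule integral_spike[OF assms(1)]) (simp add: f'_def)
  moreover have "integral UNIV g' = integral UNIV g"
    by (rule integral_spike[OF assms(1)]) (simp add: g'_def)
  moreover have "g integrable_on UNIV" if "g' integrable_on UNIV"
    using that assms(1) by (rule integrable_spike) (simp add: g'_def)
  ultimately show "g integrable_on UNIV" "(\<lambda>k. integral UNIV (f k)) \<longlonglongrightarrow> integral UNIV g"
    by simp_all
qed

lemma has_integral_translation:
  fixes F :: "'a::euclidean_space \<Rightarrow> real"
  assumes "(F has_integral I) UNIV" "bounded B" "\<And>x. x \<notin> B \<Longrightarrow> F x = 0"
  shows "((\<lambda>x. F (x + c)) has_integral I) UNIV"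
proof -
  obtain a where a: "B \<subseteq> cbox (-a) a" using assms(2) bounded_subset_cbox_symmetric by blast
  have "(F has_integral I) (cbox (-a) a)"
  proof -
    have "(\<lambda>x. if x \<in> cbox (-a) a then F x else 0) = F" using a assms(3) by (auto simp: fun_eq_iff)
    then show ?thesis using assms(1) has_integral_restrict_UNIV[of "cbox (-a) a" F I] by simp
  qed
  then have "((\<lambda>x. F (x + c)) has_integral I) (cbox (-a - c) (a - c))"
    by (rule has_integral_shift_cbox)
  then show ?thesis
  proof (rule has_integral_on_superset)
    fix x assume "x \<notin> cbox (-a - c) (a - c)"
    then have "x + c \<notin> cbox (-a) a" by (auto simp: mem_box algebra_simps)
    then show "F (x + c) = 0" using a assms(3) by blast
  qed auto
qed

text \<open>Difference quotients have integral zero by translation invariance. The Lipschitz bound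
  dominates them uniformly on a bounded set, so the limit may be taken under the integral although
  \<open>F\<close> is differentiable only off a null set.\<close>

lemma has_integral_derivative_compact_support:
  fixes F :: "'a::euclidean_space \<Rightarrow> real"
  assumes lip: "\<And>x y. \<bar>F x - F y\<bar> \<le> L * norm (x - y)"
    and B: "bounded B" "\<And>x. x \<notin> B \<Longrightarrow> F x = 0"
    and N: "negligible N" and diff: "\<And>x. x \<notin> N \<Longrightarrow> F differentiable (at x)"
  shows "((\<lambda>x. frechet_derivative F (at x) e) has_integral 0) UNIV"
proof -
  define h where "h k = inverse (real (Suc k))" for k
  have h: "h k > 0" "h k \<le> 1" for k by (auto simp: h_def field_simps)
  have h0: "h \<longlonglongrightarrow> 0" unfolding h_def by (rule LIMSEQ_inverse_real_of_nat)
  have contF: "continuous_on UNIV F"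
    unfolding continuous_on_iff
  proof safe
    fix x :: 'a and \<epsilon> :: real assume "\<epsilon> > 0"
    show "\<exists>d>0. \<forall>x'\<in>UNIV. dist x' x < d \<longrightarrow> dist (F x') (F x) < \<epsilon>"
    proof (intro exI conjI ballI impI)
      show "\<epsilon> / (\<bar>L\<bar> + 1) > 0" using \<open>\<epsilon> > 0\<close> by (intro divide_pos_pos) auto
      fix x' assume "dist x' x < \<epsilon> / (\<bar>L\<bar> + 1)"
      then have "(\<bar>L\<bar> + 1) * norm (x' - x) < \<epsilon>" by (simp add: dist_norm field_simps)
      moreover have "L * norm (x' - x) \<le> (\<bar>L\<bar> + 1) * norm (x' - x)" by (intro mult_right_mono) auto
      ultimately show "dist (F x') (F x) < \<epsilon>" using lip[of x' x] by (simp add: dist_real_def)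
    qed
  qed
  have Fm: "F \<in> borel_measurable borel" by (rule borel_measurable_continuous_onI[OF contF])
  obtain r where r: "B \<subseteq> cball 0 r" using B(1) by (metis bounded_subset_ballD ball_subset_cball order_trans)
  have bdF: "\<bar>F x\<bar> \<le> \<bar>L\<bar> * (norm (x - y)) + \<bar>F y\<bar>" for x y
  proof -
    have "L * norm (x - y) \<le> \<bar>L\<bar> * norm (x - y)" by (intro mult_right_mono) auto
    then show ?thesis using lip[of x y] by linarith
  qed
  have Fint: "F absolutely_integrable_on UNIV"
  proof (rule absolutely_integrable_bounded_support[OF Fm B(1)])
    fix x assume "x \<in> B"
    then have "norm (x - 0) \<le> r" using r by auto
    then have "\<bar>L\<bar> * norm (x - 0) \<le> \<bar>L\<bar> * r" by (intro mult_left_mono) auto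
    then show "\<bar>F x\<bar> \<le> \<bar>L\<bar> * r + \<bar>F 0\<bar>" using bdF[of x 0] by linarith
  qed (use B in auto)
  define I where "I = integral UNIV F"
  have I: "(F has_integral I) UNIV"
    using Fint by (simp add: I_def absolutely_integrable_on_def integrable_integral)
  define f where "f k x = (F (x + h k *\<^sub>R e) - F x) / h k" for k x
  have fk: "(f k has_integral 0) UNIV" for k
    using has_integral_divide[OF has_integral_diff[OF has_integral_translation[OF I B] I], of "h k *\<^sub>R e" "h k"]
    by (simp add: f_def[abs_def])
  \<comment> \<open>Step sizes are at most 1, so outside the enlarged radius neither end point of
    the difference lies in the support.\<close>
  define H where "H x = (if x \<in> cball 0 (r + norm e) then \<bar>L\<bar> * norm e else 0)" for x :: 'a
  have dom: "\<bar>f k x\<bar> \<le> H x" for k x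
  proof (cases "x \<in> cball 0 (r + norm e)")
    case True
    have "\<bar>F (x + h k *\<^sub>R e) - F x\<bar> \<le> L * (h k * norm e)" using lip[of "x + h k *\<^sub>R e" x] h(1)[of k] by simp
    also have "\<dots> \<le> \<bar>L\<bar> * (h k * norm e)" using h(1)[of k] by (intro mult_right_mono) auto
    finally show ?thesis using True h(1)[of k] by (simp add: f_def H_def field_simps)
  next
    case False
    then have nx: "norm x > r + norm e" by auto
    have "norm (h k *\<^sub>R e) \<le> norm e" using h[of k] by (simp add: mult_left_le_one_le)
    then have "norm (x + h k *\<^sub>R e) > r" using norm_diff_ineq[of x "h k *\<^sub>R e"] nx by linarith
    moreover have "norm x > r" using nx norm_ge_zero[of e] by linarith
    ultimately have "x \<notin> B" "x + h k *\<^sub>R e \<notin> B" using r by (auto simp: subset_iff)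
    then show ?thesis using False by (simp add: f_def H_def B)
  qed
  have Hint: "H integrable_on UNIV"
    unfolding H_def integrable_restrict_UNIV by (intro integrable_on_const) simp
  have conv: "(\<lambda>k. f k x) \<longlonglongrightarrow> frechet_derivative F (at x) e" if "x \<notin> N" for x
  proof -
    have "(F has_derivative frechet_derivative F (at x)) (at (x + 0 *\<^sub>R e))"
      using diff[OF that] by (simp add: frechet_derivative_works)
    then have "((\<lambda>s. F (x + s *\<^sub>R e)) has_derivative (\<lambda>s. frechet_derivative F (at x) (s *\<^sub>R e))) (at 0)"
      by (rule has_derivative_compose[rotated]) (auto intro!: derivative_eq_intros)
    moreover have "frechet_derivative F (at x) (s *\<^sub>R e) = frechet_derivative F (at x) e * s" for s
      using linear_frechet_derivative[OF diff[OF that]] by (simp add: linear_scale)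
    ultimately have "((\<lambda>s. F (x + s *\<^sub>R e)) has_field_derivative frechet_derivative F (at x) e) (at 0)"
      by (simp add: has_field_derivative_def)
    then have "((\<lambda>s. (F (x + s *\<^sub>R e) - F x) / s) \<longlongrightarrow> frechet_derivative F (at x) e) (at 0)"
      by (simp add: DERIV_def)
    moreover have "filterlim h (at 0) sequentially"
    proof -
      have "h k \<noteq> 0" for k using h(1)[of k] by simp
      then show ?thesis using h0 by (simp add: filterlim_at)
    qed
    ultimately show ?thesis unfolding f_def by (rule filterlim_compose)
  qed
  have fi: "f k integrable_on UNIV" for k using fk by blast
  note dc = dominated_convergence_almost_everywhere[OF N fi Hint dom conv]
  have "(\<lambda>k. integral UNIV (f k)) = (\<lambda>k. 0)" using fk by (auto intro!: integral_unique)
  then have "integral UNIV (\<lambda>x. frechet_derivative F (at x) e) = 0"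
    using dc(2) LIMSEQ_unique[OF tendsto_const] by fastforce
  then show ?thesis using dc(1) by (metis integrable_integral)
qed

lemma has_integral_divergence_compact_support:
  fixes V :: "real^'n \<Rightarrow> real^'n"
  assumes lip: "\<And>x y. norm (V x - V y) \<le> L * norm (x - y)"
    and B: "bounded B" "\<And>x. x \<notin> B \<Longrightarrow> V x = 0"
    and N: "negligible N" and diff: "\<And>x. x \<notin> N \<Longrightarrow> V differentiable (at x)"
  shows "(divergence V has_integral 0) UNIV"
proof -
  have "((\<lambda>x. frechet_derivative (\<lambda>x. V x $ i) (at x) (axis i 1)) has_integral 0) UNIV" for i
  proof (rule has_integral_derivative_compact_support[OF _ B(1) _ N])
    show "\<bar>V x $ i - V y $ i\<bar> \<le> L * norm (x - y)" for x y
      using lip[of x y] component_le_norm_cart[of "V x - V y" i] by simp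
    show "(\<lambda>x. V x $ i) differentiable (at x)" if "x \<notin> N" for x
      using bounded_linear.has_derivative[OF bounded_linear_vec_nth] diff[OF that]
      unfolding differentiable_def by blast
  qed (simp add: B)
  then have "((\<lambda>x. \<Sum>i\<in>UNIV. frechet_derivative (\<lambda>x. V x $ i) (at x) (axis i 1)) has_integral (\<Sum>i\<in>(UNIV::'n set). 0)) UNIV"
    by (intro has_integral_sum) auto
  then have "((\<lambda>x. \<Sum>i\<in>UNIV. frechet_derivative (\<lambda>x. V x $ i) (at x) (axis i 1)) has_integral 0) UNIV" by simp
  then show ?thesis
  proof (rule has_integral_spike[OF N, rotated])
    fix x assume x: "x \<in> UNIV - N"
    then have "V differentiable (at x)" using diff by simp
    then have "(V has_derivative frechet_derivative V (at x)) (at x)" by (simp add: frechet_derivative_works)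
    then have "((\<lambda>x. V x $ i) has_derivative (\<lambda>h. frechet_derivative V (at x) h $ i)) (at x)" for i
      by (rule bounded_linear.has_derivative[OF bounded_linear_vec_nth])
    from frechet_derivative_at[OF this]
    show "divergence V x = (\<Sum>i\<in>UNIV. frechet_derivative (\<lambda>x. V x $ i) (at x) (axis i 1))"
      by (simp add: divergence_def trace_def jacobian_def matrix_def fun_eq_iff)
  qed
qed

section \<open>Hyperplane integrals written as integrals over the whole space\<close>

lemma plane_integral_eq:
  assumes \<nu>: "norm \<nu> = 1" and Q: "Q \<subseteq> {x. \<nu> \<bullet> x = \<beta>}"
  shows "plane_integral \<nu> Q g = integral UNIV (\<lambda>y. if 0 \<le> \<nu> \<bullet> y - \<beta> \<and> \<nu> \<bullet> y - \<beta> \<le> 1 \<and>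
    y - (\<nu> \<bullet> y - \<beta>) *\<^sub>R \<nu> \<in> Q then g (y - (\<nu> \<bullet> y - \<beta>) *\<^sub>R \<nu>) else 0)"
proof -
  \<comment> \<open>\<open>\<nu> \<bullet> y - \<beta>\<close> is the signed height of
    \<open>y\<close> over the plane and \<open>p y\<close> its orthogonal projection. Together they
    resolve the definite description in \<open>plane_integral\<close>.\<close>
  define p where "p y = y - (\<nu> \<bullet> y - \<beta>) *\<^sub>R \<nu>" for y
  define Z where "Z = (\<lambda>(x, t). x + t *\<^sub>R \<nu>) ` (Q \<times> {0..1})"
  have nn: "\<nu> \<bullet> \<nu> = 1" using \<nu> by (simp add: norm_eq_1)
  have t: "\<nu> \<bullet> (x + t *\<^sub>R \<nu>) - \<beta> = t" if "x \<in> Q" for x t using that Q nn by (auto simp: inner_simps)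
  then have p: "p (x + t *\<^sub>R \<nu>) = x" if "x \<in> Q" for x t using that by (simp add: p_def)
  have Z: "y \<in> Z \<longleftrightarrow> 0 \<le> \<nu> \<bullet> y - \<beta> \<and> \<nu> \<bullet> y - \<beta> \<le> 1 \<and> p y \<in> Q" for y
  proof
    assume "y \<in> Z"
    then obtain x s where x: "x \<in> Q" "0 \<le> s" "s \<le> 1" "y = x + s *\<^sub>R \<nu>" by (auto simp: Z_def)
    then show "0 \<le> \<nu> \<bullet> y - \<beta> \<and> \<nu> \<bullet> y - \<beta> \<le> 1 \<and> p y \<in> Q"
      using t[OF x(1), of s] p[OF x(1), of s] by simp
  next
    assume *: "0 \<le> \<nu> \<bullet> y - \<beta> \<and> \<nu> \<bullet> y - \<beta> \<le> 1 \<and> p y \<in> Q"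
    have "y = p y + (\<nu> \<bullet> y - \<beta>) *\<^sub>R \<nu>" by (simp add: p_def)
    then show "y \<in> Z" unfolding Z_def using *
      by (intro image_eqI[of _ _ "(p y, \<nu> \<bullet> y - \<beta>)"]) auto
  qed
  have the: "(THE x. x \<in> Q \<and> (\<exists>t. y = x + t *\<^sub>R \<nu>)) = p y" if "y \<in> Z" for y
  proof (rule the_equality)
    show "p y \<in> Q \<and> (\<exists>t. y = p y + t *\<^sub>R \<nu>)" using that Z by (auto simp: p_def intro!: exI[of _ "\<nu> \<bullet> y - \<beta>"])
  qed (use p in auto)
  have "plane_integral \<nu> Q g = integral Z (\<lambda>y. g (p y))"
    unfolding plane_integral_def Z_def[symmetric] by (intro integral_cong) (simp add: the)
  also have "\<dots> = integral UNIV (\<lambda>y. if y \<in> Z then g (p y) else 0)"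
    by (simp add: integral_restrict_UNIV)
  finally show ?thesis unfolding Z p_def .
qed

text \<open>The condition is affine in \<open>y\<close>: c \<bullet> y = d with \<open>c\<close> the
  part of a' orthogonal to \<nu>. Both \<open>c\<close> and \<open>d\<close> vanish only if the two
  hyperplanes coincide; otherwise the set is a hyperplane or empty.\<close>

lemma negligible_projection_hyperplane:
  fixes a' \<nu> :: "'a::euclidean_space"
  assumes \<nu>: "norm \<nu> = 1" and ne: "{x. a' \<bullet> x = b'} \<noteq> {x. \<nu> \<bullet> x = \<beta>}" and a': "a' \<noteq> 0"
  shows "negligible {y. a' \<bullet> (y - (\<nu> \<bullet> y - \<beta>) *\<^sub>R \<nu>) = b'}"
proof -
  define c where "c = a' - (a' \<bullet> \<nu>) *\<^sub>R \<nu>"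
  define d where "d = b' - \<beta> * (a' \<bullet> \<nu>)"
  have "c \<noteq> 0 \<or> d \<noteq> 0"
  proof (rule ccontr)
    assume "\<not> ?thesis"
    then have "c = 0" "d = 0" by auto
    then have a'': "a' = (a' \<bullet> \<nu>) *\<^sub>R \<nu>" and b': "b' = \<beta> * (a' \<bullet> \<nu>)"
      unfolding c_def d_def by (simp_all only: right_minus_eq)
    define s where "s = a' \<bullet> \<nu>"
    have "s \<noteq> 0"
    proof
      assume "s = 0"
      then have "a' = 0" using a'' unfolding s_def[symmetric] by simp
      then show False using a' by simp
    qed
    moreover have "a' \<bullet> x = s * (\<nu> \<bullet> x)" for x
    proof -
      have "a' \<bullet> x = (s *\<^sub>R \<nu>) \<bullet> x" unfolding s_def by (rule arg_cong[OF a''])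
      then show ?thesis by simp
    qed
    moreover have "b' = s * \<beta>" unfolding s_def b' by (rule mult.commute)
    ultimately have "a' \<bullet> x = b' \<longleftrightarrow> \<nu> \<bullet> x = \<beta>" for x by simp
    then show False using ne by auto
  qed
  then have "negligible {y. c \<bullet> y = d}" by (rule negligible_hyperplane)
  moreover have "{y. a' \<bullet> (y - (\<nu> \<bullet> y - \<beta>) *\<^sub>R \<nu>) = b'} = {y. c \<bullet> y = d}"
    by (auto simp: c_def d_def inner_simps algebra_simps)
  ultimately show ?thesis by simp
qed

text \<open>Lets strict and weak inequalities be exchanged on planar pieces, as the pieces then
  differ only inside a second plane.\<close>

lemma plane_integral_spike:
  assumes \<nu>: "norm \<nu> = 1" and Q: "Q \<subseteq> {x. \<nu> \<bullet> x = \<beta>}" "Q' \<subseteq> {x. \<nu> \<bullet> x = \<beta>}"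
    and ne: "{x. a' \<bullet> x = b'} \<noteq> {x. \<nu> \<bullet> x = \<beta>}" and a': "a' \<noteq> 0"
    and diff: "Q - Q' \<subseteq> {x. a' \<bullet> x = b'}" "Q' - Q \<subseteq> {x. a' \<bullet> x = b'}"
  shows "plane_integral \<nu> Q g = plane_integral \<nu> Q' g"
  unfolding plane_integral_eq[OF \<nu> Q(1)] plane_integral_eq[OF \<nu> Q(2)]
  by (rule integral_spike[OF negligible_projection_hyperplane[OF \<nu> ne a']]) (use diff in auto)

lemma plane_integral_cong:
  assumes "\<And>x. x \<in> Q \<Longrightarrow> g x = g' x" "norm \<nu> = 1" "Q \<subseteq> {x. \<nu> \<bullet> x = \<beta>}"
  shows "plane_integral \<nu> Q g = plane_integral \<nu> Q g'"
  unfolding plane_integral_eq[OF assms(2,3)] by (rule integral_cong) (use assms(1) in auto)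

lemma plane_integral_minus:
  assumes "norm \<nu> = 1" "Q \<subseteq> {x. \<nu> \<bullet> x = \<beta>}"
  shows "plane_integral \<nu> Q (\<lambda>x. - g x) = - plane_integral \<nu> Q g"
  unfolding plane_integral_eq[OF assms] integral_neg[symmetric] by (rule integral_cong) auto

text \<open>Integrability is not presupposed: if \<open>F\<close> is not integrable, neither is its
  translate, and both integrals are 0 by convention.\<close>

lemma integral_translation:
  fixes F :: "'a::euclidean_space \<Rightarrow> real"
  assumes "bounded B" "\<And>x. x \<notin> B \<Longrightarrow> F x = 0"
  shows "integral UNIV (\<lambda>x. F (x + c)) = integral UNIV F"
proof (cases "F integrable_on UNIV")
  case True
  then show ?thesis
    by (intro integral_unique has_integral_translation[OF _ assms] integrable_integral)
next
  case False
  have "\<not> (\<lambda>x. F (x + c)) integrable_on UNIV"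
  proof
    assume "(\<lambda>x. F (x + c)) integrable_on UNIV"
    then obtain I where "((\<lambda>x. F (x + c)) has_integral I) UNIV" by blast
    moreover have "bounded ((\<lambda>x. x - c) ` B)" using assms(1) by (simp add: bounded_translation_minus)
    moreover have "F (x + c) = 0" if "x \<notin> (\<lambda>x. x - c) ` B" for x
      using that assms(2)[of "x + c"] by (metis add_diff_cancel_right' image_eqI)
    ultimately have "((\<lambda>x. F (x - c + c)) has_integral I) UNIV"
      using has_integral_translation[of "\<lambda>x. F (x + c)" I "(\<lambda>x. x - c) ` B" "- c"] by simp
    then show False using False by auto
  qed
  then show ?thesis using False by (simp add: not_integrable_integral)
qed

text \<open>The prisms for \<nu> and for its negative lie on opposite sides of the plane and differ
  by a translation along \<nu>, a direction in which the integrand is constant. This makes the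
  fluxes of two neighbours with opposite normals comparable.\<close>

lemma plane_integral_uminus:
  fixes \<nu> :: "real^'n"
  assumes \<nu>: "norm \<nu> = 1" and Q: "Q \<subseteq> {x. \<nu> \<bullet> x = \<beta>}" and bd: "bounded Q"
  shows "plane_integral (- \<nu>) Q g = plane_integral \<nu> Q g"
proof -
  have nn: "\<nu> \<bullet> \<nu> = 1" using \<nu> by (simp add: norm_eq_1)
  define p where "p y = y - (\<nu> \<bullet> y - \<beta>) *\<^sub>R \<nu>" for y
  define f where "f y = (if - 1 \<le> \<nu> \<bullet> y - \<beta> \<and> \<nu> \<bullet> y - \<beta> \<le> 0 \<and> p y \<in> Q then g (p y) else 0)" for y
  have "plane_integral (- \<nu>) Q g = integral UNIV f"
    using Q by (subst plane_integral_eq[of "- \<nu>" Q "- \<beta>"])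
      (auto simp: \<nu> f_def[abs_def] p_def algebra_simps intro!: arg_cong[of _ _ "integral UNIV"])
  also have "\<dots> = integral UNIV (\<lambda>y. f (y + (- \<nu>)))"
  proof (rule integral_translation[symmetric])
    obtain r where r: "\<And>x. x \<in> Q \<Longrightarrow> norm x \<le> r" using bd by (auto simp: bounded_iff)
    show "bounded {y. - 1 \<le> \<nu> \<bullet> y - \<beta> \<and> \<nu> \<bullet> y - \<beta> \<le> 0 \<and> p y \<in> Q}"
      unfolding bounded_iff
    proof (intro exI[of _ "r + 1"] ballI)
      fix y assume "y \<in> {y. - 1 \<le> \<nu> \<bullet> y - \<beta> \<and> \<nu> \<bullet> y - \<beta> \<le> 0 \<and> p y \<in> Q}"
      then have "norm (p y) \<le> r" "\<bar>\<nu> \<bullet> y - \<beta>\<bar> \<le> 1" using r by auto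
      moreover have "norm y \<le> norm (p y) + norm ((\<nu> \<bullet> y - \<beta>) *\<^sub>R \<nu>)"
        unfolding p_def by (metis diff_add_cancel norm_triangle_ineq)
      ultimately show "norm y \<le> r + 1" using \<nu> by simp
    qed
  qed (auto simp: f_def)
  also have "\<dots> = plane_integral \<nu> Q g"
    unfolding plane_integral_eq[OF \<nu> Q]
    by (rule integral_cong) (simp add: f_def p_def nn inner_simps algebra_simps)
  finally show ?thesis .
qed

section \<open>Divergence theorem on bounded polyhedra by Lipschitz cutoff functions\<close>

definition clamp01 :: "real \<Rightarrow> real" where
  "clamp01 s = min 1 (max 0 s)"

lemma clamp01_simps: "s \<le> 0 \<Longrightarrow> clamp01 s = 0" "1 \<le> s \<Longrightarrow> clamp01 s = 1" "0 \<le> clamp01 s" "clamp01 s \<le> 1"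
  "\<bar>clamp01 s - clamp01 t\<bar> \<le> \<bar>s - t\<bar>" "clamp01 s = 0 \<longleftrightarrow> s \<le> 0"
  by (auto simp: clamp01_def min_def max_def)

lemma clamp01_derivative:
  assumes "s \<noteq> 0" "s \<noteq> 1"
  shows "(clamp01 has_real_derivative (if 0 < s \<and> s < 1 then 1 else 0)) (at s)"
proof -
  consider "s < 0" | "0 < s" "s < 1" | "1 < s" using assms by linarith
  then show ?thesis
  proof cases
    case 1
    have "((\<lambda>_. 0) has_real_derivative 0) (at s)" by simp
    then have "(clamp01 has_real_derivative 0) (at s)"
      by (rule has_field_derivative_transform_within_open[of _ _ s "{..<0}"])
        (use 1 in \<open>auto simp: clamp01_def\<close>)
    then show ?thesis using 1 by simp
  next
    case 2
    have "((\<lambda>s. s) has_real_derivative 1) (at s)" by simp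
    then have "(clamp01 has_real_derivative 1) (at s)"
      by (rule has_field_derivative_transform_within_open[of _ _ s "{0<..<1}"])
        (use 2 in \<open>auto simp: clamp01_def\<close>)
    then show ?thesis using 2 by simp
  next
    case 3
    have "((\<lambda>_. 1) has_real_derivative 0) (at s)" by simp
    then have "(clamp01 has_real_derivative 0) (at s)"
      by (rule has_field_derivative_transform_within_open[of _ _ s "{1<..}"])
        (use 3 in \<open>auto simp: clamp01_def\<close>)
    then show ?thesis using 3 by simp
  qed
qed

context
  fixes I :: "'i set" and a :: "'i \<Rightarrow> real^'n" and b :: "'i \<Rightarrow> real" and P
  assumes fin: "finite I" and norm_a: "\<And>i. i \<in> I \<Longrightarrow> norm (a i) = 1"
  defines "P \<equiv> {x. \<forall>i\<in>I. a i \<bullet> x \<le> b i}"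
begin

text \<open>As \<open>\<epsilon> \<rightarrow> 0\<close>, the gradient of the cutoff function concentrates in layers of width \<open>\<epsilon>\<close> below the faces
  of \<open>P\<close> and produces the boundary integrals.\<close>

definition cutoff :: "real \<Rightarrow> 'i set \<Rightarrow> real^'n \<Rightarrow> real" where
  "cutoff \<epsilon> J x = (\<Prod>i\<in>J. clamp01 ((b i - a i \<bullet> x) / \<epsilon>))"

lemma cutoff_bounds: "0 \<le> cutoff \<epsilon> J x" "cutoff \<epsilon> J x \<le> 1"
  unfolding cutoff_def by (auto intro!: prod_nonneg prod_le_1 clamp01_simps)

lemma cutoff_nonzero: "0 < \<epsilon> \<Longrightarrow> finite J \<Longrightarrow> cutoff \<epsilon> J x \<noteq> 0 \<longleftrightarrow> (\<forall>i\<in>J. a i \<bullet> x < b i)"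
  by (auto simp: cutoff_def clamp01_simps not_le divide_le_0_iff)

lemma cutoff_outside: "0 < \<epsilon> \<Longrightarrow> x \<notin> P \<Longrightarrow> cutoff \<epsilon> I x = 0"
  using cutoff_nonzero[OF _ fin, of \<epsilon> x] by (force simp: P_def)

lemma cutoff_lipschitz:
  assumes "0 < \<epsilon>"
  shows "\<bar>cutoff \<epsilon> I x - cutoff \<epsilon> I y\<bar> \<le> real (card I) / \<epsilon> * norm (x - y)"
proof -
  have "\<bar>cutoff \<epsilon> I x - cutoff \<epsilon> I y\<bar>
    \<le> (\<Sum>i\<in>I. \<bar>clamp01 ((b i - a i \<bullet> x) / \<epsilon>) - clamp01 ((b i - a i \<bullet> y) / \<epsilon>)\<bar>)"
    unfolding cutoff_def
    using norm_prod_diff[of I "\<lambda>i. clamp01 ((b i - a i \<bullet> x) / \<epsilon>)" "\<lambda>i. clamp01 ((b i - a i \<bullet> y) / \<epsilon>)"]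
    by (simp add: clamp01_simps)
  also have "\<dots> \<le> (\<Sum>i\<in>I. 1 / \<epsilon> * norm (x - y))"
  proof (rule sum_mono)
    fix i assume i: "i \<in> I"
    have "\<bar>clamp01 ((b i - a i \<bullet> x) / \<epsilon>) - clamp01 ((b i - a i \<bullet> y) / \<epsilon>)\<bar>
      \<le> \<bar>(b i - a i \<bullet> x) / \<epsilon> - (b i - a i \<bullet> y) / \<epsilon>\<bar>" by (rule clamp01_simps)
    also have "\<dots> = \<bar>a i \<bullet> (y - x)\<bar> / \<epsilon>" using assms
      by (simp add: inner_diff_right flip: diff_divide_distrib)
    also have "\<dots> \<le> norm (x - y) / \<epsilon>"
      using Cauchy_Schwarz_ineq2[of "a i" "y - x"] norm_a[OF i] assms
      by (intro divide_right_mono) (auto simp: norm_minus_commute)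
    finally show "\<bar>clamp01 ((b i - a i \<bullet> x) / \<epsilon>) - clamp01 ((b i - a i \<bullet> y) / \<epsilon>)\<bar> \<le> 1 / \<epsilon> * norm (x - y)" by simp
  qed
  finally show ?thesis by simp
qed

lemma cutoff_has_derivative:
  assumes "0 < \<epsilon>" "\<And>i. i \<in> I \<Longrightarrow> a i \<bullet> x \<noteq> b i \<and> a i \<bullet> x \<noteq> b i - \<epsilon>"
  shows "(cutoff \<epsilon> I has_derivative (\<lambda>h. \<Sum>i\<in>I. (if b i - \<epsilon> < a i \<bullet> x \<and> a i \<bullet> x < b i then 1 else 0) *
      (- (a i \<bullet> h) / \<epsilon>) * cutoff \<epsilon> (I - {i}) x)) (at x)"
  unfolding cutoff_def
proof (rule has_derivative_prod)
  fix i assume i: "i \<in> I"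
  have "(clamp01 has_real_derivative (if 0 < (b i - a i \<bullet> x) / \<epsilon> \<and> (b i - a i \<bullet> x) / \<epsilon> < 1 then 1 else 0))
    (at ((b i - a i \<bullet> x) / \<epsilon>))"
    using assms(2)[OF i] assms(1) by (intro clamp01_derivative) (auto simp: field_simps)
  moreover have "(0 < (b i - a i \<bullet> x) / \<epsilon> \<and> (b i - a i \<bullet> x) / \<epsilon> < 1) = (b i - \<epsilon> < a i \<bullet> x \<and> a i \<bullet> x < b i)"
    using assms(1) by (auto simp: field_simps)
  ultimately have "(clamp01 has_derivative (\<lambda>h. (if b i - \<epsilon> < a i \<bullet> x \<and> a i \<bullet> x < b i then 1 else 0) * h))
    (at ((b i - a i \<bullet> x) / \<epsilon>))" by (simp add: has_field_derivative_def)
  moreover have "((\<lambda>x. (b i - a i \<bullet> x) / \<epsilon>) has_derivative (\<lambda>h. - (a i \<bullet> h) / \<epsilon>)) (at x)"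
    using assms(1) by (auto intro!: derivative_eq_intros simp: less_imp_neq[symmetric])
  ultimately show "((\<lambda>x. clamp01 ((b i - a i \<bullet> x) / \<epsilon>)) has_derivative
      (\<lambda>h. (if b i - \<epsilon> < a i \<bullet> x \<and> a i \<bullet> x < b i then 1 else 0) * (- (a i \<bullet> h) / \<epsilon>))) (at x)"
    by (rule has_derivative_compose[rotated])
qed

lemma borel_measurable_clamp01: "clamp01 \<in> borel_measurable borel"
  unfolding clamp01_def[abs_def] by measurable

lemma borel_measurable_cutoff: "cutoff \<epsilon> J \<in> borel_measurable borel"
proof -
  have "(\<lambda>x. clamp01 ((b i - a i \<bullet> x) / \<epsilon>)) \<in> borel_measurable borel" for i
    by (rule measurable_compose[OF _ borel_measurable_clamp01]) measurable
  then show ?thesis unfolding cutoff_def[abs_def] by (intro borel_measurable_prod)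
qed

lemma closed_P: "closed P"
proof -
  have "P = (\<Inter>i\<in>I. {x. a i \<bullet> x \<le> b i})" by (auto simp: P_def)
  then show ?thesis by (auto intro!: closed_INT closed_halfspace_le)
qed

lemma convex_P: "convex P"
proof -
  have "P = (\<Inter>i\<in>I. {x. a i \<bullet> x \<le> b i})" by (auto simp: P_def)
  then show ?thesis by (auto intro!: convex_INT convex_halfspace_le)
qed

text \<open>The polynomial field \<open>w\<close> need not be globally Lipschitz, but cut off it
  vanishes outside the compact set \<open>P\<close> and becomes so; hence its divergence has
  integral zero. The product rule splits this divergence into a volume term and the layer
  terms.\<close>

lemma cutoff_divergence_integral:
  assumes \<epsilon>: "0 < \<epsilon>" and bd: "bounded P" and w: "w \<in> vpolys k"
  shows "((\<lambda>x. cutoff \<epsilon> I x * divergence w x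
    - (\<Sum>i\<in>I. (if b i - \<epsilon> < a i \<bullet> x \<and> a i \<bullet> x < b i then 1 / \<epsilon> * cutoff \<epsilon> (I - {i}) x * (a i \<bullet> w x) else 0)))
    has_integral 0) UNIV"
proof -
  \<comment> \<open>The kinks of the clamped factors, at both ends of each layer.\<close>
  define N where "N = (\<Union>i\<in>I. {x. a i \<bullet> x = b i} \<union> {x. a i \<bullet> x = b i - \<epsilon>})"
  have N: "negligible N"
    unfolding N_def using fin norm_a
    by (intro negligible_Union finite_imageI) (force intro!: negligible_Un negligible_hyperplane)+
  define V where "V x = cutoff \<epsilon> I x *\<^sub>R w x" for x
  define \<eta>' where "\<eta>' x h = (\<Sum>i\<in>I. (if b i - \<epsilon> < a i \<bullet> x \<and> a i \<bullet> x < b i then 1 else 0) *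
      (- (a i \<bullet> h) / \<epsilon>) * cutoff \<epsilon> (I - {i}) x)" for x h
  have V': "(V has_derivative (\<lambda>h. cutoff \<epsilon> I x *\<^sub>R (jacobian w (at x) *v h) + \<eta>' x h *\<^sub>R w x)) (at x)"
    if "x \<notin> N" for x
    unfolding V_def \<eta>'_def
    by (rule has_derivative_scaleR[OF cutoff_has_derivative[OF \<epsilon>] vpolys_has_derivative(1)[OF w]])
      (use that in \<open>auto simp: N_def\<close>)
  have comp: "compact P" using bd closed_P compact_eq_bounded_closed by blast
  obtain M where M: "M > 0" "\<And>x. x \<in> P \<Longrightarrow> norm (w x) \<le> M"
  proof -
    have "bounded (w ` P)"
      by (intro compact_imp_bounded compact_continuous_image continuous_on_vpolys[OF w] comp)
    then show ?thesis using that by (auto simp: bounded_pos)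
  qed
  obtain L where L: "L > 0" "\<And>x y. x \<in> P \<Longrightarrow> y \<in> P \<Longrightarrow> norm (w x - w y) \<le> L * norm (x - y)"
  proof -
    obtain K where K: "K > 0" "\<And>(A :: real^'n^'n) x. norm (A *v x) \<le> norm A * norm x * K"
      using bounded_bilinear.pos_bounded[OF bounded_bilinear_matrix_vector_mult] by blast
    have "bounded ((\<lambda>x. jacobian w (at x)) ` P)"
      by (intro compact_imp_bounded compact_continuous_image continuous_on_jacobian[OF w] comp)
    then obtain J where J: "J > 0" "\<And>x. x \<in> P \<Longrightarrow> norm (jacobian w (at x)) \<le> J" by (auto simp: bounded_pos)
    have "norm (w x - w y) \<le> (J * K) * norm (x - y)" if "x \<in> P" "y \<in> P" for x y
    proof (rule differentiable_bound[OF convex_P _ _ that])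
      show "(w has_derivative (\<lambda>h. jacobian w (at x) *v h)) (at x within P)" for x
        using vpolys_has_derivative(1)[OF w] by (rule has_derivative_at_withinI)
      show "onorm (\<lambda>h. jacobian w (at x) *v h) \<le> J * K" if "x \<in> P" for x
      proof (rule onorm_le)
        fix h :: "real^'n"
        have "norm (jacobian w (at x)) * norm h * K \<le> J * norm h * K"
          using J(2)[OF that] K(1) by (intro mult_right_mono) auto
        then show "norm (jacobian w (at x) *v h) \<le> J * K * norm h"
          using K(2)[of "jacobian w (at x)" h] by (simp add: mult_ac)
      qed
    qed
    then show ?thesis using that[of "J * K"] J K by simp
  qed
  define C where "C = real (card I) / \<epsilon>"
  have C: "C \<ge> 0" "\<And>x y. \<bar>cutoff \<epsilon> I x - cutoff \<epsilon> I y\<bar> \<le> C * norm (x - y)"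
    using cutoff_lipschitz[OF \<epsilon>] \<epsilon> by (auto simp: C_def)
  have lip: "norm (V x - V y) \<le> (C * M + L) * norm (x - y)" for x y
  proof -
    \<comment> \<open>With one point outside \<open>P\<close>, where the cutoff is zero, only the
      value of \<open>w\<close> at the other point enters, so the bound on \<open>P\<close> suffices
      even if the segment leaves \<open>P\<close>.\<close>
    have half: "norm (V x - V y) \<le> (C * M + L) * norm (x - y)" if y: "y \<notin> P" for x y
    proof (cases "x \<in> P")
      case True
      have "norm (V x - V y) = \<bar>cutoff \<epsilon> I x - cutoff \<epsilon> I y\<bar> * norm (w x)"
        using cutoff_outside[OF \<epsilon> y] by (simp add: V_def)
      also have "\<dots> \<le> (C * norm (x - y)) * M" using C M True by (intro mult_mono) auto
      also have "\<dots> \<le> (C * M + L) * norm (x - y)" using L(1) by (simp add: algebra_simps)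
      finally show ?thesis .
    next
      case False
      then show ?thesis using cutoff_outside[OF \<epsilon>] y C(1) M(1) L(1) by (simp add: V_def)
    qed
    show ?thesis
    proof (cases "x \<in> P \<and> y \<in> P")
      case True
      have "V x - V y = (cutoff \<epsilon> I x - cutoff \<epsilon> I y) *\<^sub>R w x + cutoff \<epsilon> I y *\<^sub>R (w x - w y)"
        by (simp add: V_def algebra_simps)
      then have "norm (V x - V y) \<le> \<bar>cutoff \<epsilon> I x - cutoff \<epsilon> I y\<bar> * norm (w x) + \<bar>cutoff \<epsilon> I y\<bar> * norm (w x - w y)"
        by (metis norm_scaleR norm_triangle_ineq)
      also have "\<dots> \<le> (C * norm (x - y)) * M + 1 * (L * norm (x - y))"
        using C M L True cutoff_bounds[of \<epsilon> I y] by (intro add_mono mult_mono) auto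
      finally show ?thesis by (simp add: algebra_simps)
    next
      case False
      then show ?thesis using half[of x y] half[of y x] by (metis norm_minus_commute)
    qed
  qed
  have "V differentiable (at x)" if "x \<notin> N" for x
    using V'[OF that] unfolding differentiable_def by blast
  moreover have "V x = 0" if "x \<notin> P" for x
    using cutoff_outside[OF \<epsilon> that] by (simp add: V_def)
  ultimately have "(divergence V has_integral 0) UNIV"
    by (intro has_integral_divergence_compact_support[OF lip bd _ N])
  then show ?thesis
  proof (rule has_integral_spike[OF N, rotated])
    fix x assume x: "x \<in> UNIV - N"
    then have Vx: "(V has_derivative (\<lambda>h. cutoff \<epsilon> I x *\<^sub>R (jacobian w (at x) *v h) + \<eta>' x h *\<^sub>R w x)) (at x)"
      using V' by simp
    have lin: "linear (\<eta>' x)"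
    proof -
      have "\<eta>' x = (\<lambda>h. (\<Sum>i\<in>I. ((if b i - \<epsilon> < a i \<bullet> x \<and> a i \<bullet> x < b i then 1 else 0) *
          (- 1 / \<epsilon>) * cutoff \<epsilon> (I - {i}) x) *\<^sub>R a i) \<bullet> h)"
        unfolding \<eta>'_def inner_sum_left by (intro ext sum.cong) auto
      then show ?thesis by (simp add: bounded_linear_inner_right bounded_linear.linear)
    qed
    have "divergence V x = trace (matrix (\<lambda>h. cutoff \<epsilon> I x *\<^sub>R (jacobian w (at x) *v h) + \<eta>' x h *\<^sub>R w x))"
      using frechet_derivative_at[OF Vx] by (simp add: divergence_def jacobian_def)
    also have "\<dots> = cutoff \<epsilon> I x * divergence w x + trace (matrix (\<lambda>h. \<eta>' x h *\<^sub>R w x))"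
      by (simp add: trace_def matrix_def sum.distrib sum_distrib_left matrix_vector_mult_basis column_def divergence_def)
    also have "trace (matrix (\<lambda>h. \<eta>' x h *\<^sub>R w x)) = \<eta>' x (w x)" by (rule trace_rank_one[OF lin])
    also have "\<eta>' x (w x) = - (\<Sum>i\<in>I. (if b i - \<epsilon> < a i \<bullet> x \<and> a i \<bullet> x < b i then
       1 / \<epsilon> * cutoff \<epsilon> (I - {i}) x * (a i \<bullet> w x) else 0))"
      unfolding \<eta>'_def sum_negf[symmetric] by (intro sum.cong) auto
    finally show "cutoff \<epsilon> I x * divergence w x
      - (\<Sum>i\<in>I. (if b i - \<epsilon> < a i \<bullet> x \<and> a i \<bullet> x < b i then 1 / \<epsilon> * cutoff \<epsilon> (I - {i}) x * (a i \<bullet> w x) else 0))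
      = divergence V x" by simp
  qed
qed

text \<open>For g = a_i \<bullet> w this is the \<open>i\<close>-th term of minus the gradient of
  the cutoff, paired with \<open>w\<close>: factor \<open>i\<close> has slope 1 / \<epsilon> on its
  layer, the other factors stay undifferentiated.\<close>

definition layer :: "real \<Rightarrow> 'i \<Rightarrow> (real^'n \<Rightarrow> real) \<Rightarrow> real^'n \<Rightarrow> real" where
  "layer \<epsilon> i g x = (if b i - \<epsilon> < a i \<bullet> x \<and> a i \<bullet> x < b i then 1 / \<epsilon> * cutoff \<epsilon> (I - {i}) x * g x else 0)"

lemma layer_nonzero: "0 < \<epsilon> \<Longrightarrow> layer \<epsilon> i g x \<noteq> 0 \<Longrightarrow> x \<in> P"
  using cutoff_nonzero[of \<epsilon> "I - {i}" x] fin
  by (force simp: layer_def P_def less_imp_le split: if_splits)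

lemma layer_absolutely_integrable:
  assumes \<epsilon>: "0 < \<epsilon>" and bd: "bounded P" and g: "continuous_on UNIV g"
  shows "layer \<epsilon> i g absolutely_integrable_on UNIV"
proof -
  have gm: "g \<in> borel_measurable borel" by (rule borel_measurable_continuous_onI[OF g])
  have "compact P" using bd closed_P compact_eq_bounded_closed by blast
  then have "bounded (g ` P)"
    by (intro compact_imp_bounded compact_continuous_image continuous_on_subset[OF g]) auto
  then obtain M where M: "M > 0" "\<And>x. x \<in> P \<Longrightarrow> \<bar>g x\<bar> \<le> M" by (auto simp: bounded_pos)
  show ?thesis
  proof (rule absolutely_integrable_bounded_support[OF _ bd])
    show "layer \<epsilon> i g \<in> borel_measurable borel"
      unfolding layer_def[abs_def] using gm borel_measurable_cutoff by measurable
    fix x assume "x \<in> P"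
    have "cutoff \<epsilon> (I - {i}) x * \<bar>g x\<bar> \<le> 1 * M"
      using cutoff_bounds[of \<epsilon> "I - {i}" x] M(2)[OF \<open>x \<in> P\<close>] by (intro mult_mono) auto
    then have "1 / \<epsilon> * (cutoff \<epsilon> (I - {i}) x * \<bar>g x\<bar>) \<le> 1 / \<epsilon> * M"
      using \<epsilon> by (intro mult_left_mono) auto
    then show "\<bar>layer \<epsilon> i g x\<bar> \<le> 1 / \<epsilon> * M"
      using \<epsilon> M(1) cutoff_bounds[of \<epsilon> "I - {i}" x] by (simp add: layer_def abs_mult)
  qed (use layer_nonzero[OF \<epsilon>] in blast)
qed

text \<open>The layer of width \<open>\<epsilon>\<close> below the face \<open>i\<close> is mapped to the prism of height 1 above it.\<close>

lemma layer_rescaled: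
  assumes card: "CARD('n) \<in> {2, 3}" and \<epsilon>: "0 < \<epsilon>" and bd: "bounded P" and g: "continuous_on UNIV g"
    and i: "i \<in> I"
  shows "(\<lambda>y. \<epsilon> * layer \<epsilon> i g (y - ((1 + \<epsilon>) * (a i \<bullet> y - b i)) *\<^sub>R a i)) integrable_on UNIV"
    and "integral UNIV (\<lambda>y. \<epsilon> * layer \<epsilon> i g (y - ((1 + \<epsilon>) * (a i \<bullet> y - b i)) *\<^sub>R a i)) = integral UNIV (layer \<epsilon> i g)"
proof -
  define \<nu> where "\<nu> = a i"
  have nn: "\<nu> \<bullet> \<nu> = 1" using norm_a[OF i] by (simp add: norm_eq_1 \<nu>_def)
  \<comment> \<open>\<psi> fixes the plane and multiplies the signed height by -1 / \<epsilon>, so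
    heights in (-\<epsilon>, 0) go to (0, 1). Its determinant has modulus 1 / \<epsilon>, which
    cancels the factor \<epsilon> in \<open>F\<close>; \<Psi> is the inverse map.\<close>
  define \<psi> where "\<psi> x = x + (- (1 + 1 / \<epsilon>) * (\<nu> \<bullet> x - b i)) *\<^sub>R \<nu>" for x
  define \<psi>' where "\<psi>' h = h + (\<nu> \<bullet> h) *\<^sub>R (- (1 + 1 / \<epsilon>) *\<^sub>R \<nu>)" for h
  define \<Psi> where "\<Psi> y = y - ((1 + \<epsilon>) * (\<nu> \<bullet> y - b i)) *\<^sub>R \<nu>" for y
  have t\<psi>: "\<nu> \<bullet> \<psi> x - b i = - (1 / \<epsilon>) * (\<nu> \<bullet> x - b i)" for x
    by (simp add: \<psi>_def inner_simps nn algebra_simps)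
  have t\<Psi>: "\<nu> \<bullet> \<Psi> y - b i = - \<epsilon> * (\<nu> \<bullet> y - b i)" for y
    by (simp add: \<Psi>_def inner_simps nn algebra_simps)
  have \<Psi>\<psi>: "\<Psi> (\<psi> x) = x" for x
  proof -
    have "\<Psi> (\<psi> x) = \<psi> x - ((1 + \<epsilon>) * (\<nu> \<bullet> \<psi> x - b i)) *\<^sub>R \<nu>" by (simp only: \<Psi>_def)
    also have "\<dots> = x + (- (1 + 1 / \<epsilon>) * (\<nu> \<bullet> x - b i) + (1 + \<epsilon>) * (1 / \<epsilon>) * (\<nu> \<bullet> x - b i)) *\<^sub>R \<nu>"
      unfolding t\<psi> by (simp add: \<psi>_def algebra_simps)
    also have "(1 + \<epsilon>) * (1 / \<epsilon>) = 1 + 1 / \<epsilon>" using \<epsilon> by (simp add: field_simps)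
    finally show ?thesis by (simp add: algebra_simps)
  qed
  have \<psi>\<Psi>: "\<psi> (\<Psi> y) = y" for y
  proof -
    have "\<psi> (\<Psi> y) = \<Psi> y + (- (1 + 1 / \<epsilon>) * (\<nu> \<bullet> \<Psi> y - b i)) *\<^sub>R \<nu>" by (simp only: \<psi>_def)
    also have "\<dots> = y + (((1 + 1 / \<epsilon>) * \<epsilon>) * (\<nu> \<bullet> y - b i) - (1 + \<epsilon>) * (\<nu> \<bullet> y - b i)) *\<^sub>R \<nu>"
      unfolding t\<Psi> by (simp add: \<Psi>_def algebra_simps)
    also have "(1 + 1 / \<epsilon>) * \<epsilon> = 1 + \<epsilon>" using \<epsilon> by (simp add: field_simps)
    finally show ?thesis by (simp add: algebra_simps)
  qed
  have img: "\<psi> ` UNIV = UNIV" using \<psi>\<Psi> by (metis surjI)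
  have inj: "inj_on \<psi> UNIV" using \<Psi>\<psi> by (metis injI)
  have der: "(\<psi> has_derivative \<psi>') (at x within UNIV)" for x
    unfolding \<psi>_def \<psi>'_def using less_imp_neq[OF \<epsilon>, symmetric]
    by (auto intro!: derivative_eq_intros simp: algebra_simps)
  have "det (matrix \<psi>') = 1 + \<nu> \<bullet> (- (1 + 1 / \<epsilon>) *\<^sub>R \<nu>)"
    unfolding \<psi>'_def by (rule det_identity_plus_rank_one)
  also have "\<dots> = - (1 / \<epsilon>)" by (simp add: nn)
  finally have det: "\<bar>det (matrix \<psi>')\<bar> = 1 / \<epsilon>" using \<epsilon> by simp
  define F where "F y = \<epsilon> * layer \<epsilon> i g (\<Psi> y)" for y
  have eq: "(\<lambda>x. \<bar>det (matrix \<psi>')\<bar> * F (\<psi> x)) = layer \<epsilon> i g"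
    using \<epsilon> by (simp add: det F_def \<Psi>\<psi>)
  have "F absolutely_integrable_on (\<psi> ` UNIV)" "integral (\<psi> ` UNIV) F = integral UNIV (layer \<epsilon> i g)"
    using change_of_variables_dim_2_3[OF card _ der inj, of F] layer_absolutely_integrable[OF \<epsilon> bd g, of i]
    unfolding eq by auto
  then have "F integrable_on UNIV" "integral UNIV F = integral UNIV (layer \<epsilon> i g)"
    unfolding img by (auto simp: absolutely_integrable_on_def)
  then show "(\<lambda>y. \<epsilon> * layer \<epsilon> i g (y - ((1 + \<epsilon>) * (a i \<bullet> y - b i)) *\<^sub>R a i)) integrable_on UNIV"
    "integral UNIV (\<lambda>y. \<epsilon> * layer \<epsilon> i g (y - ((1 + \<epsilon>) * (a i \<bullet> y - b i)) *\<^sub>R a i)) = integral UNIV (layer \<epsilon> i g)"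
    unfolding F_def[abs_def] \<Psi>_def[abs_def] \<nu>_def by auto
qed

text \<open>After rescaling, all integrands live over the same prism. Over points of the face off
  the other planes, the remaining cutoff factors are eventually 1; over points outside
  \<open>P\<close>, some factor is eventually 0. The points projecting into another plane form a
  null set because the planes are distinct.\<close>

lemma layer_tendsto_plane_integral:
  assumes card: "CARD('n) \<in> {2, 3}" and bd: "bounded P" and g: "continuous_on UNIV g"
    and distinct: "\<And>j. j \<in> I \<Longrightarrow> j \<noteq> i \<Longrightarrow> {x. a j \<bullet> x = b j} \<noteq> {x. a i \<bullet> x = b i}"
    and i: "i \<in> I"
  shows "(\<lambda>k. integral UNIV (layer (inverse (real (Suc k))) i g)) \<longlonglongrightarrow>
    plane_integral (a i) (P \<inter> {x. a i \<bullet> x = b i}) g"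
proof -
  define \<epsilon> where "\<epsilon> k = inverse (real (Suc k))" for k
  have \<epsilon>: "0 < \<epsilon> k" "\<epsilon> k \<le> 1" for k by (auto simp: \<epsilon>_def field_simps)
  have \<epsilon>0: "\<epsilon> \<longlonglongrightarrow> 0" unfolding \<epsilon>_def by (rule LIMSEQ_inverse_real_of_nat)
  define \<nu> where "\<nu> = a i"
  have \<nu>: "norm \<nu> = 1" and nn: "\<nu> \<bullet> \<nu> = 1" using norm_a[OF i] by (simp_all add: norm_eq_1 \<nu>_def)
  define t where "t y = \<nu> \<bullet> y - b i" for y
  define p where "p y = y - t y *\<^sub>R \<nu>" for y
  define \<Psi> where "\<Psi> k y = y - ((1 + \<epsilon> k) * t y) *\<^sub>R \<nu>" for k y
  have \<Psi>p: "\<Psi> k y = p y - (\<epsilon> k * t y) *\<^sub>R \<nu>" for k y by (simp add: \<Psi>_def p_def algebra_simps)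
  have ap: "a i \<bullet> p y = b i" for y by (simp add: p_def t_def inner_simps nn flip: \<nu>_def)
  have a\<Psi>: "a i \<bullet> \<Psi> k y = b i - \<epsilon> k * t y" for k y
    using ap[of y] nn by (simp add: \<Psi>p inner_simps \<nu>_def)
  define f where "f k y = \<epsilon> k * layer (\<epsilon> k) i g (\<Psi> k y)" for k y
  have f: "f k y = (if 0 < t y \<and> t y < 1 then cutoff (\<epsilon> k) (I - {i}) (\<Psi> k y) * g (\<Psi> k y) else 0)" for k y
    using \<epsilon>(1)[of k] by (auto simp: f_def layer_def a\<Psi> zero_less_mult_iff mult_less_cancel_left_pos
      mult_less_cancel_left2)
  have fint: "f k integrable_on UNIV" "integral UNIV (f k) = integral UNIV (layer (\<epsilon> k) i g)" for k
    using layer_rescaled[OF card \<epsilon>(1) bd g i, of k]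
    by (simp_all add: f_def[abs_def] \<Psi>_def t_def \<nu>_def)
  define G where "G y = (if 0 < t y \<and> t y < 1 \<and> p y \<in> P then g (p y) else 0)" for y
  have "compact P" using bd closed_P compact_eq_bounded_closed by blast
  then have "bounded (g ` P)"
    by (intro compact_imp_bounded compact_continuous_image continuous_on_subset[OF g]) auto
  then obtain M where M: "M > 0" "\<And>x. x \<in> P \<Longrightarrow> \<bar>g x\<bar> \<le> M" by (auto simp: bounded_pos)
  obtain r where r: "\<And>x. x \<in> P \<Longrightarrow> norm x \<le> r" using bd by (auto simp: bounded_iff)
  \<comment> \<open>\<open>y\<close> and \<open>\<Psi> k y\<close> are less than 2 apart, since the
    height is below 1 and \<open>\<epsilon> k\<close> at most 1.\<close>
  define H where "H x = (if x \<in> cball 0 (r + 2) then M else 0)" for x :: "real^'n"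
  have Hint: "H integrable_on UNIV"
    unfolding H_def integrable_restrict_UNIV by (intro integrable_on_const) simp
  have dom: "\<bar>f k y\<bar> \<le> H y" for k y
  proof (cases "f k y = 0")
    case True
    then show ?thesis using M(1) by (simp add: H_def)
  next
    case False
    then have P: "\<Psi> k y \<in> P" using layer_nonzero[OF \<epsilon>(1)] by (auto simp: f_def)
    have ty: "0 < t y" "t y < 1" using False by (auto simp: f split: if_splits)
    have "y = \<Psi> k y + ((1 + \<epsilon> k) * t y) *\<^sub>R \<nu>" by (simp add: \<Psi>_def)
    then have "norm y \<le> norm (\<Psi> k y) + norm (((1 + \<epsilon> k) * t y) *\<^sub>R \<nu>)" by (metis norm_triangle_ineq)
    moreover have "(1 + \<epsilon> k) * t y \<le> 2 * 1" using \<epsilon>[of k] ty by (intro mult_mono) auto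
    ultimately have "norm y \<le> r + 2" using r[OF P] ty \<epsilon>[of k] by (simp add: \<nu> abs_mult)
    moreover have "cutoff (\<epsilon> k) (I - {i}) (\<Psi> k y) * \<bar>g (\<Psi> k y)\<bar> \<le> 1 * M"
      using cutoff_bounds[of "\<epsilon> k" "I - {i}" "\<Psi> k y"] M(2)[OF P] by (intro mult_mono) auto
    ultimately show ?thesis using ty cutoff_bounds(1)[of "\<epsilon> k" "I - {i}" "\<Psi> k y"]
      by (simp add: f H_def abs_mult)
  qed
  define N where "N = (\<Union>j\<in>I - {i}. {y. a j \<bullet> (y - (\<nu> \<bullet> y - b i) *\<^sub>R \<nu>) = b j})"
  have N: "negligible N"
    unfolding N_def
  proof (intro negligible_Union finite_imageI)
    fix S assume "S \<in> (\<lambda>j. {y. a j \<bullet> (y - (\<nu> \<bullet> y - b i) *\<^sub>R \<nu>) = b j}) ` (I - {i})"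
    then obtain j where j: "j \<in> I" "j \<noteq> i" and S: "S = {y. a j \<bullet> (y - (\<nu> \<bullet> y - b i) *\<^sub>R \<nu>) = b j}" by auto
    have "a j \<noteq> 0" using norm_a[OF j(1)] by auto
    then show "negligible S"
      unfolding S using negligible_projection_hyperplane[OF \<nu> distinct[OF j, folded \<nu>_def]] by blast
  qed (use fin in auto)
  have conv: "(\<lambda>k. f k y) \<longlonglongrightarrow> G y" if y: "y \<notin> N" for y
  proof (cases "0 < t y \<and> t y < 1")
    case False
    then have "f k y = 0" "G y = 0" for k unfolding f G_def by auto
    then show ?thesis by simp
  next
    case ty: True
    have ne: "a j \<bullet> p y \<noteq> b j" if "j \<in> I - {i}" for j using y that by (auto simp: N_def p_def t_def)
    have \<Psi>lim: "(\<lambda>k. \<Psi> k y) \<longlonglongrightarrow> p y"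
      unfolding \<Psi>p by (rule tendsto_eq_intros \<epsilon>0 refl)+ simp
    have glim: "(\<lambda>k. g (\<Psi> k y)) \<longlonglongrightarrow> g (p y)"
      using g \<Psi>lim by (metis UNIV_I continuous_on_eq_continuous_at isCont_tendsto_compose open_UNIV)
    show ?thesis
    proof (cases "p y \<in> P")
      case True
      have "\<forall>\<^sub>F k in sequentially. 1 \<le> (b j - a j \<bullet> \<Psi> k y) / \<epsilon> k" if j: "j \<in> I - {i}" for j
      proof -
        define \<delta> where "\<delta> = b j - a j \<bullet> p y"
        have \<delta>: "\<delta> > 0" using True ne[OF j] j by (auto simp: P_def \<delta>_def less_le)
        have "\<forall>\<^sub>F k in sequentially. \<epsilon> k < \<delta> / 2" using \<epsilon>0 \<delta> by (intro order_tendstoD) auto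
        moreover have "(\<lambda>k. b j - a j \<bullet> \<Psi> k y) \<longlonglongrightarrow> \<delta>" unfolding \<delta>_def by (intro tendsto_intros \<Psi>lim)
        then have "\<forall>\<^sub>F k in sequentially. \<delta> / 2 < b j - a j \<bullet> \<Psi> k y" using \<delta> by (intro order_tendstoD) auto
        ultimately show ?thesis
        proof eventually_elim
          case (elim k)
          then have "\<epsilon> k \<le> b j - a j \<bullet> \<Psi> k y" by linarith
          then show ?case using \<epsilon>(1)[of k] by (simp add: le_divide_eq)
        qed
      qed
      then have "\<forall>\<^sub>F k in sequentially. \<forall>j\<in>I - {i}. 1 \<le> (b j - a j \<bullet> \<Psi> k y) / \<epsilon> k"
        using fin by (intro eventually_ball_finite) auto
      then have "\<forall>\<^sub>F k in sequentially. g (\<Psi> k y) = f k y"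
        by eventually_elim (use ty in \<open>simp add: f cutoff_def clamp01_simps\<close>)
      then have "(\<lambda>k. f k y) \<longlonglongrightarrow> g (p y)" using glim tendsto_cong by fastforce
      then show ?thesis using ty True by (simp add: G_def)
    next
      case False
      then obtain j where j: "j \<in> I" "b j < a j \<bullet> p y" by (auto simp: P_def not_le)
      then have "j \<noteq> i" using ap by auto
      have "(\<lambda>k. a j \<bullet> \<Psi> k y) \<longlonglongrightarrow> a j \<bullet> p y" by (intro tendsto_intros \<Psi>lim)
      then have "\<forall>\<^sub>F k in sequentially. b j < a j \<bullet> \<Psi> k y" using j by (intro order_tendstoD) auto
      then have "\<forall>\<^sub>F k in sequentially. 0 = f k y"
      proof eventually_elim
        case (elim k)
        then have "cutoff (\<epsilon> k) (I - {i}) (\<Psi> k y) = 0"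
          using cutoff_nonzero[OF \<epsilon>(1)[of k], of "I - {i}" "\<Psi> k y"] fin j(1) \<open>j \<noteq> i\<close> by force
        then show ?case by (simp add: f)
      qed
      then have "(\<lambda>k. f k y) \<longlonglongrightarrow> 0" using tendsto_cong[of "\<lambda>_. 0"] by fastforce
      then show ?thesis using False by (simp add: G_def)
    qed
  qed
  have "(\<lambda>k. integral UNIV (f k)) \<longlonglongrightarrow> integral UNIV G"
    by (rule dominated_convergence_almost_everywhere(2)[OF N fint(1) Hint dom conv])
  moreover have "integral UNIV G = plane_integral (a i) (P \<inter> {x. a i \<bullet> x = b i}) g"
  proof -
    \<comment> \<open>\<open>G\<close> has strict inequalities for the height, the prism of
      \<open>plane_integral\<close> is closed: they differ on its bottom and top.\<close>
    have null: "negligible ({y. \<nu> \<bullet> y = b i} \<union> {y. \<nu> \<bullet> y = b i + 1})"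
      using \<nu> by (intro negligible_Un negligible_hyperplane) auto
    show ?thesis
      unfolding \<nu>_def[symmetric]
      by (subst plane_integral_eq[OF \<nu>, of _ "b i"], simp add: \<nu>_def, rule integral_spike[OF null])
         (use ap in \<open>auto simp: G_def t_def p_def \<nu>_def\<close>)
  qed
  ultimately show ?thesis by (simp add: fint \<epsilon>_def)
qed

text \<open>The cutoff integrals tend to the integral over \<open>P\<close>, the equal layer
  integrals to the face integrals. Redundant half-spaces and empty faces are allowed, only the
  planes must differ; so a cut simplex needs no distinction of which facets survive the cut.\<close>

theorem divergence_theorem_polytope_unit:
  assumes card: "CARD('n) \<in> {2, 3}" and bd: "bounded P" and w: "w \<in> vpolys k"
    and distinct: "\<And>i j. i \<in> I \<Longrightarrow> j \<in> I \<Longrightarrow> j \<noteq> i \<Longrightarrow> {x. a j \<bullet> x = b j} \<noteq> {x. a i \<bullet> x = b i}"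
  shows "integral P (divergence w) =
    (\<Sum>i\<in>I. plane_integral (a i) (P \<inter> {x. a i \<bullet> x = b i}) (\<lambda>x. a i \<bullet> w x))"
proof -
  define \<epsilon> where "\<epsilon> k = inverse (real (Suc k))" for k
  have \<epsilon>: "0 < \<epsilon> k" for k by (auto simp: \<epsilon>_def)
  have \<epsilon>0: "\<epsilon> \<longlonglongrightarrow> 0" unfolding \<epsilon>_def by (rule LIMSEQ_inverse_real_of_nat)
  have gc: "continuous_on UNIV (\<lambda>x. a i \<bullet> w x)" for i
    by (intro continuous_intros continuous_on_vpolys[OF w])
  have divc: "continuous_on S (divergence w)" for S
    by (rule pdeg_continuous_on[OF pdeg_divergence[OF w]])
  have layint: "layer (\<epsilon> m) i (\<lambda>x. a i \<bullet> w x) integrable_on UNIV" for m i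
    using layer_absolutely_integrable[OF \<epsilon> bd gc] by (simp add: absolutely_integrable_on_def)
  define f where "f m x = cutoff (\<epsilon> m) I x * divergence w x" for m x
  have "((\<lambda>x. f m x - (\<Sum>i\<in>I. layer (\<epsilon> m) i (\<lambda>x. a i \<bullet> w x) x)) has_integral 0) UNIV" for m
    using cutoff_divergence_integral[OF \<epsilon> bd w, of m] by (simp add: f_def[abs_def] layer_def)
  moreover have "((\<lambda>x. \<Sum>i\<in>I. layer (\<epsilon> m) i (\<lambda>x. a i \<bullet> w x) x) has_integral
      (\<Sum>i\<in>I. integral UNIV (layer (\<epsilon> m) i (\<lambda>x. a i \<bullet> w x)))) UNIV" for m
    using fin layint by (intro has_integral_sum) (auto simp: integrable_integral)
  ultimately have "((\<lambda>x. (f m x - (\<Sum>i\<in>I. layer (\<epsilon> m) i (\<lambda>x. a i \<bullet> w x) x)) +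
      (\<Sum>i\<in>I. layer (\<epsilon> m) i (\<lambda>x. a i \<bullet> w x) x)) has_integral
      (0 + (\<Sum>i\<in>I. integral UNIV (layer (\<epsilon> m) i (\<lambda>x. a i \<bullet> w x))))) UNIV" for m
    by (rule has_integral_add)
  then have "(f m has_integral (\<Sum>i\<in>I. integral UNIV (layer (\<epsilon> m) i (\<lambda>x. a i \<bullet> w x)))) UNIV" for m
    by simp
  then have fint: "f m integrable_on UNIV"
    and feq: "integral UNIV (f m) = (\<Sum>i\<in>I. integral UNIV (layer (\<epsilon> m) i (\<lambda>x. a i \<bullet> w x)))" for m
    by (auto simp: integrable_on_def intro: integral_unique)
  have "(\<lambda>m. integral UNIV (f m)) \<longlonglongrightarrow> (\<Sum>i\<in>I. plane_integral (a i) (P \<inter> {x. a i \<bullet> x = b i}) (\<lambda>x. a i \<bullet> w x))"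
    unfolding feq \<epsilon>_def
    by (intro tendsto_sum layer_tendsto_plane_integral[OF card bd gc]) (use distinct in auto)
  moreover have "(\<lambda>m. integral UNIV (f m)) \<longlonglongrightarrow> integral UNIV (\<lambda>x. if x \<in> P then divergence w x else 0)"
  proof -
    define N where "N = (\<Union>i\<in>I. {x. a i \<bullet> x = b i})"
    have N: "negligible N"
      unfolding N_def using fin norm_a
      by (intro negligible_Union finite_imageI) (force intro!: negligible_hyperplane)+
    have comp: "compact P" using bd closed_P compact_eq_bounded_closed by blast
    then have "bounded (divergence w ` P)"
      by (intro compact_imp_bounded compact_continuous_image divc) auto
    then obtain M where M: "M > 0" "\<And>x. x \<in> P \<Longrightarrow> \<bar>divergence w x\<bar> \<le> M" by (auto simp: bounded_pos)
    define H where "H x = (if x \<in> P then M else 0)" for x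
    have "P \<in> lmeasurable" by (rule lmeasurable_compact[OF comp])
    then have Hint: "H integrable_on UNIV"
      unfolding H_def integrable_restrict_UNIV by (intro integrable_on_const)
    have dom: "\<bar>f m x\<bar> \<le> H x" for m x
    proof (cases "x \<in> P")
      case True
      have "cutoff (\<epsilon> m) I x * \<bar>divergence w x\<bar> \<le> 1 * M"
        using cutoff_bounds[of "\<epsilon> m" I x] M(2)[OF True] by (intro mult_mono) auto
      then show ?thesis using True cutoff_bounds[of "\<epsilon> m" I x] by (simp add: f_def H_def abs_mult)
    next
      case False
      then show ?thesis using cutoff_outside[OF \<epsilon>] by (simp add: f_def H_def)
    qed
    have conv: "(\<lambda>m. f m x) \<longlonglongrightarrow> (if x \<in> P then divergence w x else 0)" if x: "x \<notin> N" for x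
    proof (cases "x \<in> P")
      case True
      have "\<forall>\<^sub>F m in sequentially. 1 \<le> (b i - a i \<bullet> x) / \<epsilon> m" if i: "i \<in> I" for i
      proof -
        have "0 < b i - a i \<bullet> x" using True x i by (auto simp: P_def N_def less_le)
        then have "\<forall>\<^sub>F m in sequentially. \<epsilon> m < b i - a i \<bullet> x" using \<epsilon>0 by (intro order_tendstoD) auto
        then show ?thesis
          by eventually_elim (use \<epsilon> in \<open>auto simp: le_divide_eq less_imp_le\<close>)
      qed
      then have "\<forall>\<^sub>F m in sequentially. \<forall>i\<in>I. 1 \<le> (b i - a i \<bullet> x) / \<epsilon> m"
        using fin by (intro eventually_ball_finite) auto
      then have "\<forall>\<^sub>F m in sequentially. divergence w x = f m x"
        by eventually_elim (simp add: f_def cutoff_def clamp01_simps)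
      then have "(\<lambda>m. f m x) \<longlonglongrightarrow> divergence w x" using tendsto_cong[of "\<lambda>_. divergence w x"] by fastforce
      then show ?thesis using True by simp
    next
      case False
      then show ?thesis using cutoff_outside[OF \<epsilon>] by (simp add: f_def)
    qed
    show ?thesis by (rule dominated_convergence_almost_everywhere(2)[OF N fint Hint dom conv])
  qed
  ultimately show ?thesis using LIMSEQ_unique by (fastforce simp: integral_restrict_UNIV)
qed

end

section \<open>Simplices and Alfeld splits\<close>

definition full_simplex :: "(real^'n) set \<Rightarrow> bool" where
  "full_simplex W \<longleftrightarrow> \<not> affine_dependent W \<and> card W = Suc CARD('n)"

definition bary_coeffs :: "(real^'n) set \<Rightarrow> real^'n \<Rightarrow> (real^'n) \<times> real" where
  "bary_coeffs W v = (SOME (g, c). \<forall>u\<in>W. g \<bullet> u + c = (if u = v then 1 else 0))"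

definition bary_grad :: "(real^'n) set \<Rightarrow> real^'n \<Rightarrow> real^'n" where
  "bary_grad W v = fst (bary_coeffs W v)"

definition bary :: "(real^'n) set \<Rightarrow> real^'n \<Rightarrow> real^'n \<Rightarrow> real" where
  "bary W v x = bary_grad W v \<bullet> x + snd (bary_coeffs W v)"

text \<open>\<open>v\<close> is the vertex opposite to the facet. Its barycentric coordinate is
  positive inside and zero on that facet, so the negative gradient points outwards.\<close>

definition outer_normal :: "(real^'n) set \<Rightarrow> real^'n \<Rightarrow> real^'n" where
  "outer_normal W v = sgn (- bary_grad W v)"

lemma full_simplex_finite: "full_simplex W \<Longrightarrow> finite W"
  by (auto simp: full_simplex_def intro: card_ge_0_finite)

lemma vertices_convex_hull: "\<not> affine_dependent W \<Longrightarrow> vertices (convex hull W) = W"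
  by (auto simp: vertices_def extreme_point_of_convex_hull_affine_independent)

lemma affine_function_convex_combination:
  assumes "finite W" "sum c W = 1"
  shows "(g :: real^'n) \<bullet> (\<Sum>v\<in>W. c v *\<^sub>R v) + d = (\<Sum>v\<in>W. c v * (g \<bullet> v + d))"
proof -
  have "(\<Sum>v\<in>W. c v * (g \<bullet> v + d)) = (\<Sum>v\<in>W. c v * (g \<bullet> v)) + sum c W * d"
    by (simp add: distrib_left sum.distrib sum_distrib_right)
  then show ?thesis using assms(2) by (simp add: inner_sum_right)
qed

context
  fixes W :: "(real^'n) set"
  assumes W: "full_simplex W"
begin

private lemma finW: "finite W" by (rule full_simplex_finite[OF W])
private lemma indep: "\<not> affine_dependent W" using W by (simp add: full_simplex_def)

lemma affine_hull_full_simplex: "affine hull W = UNIV"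
proof -
  have "aff_dim W = int (DIM(real^'n))"
    using aff_dim_affine_independent[OF indep] W by (simp add: full_simplex_def)
  then show ?thesis by (rule aff_dim_eq_full[THEN iffD1])
qed

lemma bary_vertex:
  assumes "v \<in> W" "u \<in> W"
  shows "bary W v u = (if u = v then 1 else 0)"
proof -
  have "\<not> affine_dependent (W - {v})" using indep affine_independent_Diff by blast
  then have "of_nat (card (W - {v})) = aff_dim (W - {v}) + 1" by (rule aff_dim_affine_independent)
  then have "aff_dim (W - {v}) = int (DIM(real^'n)) - 1"
    using W assms(1) finW by (simp add: full_simplex_def)
  then have "aff_dim (W - {v}) = DIM(real^'n) - 1" by (simp add: of_nat_diff Suc_leI)
  then obtain a b where ab: "a \<noteq> 0" "affine hull (W - {v}) = {x. a \<bullet> x = b}"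
    using aff_dim_eq_hyperplane by blast
  have "v \<notin> affine hull (W - {v})" using indep assms(1) by (auto simp: affine_dependent_def)
  then have s: "a \<bullet> v - b \<noteq> 0" using ab by auto
  let ?g = "(1 / (a \<bullet> v - b)) *\<^sub>R a" and ?c = "- b / (a \<bullet> v - b)"
  have "?g \<bullet> u + ?c = (if u = v then 1 else 0)" if "u \<in> W" for u
  proof (cases "u = v")
    case True then show ?thesis using s by (simp add: diff_divide_distrib[symmetric])
  next
    case False
    then have "u \<in> affine hull (W - {v})" using that by (simp add: hull_inc)
    then show ?thesis using ab False by simp
  qed
  then have "\<exists>p. (case p of (g, c) \<Rightarrow> \<forall>u\<in>W. g \<bullet> u + c = (if u = v then 1 else 0))"
    by (intro exI[of _ "(?g, ?c)"]) simp
  then have "case bary_coeffs W v of (g, c) \<Rightarrow> \<forall>u\<in>W. g \<bullet> u + c = (if u = v then 1 else 0)"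
    unfolding bary_coeffs_def by (rule someI_ex)
  then show ?thesis using assms(2) by (auto simp: bary_def bary_grad_def split: prod.splits)
qed

lemma bary_combination:
  assumes "sum c W = 1" "v \<in> W"
  shows "bary W v (\<Sum>u\<in>W. c u *\<^sub>R u) = c v"
proof -
  have "bary W v (\<Sum>u\<in>W. c u *\<^sub>R u) = (\<Sum>u\<in>W. c u * bary W v u)"
    unfolding bary_def by (rule affine_function_convex_combination[OF finW assms(1)])
  also have "\<dots> = (\<Sum>u\<in>W. if u = v then c u else 0)"
    by (intro sum.cong) (auto simp: bary_vertex assms)
  finally show ?thesis using finW assms by simp
qed

lemma bary_sum: "(\<Sum>v\<in>W. bary W v x) = 1" and bary_expand: "(\<Sum>v\<in>W. bary W v x *\<^sub>R v) = x"
proof -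
  have "x \<in> affine hull W" by (simp add: affine_hull_full_simplex)
  then obtain c where c: "sum c W = 1" "(\<Sum>v\<in>W. c v *\<^sub>R v) = x"
    unfolding affine_hull_finite[OF finW] by blast
  then have "bary W v x = c v" if "v \<in> W" for v using bary_combination[OF c(1) that] by simp
  then show "(\<Sum>v\<in>W. bary W v x) = 1" "(\<Sum>v\<in>W. bary W v x *\<^sub>R v) = x" using c by auto
qed

lemma convex_hull_bary: "convex hull W = {x. \<forall>v\<in>W. 0 \<le> bary W v x}"
proof (intro equalityI subsetI CollectI ballI)
  fix x v assume "x \<in> convex hull W" "v \<in> W"
  then show "0 \<le> bary W v x" using bary_combination by (auto simp: convex_hull_finite[OF finW])
next
  fix x assume "x \<in> {x. \<forall>v\<in>W. 0 \<le> bary W v x}"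
  then show "x \<in> convex hull W"
    using bary_sum bary_expand by (auto simp: convex_hull_finite[OF finW] intro!: exI[of _ "\<lambda>v. bary W v x"])
qed

lemma affine_via_bary: "g \<bullet> x + d = (\<Sum>v\<in>W. bary W v x * (g \<bullet> v + d))"
  using affine_function_convex_combination[OF finW bary_sum, of g x d] by (simp add: bary_expand)

lemma convex_hull_facet:
  assumes "v \<in> W"
  shows "convex hull (W - {v}) = {x \<in> convex hull W. bary W v x = 0}"
proof (intro equalityI subsetI)
  fix x assume x: "x \<in> convex hull (W - {v})"
  then obtain c where c: "\<forall>u\<in>W - {v}. 0 \<le> c u" "sum c (W - {v}) = 1" "(\<Sum>u\<in>W - {v}. c u *\<^sub>R u) = x"
    using finW by (auto simp: convex_hull_finite)
  define c' where "c' = c(v := 0)"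
  have "(\<Sum>u\<in>W. c' u *\<^sub>R u) = (\<Sum>u\<in>W - {v}. c' u *\<^sub>R u)" "sum c' W = sum c' (W - {v})"
    using sum.remove[OF finW assms, of "\<lambda>u. c' u *\<^sub>R u"] sum.remove[OF finW assms, of c'] by (auto simp: c'_def)
  then have "sum c' W = 1" "(\<Sum>u\<in>W. c' u *\<^sub>R u) = x" using c by (simp_all add: c'_def)
  then have "bary W v x = 0" using bary_combination[of c' v] assms by (auto simp: c'_def)
  moreover have "x \<in> convex hull W" using x hull_mono[of "W - {v}" W] by blast
  ultimately show "x \<in> {x \<in> convex hull W. bary W v x = 0}" by simp
next
  fix x assume "x \<in> {x \<in> convex hull W. bary W v x = 0}"
  then have x: "\<forall>u\<in>W. 0 \<le> bary W u x" "bary W v x = 0" using convex_hull_bary by auto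
  have "(\<Sum>u\<in>W - {v}. bary W u x) = 1" "(\<Sum>u\<in>W - {v}. bary W u x *\<^sub>R u) = x"
    using sum.remove[OF finW assms, of "\<lambda>u. bary W u x *\<^sub>R u"] sum.remove[OF finW assms, of "\<lambda>u. bary W u x"]
      bary_sum[of x] bary_expand[of x] x by auto
  then show "x \<in> convex hull (W - {v})" using x finW
    by (auto simp: convex_hull_finite intro!: exI[of _ "\<lambda>u. bary W u x"])
qed

lemma other_vertex: "\<exists>u\<in>W. u \<noteq> v"
proof (rule ccontr)
  assume "\<not> ?thesis"
  then have "card W \<le> card {v}" by (intro card_mono) auto
  then show False using W by (simp add: full_simplex_def)
qed

lemma bary_grad_nonzero: "v \<in> W \<Longrightarrow> bary_grad W v \<noteq> 0"
proof
  assume v: "v \<in> W" and "bary_grad W v = 0"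
  then have "bary W v u = bary W v v" for u by (simp add: bary_def)
  moreover obtain u where "u \<in> W" "u \<noteq> v" using other_vertex by blast
  ultimately show False using bary_vertex[OF v, of u] bary_vertex[OF v v] by simp
qed

lemma outer_normal_unit: "v \<in> W \<Longrightarrow> norm (outer_normal W v) = 1"
  using bary_grad_nonzero by (simp add: outer_normal_def norm_sgn)

lemma bary_halfspace:
  assumes "v \<in> W"
  shows "(outer_normal W v \<bullet> x \<le> snd (bary_coeffs W v) / norm (bary_grad W v)) \<longleftrightarrow> 0 \<le> bary W v x"
    and "(outer_normal W v \<bullet> x = snd (bary_coeffs W v) / norm (bary_grad W v)) \<longleftrightarrow> bary W v x = 0"
proof -
  have pos: "norm (bary_grad W v) > 0" using bary_grad_nonzero[OF assms] by simp
  have eq: "outer_normal W v \<bullet> x = (- (bary_grad W v \<bullet> x)) / norm (bary_grad W v)"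
    by (simp add: outer_normal_def sgn_div_norm divide_inverse)
  have "(outer_normal W v \<bullet> x \<le> snd (bary_coeffs W v) / norm (bary_grad W v))
      \<longleftrightarrow> - (bary_grad W v \<bullet> x) \<le> snd (bary_coeffs W v)"
    unfolding eq by (subst divide_le_cancel) (use pos in auto)
  then show "(outer_normal W v \<bullet> x \<le> snd (bary_coeffs W v) / norm (bary_grad W v)) \<longleftrightarrow> 0 \<le> bary W v x"
    by (auto simp: bary_def)
  have "(outer_normal W v \<bullet> x = snd (bary_coeffs W v) / norm (bary_grad W v))
      \<longleftrightarrow> - (bary_grad W v \<bullet> x) = snd (bary_coeffs W v)"
    unfolding eq by (subst divide_cancel_right) (use pos in auto)
  then show "(outer_normal W v \<bullet> x = snd (bary_coeffs W v) / norm (bary_grad W v)) \<longleftrightarrow> bary W v x = 0"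
    by (auto simp: bary_def)
qed

lemma compact_full_simplex: "compact (convex hull W)"
  using finW by (simp add: finite_imp_compact_convex_hull)

lemma interior_full_simplex: "{x. \<forall>v\<in>W. 0 < bary W v x} \<subseteq> interior (convex hull W)"
proof (rule interior_maximal)
  show "{x. \<forall>v\<in>W. 0 < bary W v x} \<subseteq> convex hull W" by (auto simp: convex_hull_bary less_imp_le)
  have "{x. \<forall>v\<in>W. 0 < bary W v x} = (\<Inter>v\<in>W. {x. 0 < bary W v x})" by auto
  moreover have "open {x. 0 < bary W v x}" for v
    unfolding bary_def by (intro open_Collect_less continuous_intros)
  ultimately show "open {x. \<forall>v\<in>W. 0 < bary W v x}" using finW by (auto intro!: open_INT)
qed

lemma centroid_in_interior: "barycenter (convex hull W) \<in> interior (convex hull W)"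
  and bary_centroid: "v \<in> W \<Longrightarrow> bary W v (barycenter (convex hull W)) = 1 / real (card W)"
proof -
  have pos: "real (card W) > 0" using W by (simp add: full_simplex_def)
  have "barycenter (convex hull W) = (\<Sum>v\<in>W. (1 / real (card W)) *\<^sub>R v)"
    by (simp add: barycenter_def vertices_convex_hull[OF indep] scaleR_sum_right)
  then have b: "bary W v (barycenter (convex hull W)) = 1 / real (card W)" if "v \<in> W" for v
    using bary_combination[OF _ that, of "\<lambda>_. 1 / real (card W)"] pos by simp
  then show "v \<in> W \<Longrightarrow> bary W v (barycenter (convex hull W)) = 1 / real (card W)" .
  show "barycenter (convex hull W) \<in> interior (convex hull W)"
    using interior_full_simplex b pos by auto
qed

lemma interior_nonempty: "interior (convex hull W) \<noteq> {}"
  using centroid_in_interior by auto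

text \<open>In the generic case the level set half-space is one more constraint of the polyhedron.
  Since that requires distinct planes, a level set lying in a facet plane is treated separately. The
  condition on negative values excludes a simplex that only touches the level set from
  outside.\<close>

lemma divergence_theorem_cut_simplex:
  assumes card: "CARD('n) \<in> {2, 3}" and w: "w \<in> vpolys k"
  shows "integral {x \<in> convex hull W. \<alpha> \<bullet> x + \<beta> < 0} (divergence w)
    = (\<Sum>v\<in>W. plane_integral (outer_normal W v) {x \<in> convex hull (W - {v}). \<alpha> \<bullet> x + \<beta> < 0} (\<lambda>x. outer_normal W v \<bullet> w x))
      + (if \<exists>x\<in>convex hull W. \<alpha> \<bullet> x + \<beta> < 0 then
          plane_integral (sgn \<alpha>) {x \<in> convex hull W. \<alpha> \<bullet> x + \<beta> = 0} (\<lambda>x. sgn \<alpha> \<bullet> w x) else 0)"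
proof -
  define K where "K = convex hull W"
  define n where "n = outer_normal W"
  define B where "B v = snd (bary_coeffs W v) / norm (bary_grad W v)" for v
  define lev where "lev x = \<alpha> \<bullet> x + \<beta>" for x
  have n: "norm (n v) = 1" "n v \<noteq> 0" if "v \<in> W" for v
    using outer_normal_unit[OF that] by (auto simp: n_def)
  have nB: "n v \<bullet> x \<le> B v \<longleftrightarrow> 0 \<le> bary W v x" "n v \<bullet> x = B v \<longleftrightarrow> bary W v x = 0" if "v \<in> W" for v x
    using bary_halfspace[OF that] by (simp_all add: n_def B_def)
  have K: "K = {x. \<forall>v\<in>W. n v \<bullet> x \<le> B v}" using convex_hull_bary nB by (auto simp: K_def)
  have facet: "convex hull (W - {v}) = K \<inter> {x. n v \<bullet> x = B v}" if "v \<in> W" for v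
    using convex_hull_facet[OF that] nB[OF that] by (auto simp: K_def)
  have bdK: "bounded K" using compact_full_simplex compact_imp_bounded by (simp add: K_def)
  have distinct: "{x. n u \<bullet> x = B u} \<noteq> {x. n v \<bullet> x = B v}" if "v \<in> W" "u \<in> W" "u \<noteq> v" for u v
    using nB(2)[OF that(1), of u] nB(2)[OF that(2), of u] that by (auto simp: bary_vertex set_eq_iff)
  have empty: "plane_integral \<nu> {} g = 0" for \<nu> :: "real^'n" and g by (simp add: plane_integral_def)
  have whole: "integral K (divergence w) = (\<Sum>v\<in>W. plane_integral (n v) (convex hull (W - {v})) (\<lambda>x. n v \<bullet> w x))"
    using divergence_theorem_polytope_unit[where I = W and a = n and b = B, OF finW n(1) card _ w] distinct bdK
    unfolding K[symmetric] by (simp add: facet)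
  define S where "S v = {x \<in> convex hull (W - {v}). lev x < 0}" for v
  have goal: "integral {x \<in> K. lev x < 0} (divergence w)
    = (\<Sum>v\<in>W. plane_integral (n v) (S v) (\<lambda>x. n v \<bullet> w x))
      + (if \<exists>x\<in>K. lev x < 0 then plane_integral (sgn \<alpha>) {x \<in> K. lev x = 0} (\<lambda>x. sgn \<alpha> \<bullet> w x) else 0)"
  proof (cases "\<exists>x\<in>K. lev x < 0")
    case False
    then have K0: "{x \<in> K. lev x < 0} = {}" by auto
    have "S v = {}" for v
      using False hull_mono[of "W - {v}" W convex] by (auto simp: S_def K_def)
    then show ?thesis unfolding K0 using False by (simp add: empty)
  next
    case neg: True
    show ?thesis
    proof (cases "\<alpha> = 0")
      case True
      then have K1: "{x \<in> K. lev x < 0} = K" and K0: "{x \<in> K. lev x = 0} = {}"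
        using neg by (auto simp: lev_def)
      have "S v = convex hull (W - {v})" for v using neg True by (auto simp: lev_def S_def)
      then show ?thesis unfolding K1 K0 using whole by (simp add: empty)
    next
      case \<alpha>: False
      have levnull: "negligible {x. lev x = 0}"
        using negligible_hyperplane[of \<alpha> "- \<beta>"] \<alpha> by (simp add: lev_def eq_neg_iff_add_eq_0)
      have levplane: "{x. lev x = 0} = {x. \<alpha> \<bullet> x = - \<beta>}" by (auto simp: lev_def)
      show ?thesis
      proof (cases "\<exists>v\<in>W. {x. n v \<bullet> x = B v} = {x. lev x = 0}")
        case True
        \<comment> \<open>The level set is the plane of the facet opposite \<open>v0\<close>. As
          negative values occur, the level set normal is the outward normal of this facet: its flux
          becomes the level set term, and the other facets lose only a null set.\<close>
        then obtain v0 where v0: "v0 \<in> W" "{x. n v0 \<bullet> x = B v0} = {x. lev x = 0}" by blast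
        have "lev u = 0" if "u \<in> W - {v0}" for u
          using v0(2) nB(2)[OF v0(1), of u] that bary_vertex[OF v0(1), of u] by (auto simp: set_eq_iff)
        then have lev: "lev x = bary W v0 x * lev v0" for x
          using affine_via_bary[of \<alpha> x \<beta>] sum.remove[OF finW v0(1), of "\<lambda>v. bary W v x * lev v"]
          by (simp add: lev_def[symmetric])
        have "lev v0 < 0"
        proof -
          obtain x where "x \<in> K" "lev x < 0" using neg by blast
          moreover have "0 \<le> bary W v0 x" using \<open>x \<in> K\<close> v0 by (auto simp: K_def convex_hull_bary)
          ultimately show ?thesis using lev[of x] by (simp add: mult_less_0_iff)
        qed
        have le0: "lev x \<le> 0" if "x \<in> K" for x
          using lev[of x] \<open>lev v0 < 0\<close> that v0(1) by (auto simp: K_def convex_hull_bary mult_nonneg_nonpos)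
        have "\<alpha> \<bullet> x = (lev v0 *\<^sub>R bary_grad W v0) \<bullet> x" for x
          using lev[of x] lev[of 0] by (simp add: lev_def bary_def algebra_simps)
        then have "\<alpha> = lev v0 *\<^sub>R bary_grad W v0" by (metis inner_commute vector_eq_ldot)
        then have "\<alpha> = (- lev v0) *\<^sub>R (- bary_grad W v0)" by simp
        then have sgn: "sgn \<alpha> = n v0" using \<open>lev v0 < 0\<close>
          by (simp only: sgn_scaleR n_def outer_normal_def) simp
        have F0: "{x \<in> K. lev x = 0} = convex hull (W - {v0})" using facet[OF v0(1)] v0(2) by auto
        have S0: "S v0 = {}" unfolding S_def F0[symmetric] by auto
        have "integral {x \<in> K. lev x < 0} (divergence w) = integral K (divergence w)"
          by (rule integral_subset_negligible) (use le0 in \<open>auto intro: negligible_subset[OF levnull] simp: less_le\<close>)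
        also have "\<dots> = (\<Sum>v\<in>W - {v0}. plane_integral (n v) (convex hull (W - {v})) (\<lambda>x. n v \<bullet> w x))
          + plane_integral (sgn \<alpha>) {x \<in> K. lev x = 0} (\<lambda>x. sgn \<alpha> \<bullet> w x)"
          unfolding whole sgn F0 using sum.remove[OF finW v0(1)] by (simp add: add.commute)
        also have "(\<Sum>v\<in>W - {v0}. plane_integral (n v) (convex hull (W - {v})) (\<lambda>x. n v \<bullet> w x))
          = (\<Sum>v\<in>W - {v0}. plane_integral (n v) (S v) (\<lambda>x. n v \<bullet> w x))"
        proof (rule sum.cong[OF refl])
          fix v assume v: "v \<in> W - {v0}"
          show "plane_integral (n v) (convex hull (W - {v})) (\<lambda>x. n v \<bullet> w x) = plane_integral (n v) (S v) (\<lambda>x. n v \<bullet> w x)"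
          proof (rule plane_integral_spike[of _ _ "B v" _ \<alpha> "- \<beta>"])
            show "{x. \<alpha> \<bullet> x = - \<beta>} \<noteq> {x. n v \<bullet> x = B v}" using distinct[of v0 v] v v0 levplane by auto
            show "convex hull (W - {v}) - S v \<subseteq> {x. \<alpha> \<bullet> x = - \<beta>}"
              using le0 facet[of v] v by (auto simp: S_def levplane[symmetric] less_le)
          qed (use n v facet[of v] \<alpha> in \<open>auto simp: S_def\<close>)
        qed
        also have "\<dots> = (\<Sum>v\<in>W. plane_integral (n v) (S v) (\<lambda>x. n v \<bullet> w x))"
          using sum.remove[OF finW v0(1), of "\<lambda>v. plane_integral (n v) (S v) (\<lambda>x. n v \<bullet> w x)"] by (simp add: S0 empty)
        finally show ?thesis using neg by simp
      next
        case False
        then have ndist: "{x. \<alpha> \<bullet> x = - \<beta>} \<noteq> {x. n v \<bullet> x = B v}" if "v \<in> W" for v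
          using that levplane by auto
        \<comment> \<open>\<open>None\<close> stands for the level set half-space,
          \<open>Some v\<close> for the facet opposite \<open>v\<close>.\<close>
        define I where "I = insert None (Some ` W)"
        define a where "a i = (case i of None \<Rightarrow> sgn \<alpha> | Some v \<Rightarrow> n v)" for i
        define c0 where "c0 = - \<beta> / norm \<alpha>"
        define b where "b i = (case i of None \<Rightarrow> c0 | Some v \<Rightarrow> B v)" for i
        have na: "norm \<alpha> > 0" using \<alpha> by simp
        have sg: "sgn \<alpha> \<bullet> x = \<alpha> \<bullet> x / norm \<alpha>" for x by (simp add: sgn_div_norm divide_inverse mult.commute)
        have none: "sgn \<alpha> \<bullet> x \<le> c0 \<longleftrightarrow> lev x \<le> 0" "sgn \<alpha> \<bullet> x = c0 \<longleftrightarrow> lev x = 0" for x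
        proof -
          have "\<alpha> \<bullet> x / norm \<alpha> \<le> - \<beta> / norm \<alpha> \<longleftrightarrow> \<alpha> \<bullet> x \<le> - \<beta>"
            by (subst divide_le_cancel) (use na in auto)
          then show "sgn \<alpha> \<bullet> x \<le> c0 \<longleftrightarrow> lev x \<le> 0" by (auto simp: sg lev_def c0_def)
          have "\<alpha> \<bullet> x / norm \<alpha> = - \<beta> / norm \<alpha> \<longleftrightarrow> \<alpha> \<bullet> x = - \<beta>"
            by (subst divide_cancel_right) (use na in auto)
          then show "sgn \<alpha> \<bullet> x = c0 \<longleftrightarrow> lev x = 0" by (auto simp: sg lev_def c0_def)
        qed
        have P: "{x. \<forall>i\<in>I. a i \<bullet> x \<le> b i} = {x \<in> K. lev x \<le> 0}"
          by (auto simp: I_def a_def b_def none K)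
        have sgplane: "{x. sgn \<alpha> \<bullet> x = c0} = {x. \<alpha> \<bullet> x = - \<beta>}" using none(2) levplane by simp
        have "integral {x \<in> K. lev x \<le> 0} (divergence w) =
           (\<Sum>i\<in>I. plane_integral (a i) ({x \<in> K. lev x \<le> 0} \<inter> {x. a i \<bullet> x = b i}) (\<lambda>x. a i \<bullet> w x))"
          unfolding P[symmetric]
        proof (rule divergence_theorem_polytope_unit[OF _ _ card _ w])
          show "finite I" using finW by (simp add: I_def)
          show "norm (a i) = 1" if "i \<in> I" for i using that n na by (auto simp: I_def a_def norm_sgn)
          show "bounded {x. \<forall>i\<in>I. a i \<bullet> x \<le> b i}" unfolding P using bdK by (rule bounded_subset) auto
          show "{x. a j \<bullet> x = b j} \<noteq> {x. a i \<bullet> x = b i}" if "i \<in> I" "j \<in> I" "j \<noteq> i" for i j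
          proof (cases i; cases j)
            fix v u assume "i = Some v" "j = Some u"
            then show ?thesis using distinct[of v u] that by (auto simp: I_def a_def b_def)
          qed (use that ndist in \<open>auto simp: I_def a_def b_def sgplane dest: sym\<close>)
        qed
        also have "\<dots> = plane_integral (sgn \<alpha>) ({x \<in> K. lev x \<le> 0} \<inter> {x. lev x = 0}) (\<lambda>x. sgn \<alpha> \<bullet> w x)
          + (\<Sum>v\<in>W. plane_integral (n v) ({x \<in> K. lev x \<le> 0} \<inter> {x. n v \<bullet> x = B v}) (\<lambda>x. n v \<bullet> w x))"
          unfolding I_def using finW by (subst sum.insert) (auto simp: sum.reindex a_def b_def none)
        also have "{x \<in> K. lev x \<le> 0} \<inter> {x. lev x = 0} = {x \<in> K. lev x = 0}" by auto
        also have "(\<Sum>v\<in>W. plane_integral (n v) ({x \<in> K. lev x \<le> 0} \<inter> {x. n v \<bullet> x = B v}) (\<lambda>x. n v \<bullet> w x))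
          = (\<Sum>v\<in>W. plane_integral (n v) (S v) (\<lambda>x. n v \<bullet> w x))"
        proof (rule sum.cong[OF refl])
          fix v assume v: "v \<in> W"
          show "plane_integral (n v) ({x \<in> K. lev x \<le> 0} \<inter> {x. n v \<bullet> x = B v}) (\<lambda>x. n v \<bullet> w x)
            = plane_integral (n v) (S v) (\<lambda>x. n v \<bullet> w x)"
            by (rule plane_integral_spike[of _ _ "B v" _ \<alpha> "- \<beta>"])
              (use n v facet[of v] \<alpha> ndist in \<open>auto simp: S_def levplane[symmetric] less_le\<close>)
        qed
        also have "integral {x \<in> K. lev x \<le> 0} (divergence w) = integral {x \<in> K. lev x < 0} (divergence w)"
          by (rule integral_subset_negligible[symmetric]) (auto intro: negligible_subset[OF levnull] simp: less_le)
        finally show ?thesis using neg by simp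
      qed
    qed
  qed
  then show ?thesis by (simp add: K_def S_def lev_def n_def)
qed

end

section \<open>The Alfeld split of a single simplex\<close>

lemma bary_insert_centroid:
  assumes W: "full_simplex V" and v: "v \<in> V"
  defines "b \<equiv> barycenter (convex hull V)"
  shows "full_simplex (insert b (V - {v}))" and "b \<notin> V"
proof -
  have finV: "finite V" by (rule full_simplex_finite[OF W])
  have indep: "\<not> affine_dependent V" and card: "card V = Suc CARD('a)" using W by (simp_all add: full_simplex_def)
  have bb: "bary V u b = 1 / real (card V)" if "u \<in> V" for u
    unfolding b_def by (rule bary_centroid[OF W that])
  show nb: "b \<notin> V"
  proof
    assume "b \<in> V"
    then have "bary V b b = 1" using bary_vertex[OF W] by simp
    then show False using bb[OF \<open>b \<in> V\<close>] card by simp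
  qed
  have "b \<notin> affine hull (V - {v})"
  proof
    assume "b \<in> affine hull (V - {v})"
    then obtain c where c: "sum c (V - {v}) = 1" "(\<Sum>u\<in>V - {v}. c u *\<^sub>R u) = b"
      using finV by (auto simp: affine_hull_finite)
    define c' where "c' = c(v := 0)"
    have "(\<Sum>u\<in>V. c' u *\<^sub>R u) = (\<Sum>u\<in>V - {v}. c' u *\<^sub>R u)" "sum c' V = sum c' (V - {v})"
      using sum.remove[OF finV v, of "\<lambda>u. c' u *\<^sub>R u"] sum.remove[OF finV v, of c'] by (auto simp: c'_def)
    then have "sum c' V = 1" "(\<Sum>u\<in>V. c' u *\<^sub>R u) = b" using c by (simp_all add: c'_def)
    then have "bary V v b = 0" using bary_combination[OF W, of c' v] v by (auto simp: c'_def)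
    then show False using bb[OF v] card by simp
  qed
  then have "\<not> affine_dependent (insert b (V - {v}))"
    using indep affine_independent_Diff affine_independent_insert by blast
  moreover have "card (insert b (V - {v})) = Suc CARD('a)" using nb finV v card by simp
  ultimately show "full_simplex (insert b (V - {v}))" by (simp add: full_simplex_def)
qed

lemma alfeld_split_convex_hull:
  assumes "full_simplex V"
  shows "alfeld_split (convex hull V)
    = (\<lambda>v. convex hull (insert (barycenter (convex hull V)) (V - {v}))) ` V"
  using assms by (simp add: alfeld_split_def vertices_convex_hull full_simplex_def)

text \<open>Both sides are affine, so vertices suffice: at the centroid all coordinates agree, at
  the other vertices that of \<open>v\<close> is 0. The subsimplex omitting \<open>v\<close> thus
  lies where the coordinate of \<open>v\<close> is minimal.\<close>

lemma alfeld_subsimplex_bary_le: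
  assumes V: "full_simplex V" and v: "v \<in> V" "u \<in> V"
    and x: "x \<in> convex hull (insert (barycenter (convex hull V)) (V - {v}))"
  shows "bary V v x \<le> bary V u x"
proof -
  define b where "b = barycenter (convex hull V)"
  have "bary V v y \<le> bary V u y" if "y \<in> insert b (V - {v})" for y
    using that bary_centroid[OF V] bary_vertex[OF V] v by (auto simp: b_def)
  then have "insert b (V - {v}) \<subseteq> {y. (bary_grad V v - bary_grad V u) \<bullet> y \<le> snd (bary_coeffs V u) - snd (bary_coeffs V v)}"
    by (auto simp: bary_def inner_simps algebra_simps)
  then have "convex hull (insert b (V - {v})) \<subseteq> {y. (bary_grad V v - bary_grad V u) \<bullet> y \<le> snd (bary_coeffs V u) - snd (bary_coeffs V v)}"
    by (rule hull_minimal) (rule convex_halfspace_le)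
  then show ?thesis using x by (auto simp: b_def bary_def inner_simps algebra_simps)
qed

lemma Union_alfeld_split:
  assumes V: "full_simplex V"
  shows "\<Union>(alfeld_split (convex hull V)) = convex hull V"
proof
  define b where "b = barycenter (convex hull V)"
  have bT: "b \<in> convex hull V" using centroid_in_interior[OF V] interior_subset by (auto simp: b_def)
  have "convex hull (insert b (V - {v})) \<subseteq> convex hull V" for v
    using bT by (intro hull_minimal) (auto simp: hull_inc)
  then show "\<Union>(alfeld_split (convex hull V)) \<subseteq> convex hull V"
    unfolding alfeld_split_convex_hull[OF V] b_def by auto
  show "convex hull V \<subseteq> \<Union>(alfeld_split (convex hull V))"
  proof
    fix x assume x: "x \<in> convex hull V"
    have finV: "finite V" by (rule full_simplex_finite[OF V])
    have ne: "V \<noteq> {}" using V by (auto simp: full_simplex_def)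
    obtain v where v: "v \<in> V" "\<And>u. u \<in> V \<Longrightarrow> bary V v x \<le> bary V u x"
    proof -
      have "finite ((\<lambda>u. bary V u x) ` V)" "(\<lambda>u. bary V u x) ` V \<noteq> {}" using finV ne by auto
      then have "Min ((\<lambda>u. bary V u x) ` V) \<in> (\<lambda>u. bary V u x) ` V" by (rule Min_in)
      then obtain v where "v \<in> V" "bary V v x = Min ((\<lambda>u. bary V u x) ` V)" by auto
      then show ?thesis using that finV by simp
    qed
    define m where "m = bary V v x"
    have m0: "m \<ge> 0" using x v(1) by (simp add: m_def convex_hull_bary[OF V])
    define d where "d = real (card V)"
    have d: "d > 0" using finV ne by (simp add: d_def card_gt_0_iff)
    have nb: "b \<notin> V" unfolding b_def by (rule bary_insert_centroid(2)[OF V v(1)])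
    have bsum: "b = (\<Sum>u\<in>V. (1 / d) *\<^sub>R u)"
      using bary_expand[OF V, of b] bary_centroid[OF V] by (simp add: b_def d_def)
    \<comment> \<open>Lowering every coordinate by the minimal one, \<open>m\<close>, leaves weight
      0 for \<open>v\<close>; the removed part is \<open>d * m\<close> times the centroid.\<close>
    define c where "c u = (if u = b then d * m else bary V u x - m)" for u
    have cu: "c u = bary V u x - m" if "u \<in> V - {v}" for u using nb that by (auto simp: c_def)
    have cb: "c b = d * m" by (simp add: c_def)
    have "sum c (insert b (V - {v})) = d * m + (\<Sum>u\<in>V - {v}. bary V u x - m)"
      using finV nb by (simp add: cb cu)
    also have "(\<Sum>u\<in>V - {v}. bary V u x - m) = (\<Sum>u\<in>V. bary V u x - m)"
      using sum.remove[OF finV v(1), of "\<lambda>u. bary V u x - m"] by (simp add: m_def)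
    also have "\<dots> = 1 - d * m" by (simp add: sum_subtractf bary_sum[OF V] d_def)
    finally have s1: "sum c (insert b (V - {v})) = 1" by simp
    have "(\<Sum>u\<in>insert b (V - {v}). c u *\<^sub>R u) = (d * m) *\<^sub>R b + (\<Sum>u\<in>V - {v}. (bary V u x - m) *\<^sub>R u)"
      using finV nb by (simp add: cb cu)
    also have "(\<Sum>u\<in>V - {v}. (bary V u x - m) *\<^sub>R u) = (\<Sum>u\<in>V. (bary V u x - m) *\<^sub>R u)"
      using sum.remove[OF finV v(1), of "\<lambda>u. (bary V u x - m) *\<^sub>R u"] by (simp add: m_def)
    also have "\<dots> = x - (\<Sum>u\<in>V. m *\<^sub>R u)" by (simp add: scaleR_diff_left sum_subtractf bary_expand[OF V])
    also have "(d * m) *\<^sub>R b = (\<Sum>u\<in>V. m *\<^sub>R u)"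
      unfolding bsum scaleR_sum_right using d by simp
    finally have s2: "(\<Sum>u\<in>insert b (V - {v}). c u *\<^sub>R u) = x" by simp
    have "0 \<le> c u" if "u \<in> insert b (V - {v})" for u
      using that v(2) m0 d nb by (auto simp: c_def m_def)
    then have "x \<in> convex hull (insert b (V - {v}))"
      using s1 s2 finV by (subst convex_hull_finite) auto
    then show "x \<in> \<Union>(alfeld_split (convex hull V))"
      unfolding alfeld_split_convex_hull[OF V] using v(1) by (auto simp: b_def)
  qed
qed

text \<open>On the intersection the coordinates of \<open>u\<close> and \<open>v\<close> are both
  minimal, hence equal, and this is the equation of a hyperplane.\<close>

lemma alfeld_split_disjoint_interiors:
  assumes V: "full_simplex V" and v: "v \<in> V" "u \<in> V" "u \<noteq> v"
  defines "b \<equiv> barycenter (convex hull V)"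
  shows "interior (convex hull (insert b (V - {v}))) \<inter> interior (convex hull (insert b (V - {u}))) = {}"
proof -
  have "convex hull (insert b (V - {v})) \<inter> convex hull (insert b (V - {u})) \<subseteq>
     {x. (bary_grad V v - bary_grad V u) \<bullet> x = snd (bary_coeffs V u) - snd (bary_coeffs V v)}"
  proof
    fix x assume "x \<in> convex hull (insert b (V - {v})) \<inter> convex hull (insert b (V - {u}))"
    then have "bary V v x = bary V u x"
      using alfeld_subsimplex_bary_le[OF V v(1,2), of x] alfeld_subsimplex_bary_le[OF V v(2,1), of x]
      by (simp add: b_def)
    then show "x \<in> {x. (bary_grad V v - bary_grad V u) \<bullet> x = snd (bary_coeffs V u) - snd (bary_coeffs V v)}"
      by (simp add: bary_def inner_simps)
  qed
  moreover have "bary_grad V v - bary_grad V u \<noteq> 0"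
  proof
    assume "bary_grad V v - bary_grad V u = 0"
    then have "bary V v x - bary V u x = snd (bary_coeffs V v) - snd (bary_coeffs V u)" for x
      by (simp add: bary_def)
    from this[of v] this[of u] show False using bary_vertex[OF V] v by simp
  qed
  then have "interior {x. (bary_grad V v - bary_grad V u) \<bullet> x = snd (bary_coeffs V u) - snd (bary_coeffs V v)} = {}"
    by (rule interior_hyperplane)
  ultimately show ?thesis by (metis interior_Int interior_mono subset_empty)
qed

text \<open>The coordinates of \<open>w\<close> and w' both vanish on the common facet, so they are
  proportional. With a positive factor, points slightly off the centroid of the facet would lie in
  both interiors.\<close>

lemma outer_normal_opposite:
  assumes W: "full_simplex W" "full_simplex W'" and w: "w \<in> W" "w' \<in> W'" and eq: "W - {w} = W' - {w'}"
    and disj: "interior (convex hull W) \<inter> interior (convex hull W') = {}"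
  shows "outer_normal W' w' = - outer_normal W w"
proof -
  define c where "c = bary W' w' w"
  have finW: "finite W" "finite W'" using W full_simplex_finite by auto
  have lin: "bary W' w' x = c * bary W w x" for x
  proof -
    have "bary W' w' x = (\<Sum>v\<in>W. bary W v x * bary W' w' v)"
      unfolding bary_def[of W' w'] by (rule affine_via_bary[OF W(1)])
    also have "\<dots> = bary W w x * c + (\<Sum>v\<in>W - {w}. bary W v x * bary W' w' v)"
      using finW(1) w(1) by (simp add: sum.remove c_def)
    also have "(\<Sum>v\<in>W - {w}. bary W v x * bary W' w' v) = 0"
      using bary_vertex[OF W(2) w(2)] eq by (intro sum.neutral) auto
    finally show ?thesis by simp
  qed
  have "bary_grad W' w' \<bullet> x = (c *\<^sub>R bary_grad W w) \<bullet> x" for x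
    using lin[of x] lin[of 0] by (simp add: bary_def algebra_simps)
  then have grad: "bary_grad W' w' = c *\<^sub>R bary_grad W w" by (metis inner_commute vector_eq_ldot)
  then have "c \<noteq> 0" using bary_grad_nonzero[OF W(2) w(2)] by auto
  moreover have "\<not> c > 0"
  proof
    assume "c > 0"
    define F where "F = W - {w}"
    have F: "finite F" "F \<noteq> {}" using finW other_vertex[OF W(1), of w] by (auto simp: F_def)
    define n where "n = real (card F)"
    have n: "n > 0" using F by (simp add: n_def card_gt_0_iff)
    define p where "p = (\<Sum>v\<in>F. (1 / n) *\<^sub>R v)"
    have baryp: "bary X v p = (if v \<in> F then 1 / n else 0)" if X: "full_simplex X" "F \<subseteq> X" "v \<in> X" for X v
    proof -
      define d where "d u = (if u \<in> F then 1 / n else 0)" for u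
      have fX: "finite X" by (rule full_simplex_finite[OF X(1)])
      have FX: "X \<inter> F = F" using X(2) by auto
      have "sum d X = 1" unfolding d_def using n F fX by (simp add: sum.If_cases FX n_def)
      moreover have "(\<Sum>u\<in>X. d u *\<^sub>R u) = p"
        unfolding d_def p_def using fX X(2) by (intro sum.mono_neutral_cong_right) auto
      ultimately show ?thesis using bary_combination[OF X(1), of d v] X(3) by (simp add: d_def)
    qed
    define q where "q s = p + s *\<^sub>R bary_grad W w" for s :: real
    have qp: "q \<midarrow>0\<rightarrow> p" unfolding q_def by (rule tendsto_eq_intros refl)+ simp
    have pos: "\<forall>\<^sub>F s in at_right 0. 0 < bary X v (q s)" if X: "full_simplex X" "F \<subseteq> X" "v \<in> F" for X v
    proof -
      have "((\<lambda>s. bary X v (q s)) \<longlongrightarrow> bary X v p) (at 0)"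
        unfolding bary_def by (intro tendsto_intros qp)
      moreover have "bary X v p > 0" using baryp[of X v] X n by auto
      ultimately have "\<forall>\<^sub>F s in at 0. 0 < bary X v (q s)" by (rule order_tendstoD)
      then show ?thesis by (simp add: eventually_at_split)
    qed
    have "\<forall>\<^sub>F s in at_right 0. \<forall>v\<in>F. 0 < bary W v (q s) \<and> 0 < bary W' v (q s)"
      using pos[OF W(1)] pos[OF W(2)] eq F(1)
      by (intro eventually_ball_finite) (auto intro!: eventually_conj simp: F_def)
    moreover have "\<forall>\<^sub>F s in at_right 0. (0::real) < s" by (simp add: eventually_at_right_less)
    ultimately have "\<forall>\<^sub>F s in at_right (0::real). False"
    proof eventually_elim
      case (elim s)
      have "bary W w (q s) = s * (norm (bary_grad W w))\<^sup>2"
        using baryp[OF W(1), of w] w(1)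
        by (simp add: q_def bary_def inner_simps power2_norm_eq_inner F_def)
      then have ww: "bary W w (q s) > 0" using elim(2) bary_grad_nonzero[OF W(1) w(1)] by simp
      then have "bary W' w' (q s) > 0" using lin \<open>c > 0\<close> by simp
      moreover have "v \<in> F" if "v \<in> W'" "v \<noteq> w'" for v using that eq by (auto simp: F_def)
      moreover have "v \<in> F" if "v \<in> W" "v \<noteq> w" for v using that by (auto simp: F_def)
      ultimately have "\<forall>v\<in>W. 0 < bary W v (q s)" "\<forall>v\<in>W'. 0 < bary W' v (q s)"
        using ww elim(1) by metis+
      then have "q s \<in> interior (convex hull W)" "q s \<in> interior (convex hull W')"
        using interior_full_simplex[OF W(1)] interior_full_simplex[OF W(2)] by blast+
      then show False using disj by blast
    qed
    then show False by simp
  qed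
  ultimately have "c < 0" by linarith
  have "- bary_grad W' w' = (- c) *\<^sub>R bary_grad W w" using grad by simp
  then have "outer_normal W' w' = sgn (bary_grad W w)"
    unfolding outer_normal_def using \<open>c < 0\<close> by (simp only: sgn_scaleR) simp
  then show ?thesis by (simp add: outer_normal_def sgn_minus)
qed

text \<open>In a class of \<open>n\<close> elements with the same key and sum \<open>s\<close>,
  pairwise opposition gives (n - 1) s = 0. So it need not be shown that at most two simplices share
  a facet; classes with one element are covered by \<open>single\<close>.\<close>

lemma sum_cancel_by_key:
  fixes f :: "'a \<Rightarrow> real"
  assumes "finite X"
    and opp: "\<And>x y. x \<in> X \<Longrightarrow> y \<in> X \<Longrightarrow> x \<noteq> y \<Longrightarrow> key x = key y \<Longrightarrow> f x = - f y"
    and single: "\<And>x. x \<in> X \<Longrightarrow> (\<And>y. y \<in> X \<Longrightarrow> key y = key x \<Longrightarrow> y = x) \<Longrightarrow> f x = 0"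
  shows "sum f X = 0"
proof -
  have "sum f {x \<in> X. key x = z} = 0" for z
  proof -
    define S where "S = {x \<in> X. key x = z}"
    define s where "s = sum f S"
    define n where "n = real (card S)"
    have fS: "finite S" using assms(1) by (simp add: S_def)
    have each: "s = f a - (n - 1) * f a" if "a \<in> S" for a
    proof -
      have "sum f (S - {a}) = (\<Sum>b\<in>S - {a}. - f a)"
        using that opp[of _ a] by (intro sum.cong) (auto simp: S_def)
      also have "\<dots> = - (real (card S - 1) * f a)" using that fS by simp
      also have "real (card S - 1) = n - 1"
        using that fS card_gt_0_iff[of S] by (auto simp: n_def of_nat_diff)
      finally show ?thesis using sum.remove[OF fS that, of f] by (simp add: s_def)
    qed
    have "n * s = (\<Sum>a\<in>S. s)" by (simp add: n_def)
    also have "\<dots> = (\<Sum>a\<in>S. f a - (n - 1) * f a)" using each by (intro sum.cong) auto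
    also have "\<dots> = s - (n - 1) * s" by (simp add: sum_subtractf sum_distrib_left s_def)
    finally have *: "(n - 1) * s = 0" by (simp add: algebra_simps)
    show ?thesis
    proof (cases "n = 1")
      case True
      then have "card S = 1" by (simp add: n_def)
      then obtain a where a: "S = {a}" using card_1_singletonE by blast
      have aX: "a \<in> X" "key a = z" using a by (auto simp: S_def)
      have "y = a" if "y \<in> X" "key y = key a" for y
      proof -
        have "y \<in> S" using that aX(2) by (simp add: S_def)
        then show ?thesis using a by simp
      qed
      then have "f a = 0" using single[OF aX(1)] by blast
      then show ?thesis using a by (simp add: S_def)
    next
      case False
      then show ?thesis using * by (simp add: s_def S_def)
    qed
  qed
  then show ?thesis using sum.image_gen[OF assms(1), of f key] by simp
qed

section \<open>The undeformed mesh\<close>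

lemma lset_h_affine:
  assumes "pl_interpolant (alf D) g (lset_h D)" "K \<in> alf D"
  obtains \<alpha> \<beta> where "\<And>x. x \<in> K \<Longrightarrow> lset_h D x = \<alpha> \<bullet> x + \<beta>"
  using assms by (auto simp: pl_interpolant_def)

text \<open>The simplex has interior points, so the affine representation is unique, as the definite
  description in \<open>flat_normal\<close> demands.\<close>

lemma flat_normal_eq:
  assumes W: "full_simplex W" and eq: "\<And>x. x \<in> convex hull W \<Longrightarrow> lset_h D x = \<alpha> \<bullet> x + \<beta>"
  shows "flat_normal D (convex hull W) = sgn \<alpha>"
proof -
  have "(THE a. \<exists>b. \<forall>x\<in>convex hull W. lset_h D x = a \<bullet> x + b) = \<alpha>"
  proof (rule the_equality)
    fix a assume "\<exists>b. \<forall>x\<in>convex hull W. lset_h D x = a \<bullet> x + b"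
    then obtain b where "\<forall>x\<in>convex hull W. lset_h D x = a \<bullet> x + b" by blast
    then have b: "a \<bullet> x + b = \<alpha> \<bullet> x + \<beta>" if "x \<in> convex hull W" for x
      using eq[OF that] that by metis
    show "a = \<alpha>"
    proof (rule ccontr)
      assume "a \<noteq> \<alpha>"
      then have "interior {x. (a - \<alpha>) \<bullet> x = \<beta> - b} = {}" by (intro interior_hyperplane) auto
      moreover have "convex hull W \<subseteq> {x. (a - \<alpha>) \<bullet> x = \<beta> - b}"
        using b by (auto simp: inner_simps algebra_simps)
      ultimately show False using interior_nonempty[OF W] interior_mono by blast
    qed
  qed (use eq in auto)
  then show ?thesis by (simp add: flat_normal_def)
qed

context
  fixes D :: "('n::finite) disc" and \<Omega>ext :: "(real^'n) set" and C :: real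
  assumes bg: "background_mesh C \<Omega>ext D"
    and op: "open (\<Omega> D)" and sub: "\<Omega> D \<subseteq> \<Omega>ext"
begin

lemma bg_mesh_simplex:
  assumes "T \<in> bg_mesh D"
  shows "full_simplex (vertices T)" and "T = convex hull (vertices T)"
proof -
  have "int CARD('n) simplex T" using bg assms by (simp add: background_mesh_def)
  then obtain V where V: "\<not> affine_dependent V" "int (card V) = int CARD('n) + 1" "T = convex hull V"
    by (auto simp: simplex_def)
  then have "vertices T = V" by (simp add: vertices_convex_hull)
  then show "full_simplex (vertices T)" "T = convex hull (vertices T)"
    using V by (auto simp: full_simplex_def)
qed

lemma finite_bg_mesh: "finite (bg_mesh D)"
  using bg by (simp add: background_mesh_def triangulation_def)

lemma macro_subset: "macro D \<subseteq> bg_mesh D" by (auto simp: macro_def)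

text \<open>\<open>T\<close> is the closure of its interior and \<open>\<Omega> D\<close> is open,
  so a single common point yields an open common part and thus positive measure.\<close>

lemma macro_if_meets:
  assumes T: "T \<in> bg_mesh D" and x: "x \<in> T" "x \<in> \<Omega> D"
  shows "T \<in> macro D"
proof -
  note V = bg_mesh_simplex[OF T]
  have cv: "convex T" by (subst V(2)) (rule convex_convex_hull)
  have ne: "interior T \<noteq> {}" by (subst V(2)) (rule interior_nonempty[OF V(1)])
  have comp: "compact T" by (subst V(2)) (rule compact_full_simplex[OF V(1)])
  have "x \<in> closure (interior T)"
    using convex_closure_interior[OF cv ne] x(1) closure_subset by auto
  then have "interior T \<inter> \<Omega> D \<noteq> {}" using op x(2) by (meson closure_iff_nhds_not_empty disjoint_iff open_Int_closure_eq_empty)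
  then have "\<not> negligible (interior T \<inter> \<Omega> D)" using op by (intro open_not_negligible) auto
  then have nn: "\<not> negligible (T \<inter> \<Omega> D)" using interior_subset negligible_subset by (metis Int_mono order_refl)
  have "T \<inter> \<Omega> D \<in> lmeasurable"
    using comp op by (intro fmeasurable_Int_fmeasurable lmeasurable_compact) (auto intro: borel_open)
  then have "measure lebesgue (T \<inter> \<Omega> D) \<noteq> 0" using nn by (simp add: negligible_iff_measure)
  then have "measure lebesgue (T \<inter> \<Omega> D) > 0" using measure_nonneg[of lebesgue "T \<inter> \<Omega> D"] by linarith
  then show ?thesis using T by (simp add: macro_def)
qed

lemma \<Omega>_covered: "x \<in> \<Omega> D \<Longrightarrow> \<exists>T\<in>macro D. x \<in> T"
proof -
  assume x: "x \<in> \<Omega> D"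
  then have "x \<in> \<Union>(bg_mesh D)" using sub bg closure_subset by (auto simp: background_mesh_def)
  then show ?thesis using macro_if_meets x by auto
qed

lemma alf_simplex:
  assumes "K \<in> alf D"
  shows "full_simplex (vertices K)" and "K = convex hull (vertices K)"
    and "\<exists>T\<in>macro D. \<exists>v\<in>vertices T. vertices K = insert (barycenter T) (vertices T - {v})"
proof -
  obtain T where T: "T \<in> macro D" "K \<in> alfeld_split T" using assms by (auto simp: alf_def)
  note V = bg_mesh_simplex[OF subsetD[OF macro_subset T(1)]]
  obtain v where v: "v \<in> vertices T" "K = convex hull (insert (barycenter T) (vertices T - {v}))"
    using T(2) by (auto simp: alfeld_split_def)
  have fs: "full_simplex (insert (barycenter T) (vertices T - {v}))"
    using bary_insert_centroid(1)[OF V(1) v(1)] V(2) by simp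
  then have vK: "vertices K = insert (barycenter T) (vertices T - {v})"
    unfolding v(2) by (simp add: vertices_convex_hull full_simplex_def)
  show "full_simplex (vertices K)" using vK fs by simp
  show "K = convex hull (vertices K)" using vK v(2) by simp
  show "\<exists>T\<in>macro D. \<exists>v\<in>vertices T. vertices K = insert (barycenter T) (vertices T - {v})"
    using T(1) v(1) vK by blast
qed

lemma alf_member:
  assumes "T \<in> macro D" "v \<in> vertices T"
  defines "K \<equiv> convex hull (insert (barycenter T) (vertices T - {v}))"
  shows "K \<in> alf D" and "vertices K = insert (barycenter T) (vertices T - {v})"
proof -
  note V = bg_mesh_simplex[OF subsetD[OF macro_subset assms(1)]]
  have fs: "full_simplex (insert (barycenter T) (vertices T - {v}))"
    using bary_insert_centroid(1)[OF V(1) assms(2)] V(2) by simp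
  show "K \<in> alf D" using assms(1,2) by (auto simp: alf_def alfeld_split_def K_def)
  show "vertices K = insert (barycenter T) (vertices T - {v})"
    unfolding K_def using fs by (simp add: vertices_convex_hull full_simplex_def)
qed

lemma finite_alf: "finite (alf D)"
proof -
  have "finite (alfeld_split T)" if "T \<in> macro D" for T
    using full_simplex_finite[OF bg_mesh_simplex(1)[OF subsetD[OF macro_subset that]]]
    by (simp add: alfeld_split_def)
  moreover have "finite (macro D)" using finite_bg_mesh macro_subset finite_subset by blast
  ultimately show ?thesis by (auto simp: alf_def)
qed

lemma compact_alf: "K \<in> alf D \<Longrightarrow> compact K"
  using alf_simplex(1,2) compact_full_simplex by metis

lemma alf_subset_macro: "K \<in> alf D \<Longrightarrow> \<exists>T\<in>macro D. K \<subseteq> T"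
proof -
  assume "K \<in> alf D"
  then obtain T where T: "T \<in> macro D" "K \<in> alfeld_split T" by (auto simp: alf_def)
  note V = bg_mesh_simplex[OF subsetD[OF macro_subset T(1)]]
  have "K \<subseteq> T" using Union_alfeld_split[OF V(1)] T(2) V(2) by auto
  then show ?thesis using T by blast
qed

lemma Union_alf: "\<Union>(alf D) = \<Union>(macro D)"
proof -
  have "\<Union>(alfeld_split T) = T" if "T \<in> macro D" for T
    using Union_alfeld_split[OF bg_mesh_simplex(1)] bg_mesh_simplex(2) subsetD[OF macro_subset that] by metis
  then show ?thesis unfolding alf_def by blast
qed

lemma bg_disjoint_interiors:
  assumes "T \<in> bg_mesh D" "T' \<in> bg_mesh D" "T \<noteq> T'"
  shows "interior T \<inter> interior T' = {}"
proof (rule ccontr)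
  assume ne: "interior T \<inter> interior T' \<noteq> {}"
  have tr: "triangulation (bg_mesh D)" using bg by (simp add: background_mesh_def)
  then have f: "T \<inter> T' face_of T" "T' \<inter> T face_of T'" using assms by (auto simp: triangulation_def)
  have "T \<inter> T' = T" using face_of_disjoint_interior[OF f(1)] ne interior_subset by blast
  moreover have "T' \<inter> T = T'" using face_of_disjoint_interior[OF f(2)] ne interior_subset by blast
  ultimately show False using assms(3) by auto
qed

lemma alf_disjoint_interiors:
  assumes "K \<in> alf D" "K' \<in> alf D" "K \<noteq> K'"
  shows "interior K \<inter> interior K' = {}"
proof -
  obtain T v where T: "T \<in> macro D" "v \<in> vertices T" "vertices K = insert (barycenter T) (vertices T - {v})"
    using alf_simplex(3)[OF assms(1)] by blast
  obtain T' v' where T': "T' \<in> macro D" "v' \<in> vertices T'" "vertices K' = insert (barycenter T') (vertices T' - {v'})"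
    using alf_simplex(3)[OF assms(2)] by blast
  have K: "K = convex hull (insert (barycenter T) (vertices T - {v}))" using alf_simplex(2)[OF assms(1)] T(3) by simp
  have K': "K' = convex hull (insert (barycenter T') (vertices T' - {v'}))" using alf_simplex(2)[OF assms(2)] T'(3) by simp
  note V = bg_mesh_simplex[OF subsetD[OF macro_subset T(1)]]
  note V' = bg_mesh_simplex[OF subsetD[OF macro_subset T'(1)]]
  show ?thesis
  proof (cases "T = T'")
    case True
    then have "v' \<noteq> v" using K K' assms(3) by auto
    then show ?thesis
      using alfeld_split_disjoint_interiors[OF V(1) T(2), of v'] T'(2) True V(2) K K' by simp
  next
    case False
    have "K \<subseteq> T" using Union_alfeld_split[OF V(1)] alfeld_split_convex_hull[OF V(1)] V(2) T(2) K by auto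
    moreover have "K' \<subseteq> T'" using Union_alfeld_split[OF V'(1)] alfeld_split_convex_hull[OF V'(1)] V'(2) T'(2) K' by auto
    ultimately show ?thesis
      using bg_disjoint_interiors[OF subsetD[OF macro_subset T(1)] subsetD[OF macro_subset T'(1)] False]
        interior_mono by blast
  qed
qed

text \<open>A facet of the split mesh on which the discrete level set function is negative somewhere
  contains a point of \<open>\<Omega>\<close> in its relative interior, hence has an active neighbour.\<close>

lemma lonely_facet_nonneg:
  assumes pl: "pl_interpolant (alf D) (lset D) (lset_h D)"
    and K: "K \<in> alf D" and w: "w \<in> vertices K"
    and lonely: "\<And>K' w'. K' \<in> alf D \<Longrightarrow> w' \<in> vertices K' \<Longrightarrow> vertices K' - {w'} = vertices K - {w}
      \<Longrightarrow> K' = K \<and> w' = w"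
    and x: "x \<in> convex hull (vertices K - {w})"
  shows "0 \<le> lset_h D x"
proof (rule ccontr)
  assume neg: "\<not> 0 \<le> lset_h D x"
  obtain T v where T: "T \<in> macro D" "v \<in> vertices T" "vertices K = insert (barycenter T) (vertices T - {v})"
    using alf_simplex(3)[OF K] by blast
  have Tbg: "T \<in> bg_mesh D" using T(1) macro_subset by blast
  define V where "V = vertices T"
  define b where "b = barycenter T"
  have V: "full_simplex V" and TV: "T = convex hull V" using bg_mesh_simplex[OF Tbg] by (simp_all add: V_def)
  have finV: "finite V" by (rule full_simplex_finite[OF V])
  have vK: "vertices K = insert b (V - {v})" and vV: "v \<in> V" using T by (simp_all add: V_def b_def)
  have bV: "b \<notin> V" using bary_insert_centroid(2)[OF V vV] by (simp add: b_def TV[symmetric])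
  \<comment> \<open>A facet of \<open>K\<close> containing the barycenter also belongs to the
    subsimplex of \<open>T\<close> that omits \<open>w\<close>. So a lonely facet must be the one
    opposite the barycenter, that is, a facet of \<open>T\<close>.\<close>
  have "w = b"
  proof (rule ccontr)
    assume wb: "w \<noteq> b"
    then have wV: "w \<in> V" "w \<noteq> v" using w vK by auto
    note K' = alf_member[OF T(1), of w, folded V_def b_def, OF wV(1)]
    have eq: "vertices (convex hull insert b (V - {w})) - {v} = vertices K - {w}"
      unfolding K'(2) vK using wV bV vV by auto
    have "v \<in> vertices (convex hull insert b (V - {w}))" using K'(2) vV wV by auto
    then have "v = w" using lonely[OF K'(1) _ eq] by blast
    then show False using wV by simp
  qed
  define F where "F = V - {v}"
  have F: "vertices K - {w} = F" using vK \<open>w = b\<close> bV by (auto simp: F_def)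
  have finF: "finite F" and neF: "F \<noteq> {}" using finV other_vertex[OF V, of v] by (auto simp: F_def)
  have FT: "convex hull F \<subseteq> T" unfolding TV F_def by (intro hull_mono) auto
  obtain \<alpha> \<beta> where ab: "\<And>x. x \<in> K \<Longrightarrow> lset_h D x = \<alpha> \<bullet> x + \<beta>" using lset_h_affine[OF pl K] by blast
  have FK: "convex hull F \<subseteq> K"
    by (subst alf_simplex(2)[OF K]) (use F in \<open>auto intro!: hull_mono\<close>)
  \<comment> \<open>An affine function negative somewhere on the facet is negative at one of its
    vertices, and there the interpolant equals \<open>lset D\<close>; so this vertex lies in
    \<open>\<Omega> D\<close>.\<close>
  obtain z where z: "z \<in> F" "lset_h D z < 0"
  proof -
    have "\<exists>z\<in>F. \<alpha> \<bullet> z + \<beta> < 0"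
    proof (rule ccontr)
      assume "\<not> ?thesis"
      then have "F \<subseteq> {x. - \<beta> \<le> \<alpha> \<bullet> x}" by force
      then have "convex hull F \<subseteq> {x. - \<beta> \<le> \<alpha> \<bullet> x}"
        by (rule hull_minimal) (use convex_halfspace_ge[of "- \<beta>" \<alpha>] in simp)
      then have "0 \<le> \<alpha> \<bullet> x + \<beta>" using x F by auto
      then show False using neg ab x F FK by auto
    qed
    then obtain z where z: "z \<in> F" "\<alpha> \<bullet> z + \<beta> < 0" by blast
    then have "z \<in> K" using subsetD[OF FK hull_inc] by metis
    then show ?thesis using that z ab by auto
  qed
  have "z \<in> vertices K" using z(1) F by auto
  then have "lset_h D z = lset D z" using pl K by (auto simp: pl_interpolant_def)
  then have z\<Omega>: "z \<in> \<Omega> D" using z(2) by (simp add: \<Omega>_def)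
  define n where "n = real (card F)"
  have n: "n > 0" using finF neF by (simp add: n_def card_gt_0_iff)
  define c where "c = (\<Sum>u\<in>F. (1 / n) *\<^sub>R u)"
  \<comment> \<open>A small move from \<open>z\<close> towards the centroid of the facet stays in
    the open set \<open>\<Omega> D\<close> and enters the relative interior of the facet.\<close>
  define p where "p s = z + s *\<^sub>R (c - z)" for s :: real
  have "p \<midarrow>0\<rightarrow> z" unfolding p_def by (rule tendsto_eq_intros refl)+ simp
  then have "\<forall>\<^sub>F s in at 0. p s \<in> \<Omega> D" using op z\<Omega> by (rule topological_tendstoD)
  then have "\<forall>\<^sub>F s in at_right 0. p s \<in> \<Omega> D" by (simp add: eventually_at_split)
  moreover have "\<forall>\<^sub>F s in at_right (0::real). s \<in> {0<..<1}" by (rule eventually_at_right_real) simp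
  ultimately have "\<forall>\<^sub>F s in at_right (0::real). p s \<in> \<Omega> D \<and> s \<in> {0<..<1}" by (rule eventually_conj)
  then obtain s where s: "p s \<in> \<Omega> D" "0 < s" "s < 1"
    using eventually_happens[of _ "at_right (0::real)"] by auto
  define q where "q = p s"
  define cf where "cf u = (1 - s) * (if u = z then 1 else 0) + s / n" for u
  have "sum cf F = 1" using finF z(1) neF n by (simp add: cf_def sum.distrib sum_distrib_left[symmetric] n_def)
  moreover have "(\<Sum>u\<in>F. cf u *\<^sub>R u) = q"
  proof -
    have "(\<Sum>u\<in>F. cf u *\<^sub>R u) = (\<Sum>u\<in>F. (if u = z then (1 - s) *\<^sub>R z else 0) + s *\<^sub>R ((1 / n) *\<^sub>R u))"
      by (intro sum.cong) (auto simp: cf_def algebra_simps)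
    also have "\<dots> = (1 - s) *\<^sub>R z + s *\<^sub>R c"
      using finF z(1) by (simp add: sum.distrib c_def scaleR_sum_right)
    finally show ?thesis by (simp add: q_def p_def algebra_simps)
  qed
  moreover have "\<forall>u\<in>F. 0 < cf u" using s n by (auto simp: cf_def add_pos_nonneg)
  moreover have "\<not> affine_dependent F"
    unfolding F_def using V affine_independent_Diff by (auto simp: full_simplex_def)
  ultimately have qrel: "q \<in> rel_interior (convex hull F)"
    by (subst rel_interior_convex_hull_explicit) auto
  have qF: "q \<in> convex hull F" using qrel rel_interior_subset by blast
  then have "bary V v q = 0" using convex_hull_facet[OF V vV] by (simp add: F_def)
  then have "bary V v (q - t *\<^sub>R bary_grad V v) = - (t * (bary_grad V v \<bullet> bary_grad V v))" for t
    by (simp add: bary_def inner_simps)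
  moreover have "bary_grad V v \<bullet> bary_grad V v > 0" using bary_grad_nonzero[OF V vV] by simp
  ultimately have "bary V v (q - t *\<^sub>R bary_grad V v) < 0" if "t > 0" for t using that by simp
  then have out: "q - t *\<^sub>R bary_grad V v \<notin> T" if "t > 0" for t
    using that vV unfolding TV convex_hull_bary[OF V] by (force simp: not_le)
  \<comment> \<open>Points just beyond the facet lie in \<open>\<Omega> D\<close> but not in
    \<open>T\<close>, so other background simplices cover them; their union is closed and therefore
    contains \<open>q\<close>.\<close>
  define Y where "Y = \<Union>(bg_mesh D - {T})"
  have "compact T'" if "T' \<in> bg_mesh D" for T'
    using compact_full_simplex[OF bg_mesh_simplex(1)[OF that]] bg_mesh_simplex(2)[OF that] by simp
  then have "closed Y" unfolding Y_def using finite_bg_mesh by (intro closed_Union) (auto intro: compact_imp_closed)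
  have "((\<lambda>t. q - t *\<^sub>R bary_grad V v) \<longlongrightarrow> q) (at_right 0)"
    by (rule tendsto_eq_intros refl)+ simp
  moreover have "\<forall>\<^sub>F t in at_right 0. q - t *\<^sub>R bary_grad V v \<in> Y"
  proof -
    have "\<forall>\<^sub>F t in at_right 0. q - t *\<^sub>R bary_grad V v \<in> \<Omega> D"
      using calculation op s(1) unfolding q_def[symmetric] by (rule topological_tendstoD)
    moreover have "\<forall>\<^sub>F t in at_right (0::real). 0 < t" by (simp add: eventually_at_right_less)
    ultimately show ?thesis
    proof eventually_elim
      case (elim t)
      then show ?case using \<Omega>_covered out macro_subset by (fastforce simp: Y_def)
    qed
  qed
  ultimately have "q \<in> Y" using \<open>closed Y\<close> by (intro Lim_in_closed_set[of Y _ "at_right 0"]) auto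
  then obtain T' where T': "T' \<in> bg_mesh D" "T' \<noteq> T" "q \<in> T'" by (auto simp: Y_def)
  have T'm: "T' \<in> macro D" using macro_if_meets[OF T'(1,3)] s(1) by (simp add: q_def)
  define V' where "V' = vertices T'"
  have V': "full_simplex V'" and TV': "T' = convex hull V'" using bg_mesh_simplex[OF T'(1)] by (simp_all add: V'_def)
  have tr: "triangulation (bg_mesh D)" using bg by (simp add: background_mesh_def)
  then have f: "T \<inter> T' face_of T" "T' \<inter> T face_of T'" using Tbg T' by (auto simp: triangulation_def)
  have qT: "q \<in> T" using qF FT by blast
  \<comment> \<open>The common face contains a point of the relative interior of the facet, hence
    the whole facet.\<close>
  have FT': "convex hull F \<subseteq> T \<inter> T'"
    by (rule subset_of_face_of[OF f(1) FT]) (use qrel qT T'(3) in auto)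
  have "F \<subseteq> V'"
  proof
    fix u assume u: "u \<in> F"
    then have uT: "u extreme_point_of T" by (simp add: F_def V_def vertices_def)
    moreover have "u \<in> T \<inter> T'" using subsetD[OF FT' hull_inc[OF u]] .
    ultimately have "u extreme_point_of (T \<inter> T')" using extreme_point_of_face[OF f(1)] by blast
    then have "u extreme_point_of T'" using extreme_point_of_face[OF f(2)] by (metis Int_commute)
    then show "u \<in> V'" by (simp add: V'_def vertices_def)
  qed
  moreover have "card V' = Suc (card F)" using V V' vV finV by (simp add: full_simplex_def F_def)
  moreover have finV': "finite V'" by (rule full_simplex_finite[OF V'])
  ultimately obtain v' where v': "v' \<in> V'" "F = V' - {v'}"
  proof -
    have "card (V' - F) = 1" using \<open>F \<subseteq> V'\<close> \<open>card V' = Suc (card F)\<close> finF by (simp add: card_Diff_subset)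
    then obtain v' where "V' - F = {v'}" using card_1_singletonE by blast
    then show ?thesis using that[of v'] \<open>F \<subseteq> V'\<close> by blast
  qed
  define b' where "b' = barycenter T'"
  have b'V: "b' \<notin> V'" using bary_insert_centroid(2)[OF V' v'(1)] by (simp add: b'_def TV'[symmetric])
  note K' = alf_member[OF T'm, of v', folded V'_def b'_def, OF v'(1)]
  have "vertices (convex hull insert b' (V' - {v'})) - {b'} = vertices K - {w}"
    unfolding K'(2) F v'(2) using b'V by auto
  moreover have "b' \<in> vertices (convex hull insert b' (V' - {v'}))" using K'(2) by auto
  \<comment> \<open>The subsimplex of T' over the same facet would have to be \<open>K\<close>
    itself, so the two barycenters would coincide although they lie in disjoint interiors.\<close>
  ultimately have "b' = w" using lonely[OF K'(1)] by blast
  then have "b' = b" using \<open>w = b\<close> by simp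
  moreover have "b \<in> interior T" "b' \<in> interior T'"
    using centroid_in_interior[OF V] centroid_in_interior[OF V'] TV TV' by (simp_all add: b_def b'_def)
  ultimately show False using bg_disjoint_interiors[OF Tbg T'(1)] T'(2) by auto
qed

text \<open>The cut-simplex theorem is summed over the mesh, with facets identified by their vertex
  sets. Paired facets have opposite normals and equal normal components and cancel; unpaired ones
  carry no flux by \<open>lonely_facet_nonneg\<close>.\<close>

theorem flat_divergence_theorem:
  assumes card: "CARD('n) \<in> {2, 3}" and pl: "pl_interpolant (alf D) (lset D) (lset_h D)"
    and w: "\<And>K. K \<in> alf D \<Longrightarrow> w K \<in> vpolys k"
    and conforming: "\<And>K K' v v' x. K \<in> alf D \<Longrightarrow> K' \<in> alf D \<Longrightarrow> K \<noteq> K' \<Longrightarrow> v \<in> vertices K \<Longrightarrow> v' \<in> vertices K' \<Longrightarrow>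
       vertices K - {v} = vertices K' - {v'} \<Longrightarrow> x \<in> convex hull (vertices K - {v}) \<Longrightarrow>
       outer_normal (vertices K) v \<bullet> w K x = outer_normal (vertices K) v \<bullet> w K' x"
  shows "(\<Sum>K\<in>alf D. integral {x \<in> K. lset_h D x < 0} (divergence (w K)))
    = (\<Sum>K | K \<in> alf D \<and> (\<exists>x\<in>K. lset_h D x < 0).
        plane_integral (flat_normal D K) {x \<in> K. lset_h D x = 0} (\<lambda>x. flat_normal D K \<bullet> w K x))"
proof -
  define flux where "flux K v = plane_integral (outer_normal (vertices K) v)
    {x \<in> convex hull (vertices K - {v}). lset_h D x < 0} (\<lambda>x. outer_normal (vertices K) v \<bullet> w K x)" for K v
  have cell: "integral {x \<in> K. lset_h D x < 0} (divergence (w K)) = (\<Sum>v\<in>vertices K. flux K v)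
    + (if \<exists>x\<in>K. lset_h D x < 0 then
        plane_integral (flat_normal D K) {x \<in> K. lset_h D x = 0} (\<lambda>x. flat_normal D K \<bullet> w K x) else 0)"
    if K: "K \<in> alf D" for K
  proof -
    define W where "W = vertices K"
    have W: "full_simplex W" and KW: "K = convex hull W" using alf_simplex[OF K] by (simp_all add: W_def)
    obtain \<alpha> \<beta> where ab: "\<And>x. x \<in> K \<Longrightarrow> lset_h D x = \<alpha> \<bullet> x + \<beta>" using lset_h_affine[OF pl K] by blast
    have fn: "flat_normal D K = sgn \<alpha>" using flat_normal_eq[OF W, of D \<alpha> \<beta>] ab KW by simp
    have sub: "convex hull (W - {v}) \<subseteq> K" for v unfolding KW by (intro hull_mono) auto
    have "{x \<in> K. lset_h D x < 0} = {x \<in> K. \<alpha> \<bullet> x + \<beta> < 0}" "{x \<in> K. lset_h D x = 0} = {x \<in> K. \<alpha> \<bullet> x + \<beta> = 0}"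
      "(\<exists>x\<in>K. lset_h D x < 0) = (\<exists>x\<in>K. \<alpha> \<bullet> x + \<beta> < 0)" using ab by auto
    moreover have "{x \<in> convex hull (W - {v}). lset_h D x < 0} = {x \<in> convex hull (W - {v}). \<alpha> \<bullet> x + \<beta> < 0}" for v
      using ab subsetD[OF sub[of v]] by auto
    ultimately show ?thesis
      using divergence_theorem_cut_simplex[OF W card w[OF K], of \<alpha> \<beta>]
      by (simp add: flux_def fn flip: KW W_def)
  qed
  have "(\<Sum>K\<in>alf D. \<Sum>v\<in>vertices K. flux K v) = (\<Sum>(K, v)\<in>Sigma (alf D) vertices. flux K v)"
    using finite_alf alf_simplex(1) full_simplex_finite by (intro sum.Sigma) auto
  also have "\<dots> = 0"
  proof (rule sum_cancel_by_key[where key = "\<lambda>(K, v). vertices K - {v}"])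
    show "finite (Sigma (alf D) vertices)" using finite_alf alf_simplex(1) full_simplex_finite by auto
  next
    fix y z assume yz: "y \<in> Sigma (alf D) vertices" "z \<in> Sigma (alf D) vertices" "y \<noteq> z"
      "(case y of (K, v) \<Rightarrow> vertices K - {v}) = (case z of (K, v) \<Rightarrow> vertices K - {v})"
    obtain K v K' v' where y: "y = (K, v)" and z: "z = (K', v')" by (cases y, cases z) auto
    have K: "K \<in> alf D" "K' \<in> alf D" "v \<in> vertices K" "v' \<in> vertices K'"
      and eq: "vertices K - {v} = vertices K' - {v'}" using yz y z by auto
    have ne: "K \<noteq> K'"
    proof
      assume "K = K'"
      then have "v = v'" using eq K by blast
      then show False using yz(3) y z \<open>K = K'\<close> by simp
    qed
    define n where "n = outer_normal (vertices K) v"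
    note W = alf_simplex(1)[OF K(1)] and W' = alf_simplex(1)[OF K(2)]
    have opp: "outer_normal (vertices K') v' = - n"
      unfolding n_def using alf_disjoint_interiors[OF K(1,2) ne] alf_simplex(2)[OF K(1)] alf_simplex(2)[OF K(2)]
      by (intro outer_normal_opposite[OF W W' K(3,4) eq]) simp
    define S where "S = {x \<in> convex hull (vertices K - {v}). lset_h D x < 0}"
    have n1: "norm n = 1" unfolding n_def by (rule outer_normal_unit[OF W K(3)])
    obtain B where B: "S \<subseteq> {x. n \<bullet> x = B}"
      using convex_hull_facet[OF W K(3)] bary_halfspace(2)[OF W K(3)] by (auto simp: S_def n_def)
    have bd: "bounded S"
      by (rule bounded_subset[of "convex hull (vertices K)"])
        (use compact_imp_bounded[OF compact_full_simplex[OF W]] hull_mono[of "vertices K - {v}" "vertices K" convex] in \<open>auto simp: S_def\<close>)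
    have "flux K' v' = plane_integral (- n) S (\<lambda>x. - n \<bullet> w K' x)"
      by (simp add: flux_def opp S_def eq)
    also have "\<dots> = plane_integral n S (\<lambda>x. - n \<bullet> w K' x)" by (rule plane_integral_uminus[OF n1 B bd])
    also have "\<dots> = - plane_integral n S (\<lambda>x. n \<bullet> w K' x)"
      using plane_integral_minus[OF n1 B, of "\<lambda>x. n \<bullet> w K' x"] by simp
    also have "plane_integral n S (\<lambda>x. n \<bullet> w K' x) = plane_integral n S (\<lambda>x. n \<bullet> w K x)"
      by (rule plane_integral_cong[OF _ n1 B])
        (use conforming[OF K(1,2) ne K(3,4) eq] in \<open>auto simp: S_def n_def\<close>)
    also have "\<dots> = flux K v" by (simp add: flux_def S_def n_def)
    finally show "(case y of (K, v) \<Rightarrow> flux K v) = - (case z of (K, v) \<Rightarrow> flux K v)" by (simp add: y z)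
  next
    fix y assume y: "y \<in> Sigma (alf D) vertices"
      and l: "\<And>z. z \<in> Sigma (alf D) vertices \<Longrightarrow>
        (case z of (K, v) \<Rightarrow> vertices K - {v}) = (case y of (K, v) \<Rightarrow> vertices K - {v}) \<Longrightarrow> z = y"
    obtain K v where yK: "y = (K, v)" by (cases y)
    have K: "K \<in> alf D" "v \<in> vertices K" using y yK by auto
    have "0 \<le> lset_h D x" if "x \<in> convex hull (vertices K - {v})" for x
    proof (rule lonely_facet_nonneg[OF pl K _ that])
      fix K' w' assume "K' \<in> alf D" "w' \<in> vertices K'" "vertices K' - {w'} = vertices K - {v}"
      then show "K' = K \<and> w' = v" using l[of "(K', w')"] yK by auto
    qed
    then have e: "{x \<in> convex hull (vertices K - {v}). lset_h D x < 0} = {}" by force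
    show "(case y of (K, v) \<Rightarrow> flux K v) = 0" unfolding yK split_conv flux_def e by (simp add: plane_integral_def)
  qed
  finally have "(\<Sum>K\<in>alf D. \<Sum>v\<in>vertices K. flux K v) = 0" .
  moreover have "(\<Sum>K\<in>alf D. integral {x \<in> K. lset_h D x < 0} (divergence (w K)))
    = (\<Sum>K\<in>alf D. \<Sum>v\<in>vertices K. flux K v) + (\<Sum>K\<in>alf D. if \<exists>x\<in>K. lset_h D x < 0 then
        plane_integral (flat_normal D K) {x \<in> K. lset_h D x = 0} (\<lambda>x. flat_normal D K \<bullet> w K x) else 0)"
    unfolding sum.distrib[symmetric] by (rule sum.cong[OF refl cell])
  ultimately show ?thesis unfolding sum.inter_filter[OF finite_alf, symmetric] by simp
qed

end

section \<open>The deformed mesh\<close>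

text \<open>Only continuity of the determinant at the identity enters, so \<delta> depends on \<eta>
  and the dimension alone and can be fixed before any mesh.\<close>

lemma det_close_to_1:
  assumes "0 < \<eta>"
  obtains \<delta> where "0 < \<delta>"
    "\<And>A :: real^'n^'n. onorm (\<lambda>y. A *v y - y) \<le> \<delta> \<Longrightarrow> \<bar>det A - 1\<bar> \<le> \<eta>"
proof -
  have "isCont det (mat 1 :: real^'n^'n)"
    using has_derivative_continuous[OF has_derivative_det_mat_1] .
  then obtain d where d: "d > 0" "\<And>A :: real^'n^'n. dist A (mat 1) < d \<Longrightarrow> dist (det A) 1 < \<eta>"
    using assms unfolding continuous_at_eps_delta by (metis det_I)
  \<comment> \<open>The number of matrix entries: each is bounded by the operator norm, so with the
    bound d / (2 N) they add up to at most d / 2.\<close>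
  define N where "N = real CARD('n) * real CARD('n)"
  have N: "N > 0" by (simp add: N_def)
  show ?thesis
  proof (rule that)
    show "0 < d / (2 * N)" using d N by simp
    fix A :: "real^'n^'n" assume A: "onorm (\<lambda>y. A *v y - y) \<le> d / (2 * N)"
    define B where "B = A - mat 1"
    have B: "(\<lambda>y. A *v y - y) = (\<lambda>y. B *v y)" by (simp add: B_def matrix_vector_mult_diff_rdistrib)
    have "\<bar>B $ i $ j\<bar> \<le> d / (2 * N)" for i j
    proof -
      have "\<bar>B $ i $ j\<bar> = \<bar>(B *v axis j 1) $ i\<bar>" by (simp add: matrix_vector_mult_basis column_def)
      also have "\<dots> \<le> norm (B *v axis j 1)" by (rule component_le_norm_cart)
      also have "\<dots> \<le> onorm (\<lambda>y. B *v y) * norm (axis j (1::real))"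
        by (rule onorm[OF matrix_vector_mul_bounded_linear])
      finally show ?thesis using A B by simp
    qed
    then have "(\<Sum>i\<in>UNIV. \<Sum>j\<in>UNIV. \<bar>B $ i $ j\<bar>) \<le> (\<Sum>i\<in>(UNIV :: 'n set). \<Sum>j\<in>(UNIV :: 'n set). d / (2 * N))"
      by (intro sum_mono)
    also have "\<dots> = d / 2" using N by (simp add: N_def)
    finally have "(\<Sum>i\<in>UNIV. \<Sum>j\<in>UNIV. \<bar>B $ i $ j\<bar>) \<le> d / 2" .
    moreover have "norm B \<le> (\<Sum>i\<in>UNIV. norm (B $ i))" by (simp add: norm_vec_def L2_set_le_sum)
    moreover have "(\<Sum>i\<in>UNIV. norm (B $ i)) \<le> (\<Sum>i\<in>UNIV. \<Sum>j\<in>UNIV. \<bar>B $ i $ j\<bar>)"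
      by (intro sum_mono norm_le_l1_cart)
    ultimately have "norm B < d" using d by linarith
    then have "dist (det A) 1 < \<eta>" using d by (simp add: B_def dist_norm)
    then show "\<bar>det A - 1\<bar> \<le> \<eta>" by (simp add: dist_real_def)
  qed
qed

lemma matrix_inv_mult:
  fixes A :: "real^'n^'n"
  assumes "det A \<noteq> 0"
  shows "A ** matrix_inv A = mat 1" "matrix_inv A ** A = mat 1"
proof -
  have "\<exists>B. A ** B = mat 1 \<and> B ** A = mat 1" using assms by (metis invertible_def invertible_det_nz)
  then have "A ** matrix_inv A = mat 1 \<and> matrix_inv A ** A = mat 1"
    unfolding matrix_inv_def by (rule someI_ex)
  then show "A ** matrix_inv A = mat 1" "matrix_inv A ** A = mat 1" by auto
qed

text \<open>By Cramer's rule each entry of the inverse is a quotient of determinants.\<close>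

lemma continuous_on_matrix_inv:
  fixes F :: "'a::topological_space \<Rightarrow> real^'n^'n"
  assumes F: "continuous_on S F" and nz: "\<And>x. x \<in> S \<Longrightarrow> det (F x) \<noteq> 0"
  shows "continuous_on S (\<lambda>x. matrix_inv (F x))"
proof -
  have "matrix_inv (F x) $ k $ j = det (\<chi> i l. if l = k then axis j 1 $ i else F x $ i $ l) / det (F x)"
    if "x \<in> S" for x k j
  proof -
    have e: "F x *v (matrix_inv (F x) *v axis j 1) = axis j 1"
      using matrix_inv_mult[OF nz[OF that]] by (simp add: matrix_vector_mul_assoc)
    have "det (\<chi> i l. if l = k then axis j 1 $ i else F x $ i $ l) = (matrix_inv (F x) *v axis j 1) $ k * det (F x)"
      by (rule cramer_lemma[of k "F x" "matrix_inv (F x) *v axis j 1", unfolded e])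
    then show ?thesis using nz[OF that] by (simp add: matrix_vector_mult_basis column_def)
  qed
  moreover have "continuous_on S (\<lambda>x. det (\<chi> i l. if l = k then axis j 1 $ i else F x $ i $ l) / det (F x))" for k j
  proof (intro continuous_on_divide continuous_on_det continuous_on_vec_lambda F)
    fix i l
    show "continuous_on S (\<lambda>x. if l = k then axis j 1 $ i else F x $ i $ l)"
      by (cases "l = k") (auto intro!: continuous_intros F)
  qed (use nz in auto)
  ultimately have "continuous_on S (\<lambda>x. matrix_inv (F x) $ k $ j)" for k j
    by (subst continuous_on_cong[OF refl]) auto
  then have "continuous_on S (\<lambda>x. \<chi> k j. matrix_inv (F x) $ k $ j)"
    by (intro continuous_on_vec_lambda)
  then show ?thesis by simp
qed

text \<open>\<Phi> is a homeomorphism of the compact set \<open>K\<close> onto its image, and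
  invariance of domain in both directions matches the interiors. Every point of the image is a limit
  point of the image of the interior, so \<open>Lim\<close> has a unique value, whatever
  \<open>f\<close> does on the boundary.\<close>

lemma inner_trace_image:
  fixes \<Phi> :: "real^'n \<Rightarrow> real^'n" and G :: "real^'n \<Rightarrow> 'b::t2_space"
  assumes K: "compact K" "K \<subseteq> closure (interior K)" and \<Phi>: "continuous_on K \<Phi>" "inj_on \<Phi> K"
    and G: "continuous_on K G" and fG: "\<And>z. z \<in> interior K \<Longrightarrow> f (\<Phi> z) = G z" and x: "x \<in> K"
  shows "interior (\<Phi> ` K) = \<Phi> ` interior K" and "inner_trace (\<Phi> ` K) f (\<Phi> x) = G x"
proof -
  define \<psi> where "\<psi> = inv_into K \<Phi>"
  have \<psi>: "\<psi> (\<Phi> z) = z" if "z \<in> K" for z using \<Phi>(2) that by (simp add: \<psi>_def)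
  have c\<psi>: "continuous_on (\<Phi> ` K) \<psi>" by (rule continuous_on_inv[OF \<Phi>(1) K(1)]) (simp add: \<psi>)
  have op: "open (\<Phi> ` interior K)"
    using \<Phi> interior_subset by (intro invariance_of_domain) (auto intro: continuous_on_subset inj_on_subset)
  have inj\<psi>: "inj_on \<psi> (\<Phi> ` K)" by (auto simp: inj_on_def \<psi>)
  have "open (\<psi> ` interior (\<Phi> ` K))"
    using c\<psi> inj\<psi> interior_subset by (intro invariance_of_domain) (auto intro: continuous_on_subset inj_on_subset)
  moreover have "\<psi> ` interior (\<Phi> ` K) \<subseteq> K" using interior_subset[of "\<Phi> ` K"] \<psi> by auto
  ultimately have sub: "\<psi> ` interior (\<Phi> ` K) \<subseteq> interior K" by (intro interior_maximal)
  show int: "interior (\<Phi> ` K) = \<Phi> ` interior K"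
  proof
    show "interior (\<Phi> ` K) \<subseteq> \<Phi> ` interior K"
    proof
      fix y assume y: "y \<in> interior (\<Phi> ` K)"
      then obtain z where z: "z \<in> K" "y = \<Phi> z" using interior_subset by blast
      then have "z = \<psi> y" using \<psi> by simp
      then show "y \<in> \<Phi> ` interior K" using sub y z by blast
    qed
    show "\<Phi> ` interior K \<subseteq> interior (\<Phi> ` K)"
      using op interior_subset by (intro interior_maximal) auto
  qed
  have "continuous_on (\<Phi> ` K) (\<lambda>y. G (\<psi> y))"
    by (rule continuous_on_compose2[OF G c\<psi>]) (auto simp: \<psi>)
  then have "((\<lambda>y. G (\<psi> y)) \<longlongrightarrow> G (\<psi> (\<Phi> x))) (at (\<Phi> x) within \<Phi> ` K)"
    using x by (simp add: continuous_on_def)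
  then have "((\<lambda>y. G (\<psi> y)) \<longlongrightarrow> G x) (at (\<Phi> x) within \<Phi> ` K)"
    unfolding \<psi>[OF x] .
  then have "((\<lambda>y. G (\<psi> y)) \<longlongrightarrow> G x) (at (\<Phi> x) within \<Phi> ` interior K)"
    by (rule tendsto_within_subset) (rule image_mono[OF interior_subset])
  then have lim: "(f \<longlongrightarrow> G x) (at (\<Phi> x) within \<Phi> ` interior K)"
  proof (rule Lim_transform_eventually)
    show "\<forall>\<^sub>F y in at (\<Phi> x) within \<Phi> ` interior K. G (\<psi> y) = f y"
      unfolding eventually_at_topological
      using fG \<psi>[OF subsetD[OF interior_subset]] by (intro exI[of _ UNIV]) auto
  qed
  have "\<Phi> x \<in> closure (\<Phi> ` interior K)"
  proof -
    have "closure (interior K) \<subseteq> K" using K(1) by (simp add: closure_minimal compact_imp_closed interior_subset)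
    then have "\<Phi> ` closure (interior K) \<subseteq> closure (\<Phi> ` interior K)"
      using continuous_on_subset[OF \<Phi>(1)] closure_subset[of "\<Phi> ` interior K"]
      by (intro image_closure_subset) simp_all
    then show ?thesis using x K(2) by auto
  qed
  then have "\<Phi> x islimpt \<Phi> ` interior K"
    unfolding closure_def using op interior_limit_point[of "\<Phi> x" "\<Phi> ` interior K"]
    by (auto simp: interior_open)
  then have "\<not> trivial_limit (at (\<Phi> x) within \<Phi> ` interior K)" by (simp add: trivial_limit_within)
  then show "inner_trace (\<Phi> ` K) f (\<Phi> x) = G x"
    unfolding inner_trace_def int using lim by (rule tendsto_Lim)
qed

section \<open>Lagrange nodes and polynomials on a facet\<close>

lemma facet_node:
  assumes W: "full_simplex W" and v: "v \<in> W" and k: "0 < k" and \<alpha>: "sum \<alpha> (W - {v}) = k"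
  shows "(\<Sum>u\<in>W - {v}. (real (\<alpha> u) / real k) *\<^sub>R u) \<in> lagrange_nodes k (convex hull W)"
proof -
  have finW: "finite W" by (rule full_simplex_finite[OF W])
  have vW: "vertices (convex hull W) = W" using W by (simp add: vertices_convex_hull full_simplex_def)
  define \<beta> where "\<beta> = \<alpha>(v := 0)"
  have "(\<Sum>u\<in>W. (real (\<beta> u) / real k) *\<^sub>R u) = (\<Sum>u\<in>W - {v}. (real (\<beta> u) / real k) *\<^sub>R u)"
    "sum \<beta> W = sum \<beta> (W - {v})"
    using sum.remove[OF finW v, of "\<lambda>u. (real (\<beta> u) / real k) *\<^sub>R u"] sum.remove[OF finW v, of \<beta>]
    by (auto simp: \<beta>_def)
  then have "(\<Sum>u\<in>W. (real (\<beta> u) / real k) *\<^sub>R u) = (\<Sum>u\<in>W - {v}. (real (\<alpha> u) / real k) *\<^sub>R u)" "sum \<beta> W = k"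
    using \<alpha> by (simp_all add: \<beta>_def)
  then show ?thesis unfolding lagrange_nodes_def vW by (metis (mono_tags, lifting) mem_Collect_eq)
qed

lemma facet_node_in_facet:
  assumes W: "full_simplex W" and k: "0 < k" and \<alpha>: "sum \<alpha> (W - {v}) = k"
  shows "(\<Sum>u\<in>W - {v}. (real (\<alpha> u) / real k) *\<^sub>R u) \<in> convex hull (W - {v})"
proof -
  have "(\<Sum>u\<in>W - {v}. real (\<alpha> u) / real k) = 1"
    using k \<alpha> by (simp add: sum_divide_distrib[symmetric] flip: of_nat_sum)
  then show ?thesis using full_simplex_finite[OF W]
    by (subst convex_hull_finite) (auto intro!: exI[of _ "\<lambda>u. real (\<alpha> u) / real k"])
qed

text \<open>Unisolvence of the facet nodes. With one vertex \<open>u0\<close> as origin and steps (u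
  - u0) / k, they form the lattice of \<open>pdeg_zero_on_lattice\<close>; the conclusion then holds
  on the whole plane of the facet.\<close>

lemma pdeg_zero_on_facet_plane:
  assumes W: "full_simplex W" and v: "v \<in> W" and k: "0 < k" and p: "pdeg k p"
    and zero: "\<And>\<alpha>. sum \<alpha> (W - {v}) = k \<Longrightarrow> p (\<Sum>u\<in>W - {v}. (real (\<alpha> u) / real k) *\<^sub>R u) = 0"
    and x: "bary W v x = 0"
  shows "p x = 0"
proof -
  have finW: "finite W" by (rule full_simplex_finite[OF W])
  define F where "F = W - {v}"
  have finF: "finite F" using finW by (simp add: F_def)
  obtain u0 where u0: "u0 \<in> F" using other_vertex[OF W, of v] by (auto simp: F_def)
  define J where "J = F - {u0}"
  define t where "t u = (1 / real k) *\<^sub>R (u - u0)" for u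
  have rep: "u0 + (\<Sum>u\<in>J. (real k * c u) *\<^sub>R t u) = (\<Sum>u\<in>F. c u *\<^sub>R u)" if "sum c F = 1" for c
  proof -
    have "(\<Sum>u\<in>J. (real k * c u) *\<^sub>R t u) = (\<Sum>u\<in>J. c u *\<^sub>R u - c u *\<^sub>R u0)"
      using k by (intro sum.cong) (auto simp: t_def scaleR_diff_right)
    also have "\<dots> = (\<Sum>u\<in>F. c u *\<^sub>R u - c u *\<^sub>R u0)"
      using sum.remove[OF finF u0, of "\<lambda>u. c u *\<^sub>R u - c u *\<^sub>R u0"] by (simp add: J_def)
    also have "\<dots> = (\<Sum>u\<in>F. c u *\<^sub>R u) - u0" by (simp add: sum_subtractf that flip: scaleR_left.sum)
    finally show ?thesis by simp
  qed
  have "p (u0 + (\<Sum>j\<in>J. (real k * bary W j x) *\<^sub>R t j)) = 0"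
  proof (rule pdeg_zero_on_lattice[OF p])
    show "finite J" using finF by (simp add: J_def)
    fix m :: "real^'a \<Rightarrow> nat" assume m: "sum m J \<le> k"
    \<comment> \<open>The weight missing to \<open>k\<close> is given to the origin
      \<open>u0\<close>.\<close>
    define \<alpha> where "\<alpha> = m(u0 := k - sum m J)"
    have sJ: "sum \<alpha> J = sum m J" by (intro sum.cong) (auto simp: J_def \<alpha>_def)
    have s: "sum \<alpha> F = k" using sum.remove[OF finF u0, of \<alpha>] m sJ by (simp add: J_def[symmetric]) (simp add: \<alpha>_def)
    have "(\<Sum>j\<in>J. real (m j) *\<^sub>R t j) = (\<Sum>j\<in>J. (real k * (real (\<alpha> j) / real k)) *\<^sub>R t j)"
      using k by (intro sum.cong) (auto simp: J_def \<alpha>_def)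
    moreover have "(\<Sum>u\<in>F. real (\<alpha> u) / real k) = 1"
      using k s by (simp add: sum_divide_distrib[symmetric] flip: of_nat_sum)
    ultimately have "u0 + (\<Sum>j\<in>J. real (m j) *\<^sub>R t j) = (\<Sum>u\<in>F. (real (\<alpha> u) / real k) *\<^sub>R u)"
      using rep[of "\<lambda>u. real (\<alpha> u) / real k"] by simp
    then show "p (u0 + (\<Sum>j\<in>J. real (m j) *\<^sub>R t j)) = 0" using zero[of \<alpha>] s by (simp add: F_def)
  qed
  moreover have "sum (\<lambda>u. bary W u x) F = 1" "(\<Sum>u\<in>F. bary W u x *\<^sub>R u) = x"
    using sum.remove[OF finW v, of "\<lambda>u. bary W u x *\<^sub>R u"] sum.remove[OF finW v, of "\<lambda>u. bary W u x"]
      bary_sum[OF W, of x] bary_expand[OF W, of x] x by (auto simp: F_def)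
  ultimately show ?thesis using rep[of "\<lambda>u. bary W u x"] by simp
qed

text \<open>The difference vanishes on the whole plane of the facet, so its derivative in every
  tangential direction is zero, also at nodes on the relative boundary of the facet.\<close>

lemma vpolys_diff_facet:
  fixes P P' :: "real^'n \<Rightarrow> real^'n"
  assumes W: "full_simplex W" and v: "v \<in> W" and k: "0 < k" and P: "P \<in> vpolys k" "P' \<in> vpolys k"
    and eq: "\<And>x. x \<in> convex hull (W - {v}) \<Longrightarrow> P x = P' x"
    and x: "x \<in> convex hull (W - {v})" and t: "bary_grad W v \<bullet> t = 0"
  shows "jacobian P (at x) *v t = jacobian P' (at x) *v t"
proof -
  define R where "R x = P x - P' x" for x
  have R0: "R y = 0" if "bary W v y = 0" for y
  proof -
    have "R y $ i = 0" for i
    proof (rule pdeg_zero_on_facet_plane[OF W v k _ _ that])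
      show "pdeg k (\<lambda>y. R y $ i)" using P pdeg_minus[of k "\<lambda>y. P y $ i" "\<lambda>y. P' y $ i"]
        by (simp add: R_def vpolys_def polys_iff_pdeg)
    qed (use eq[OF facet_node_in_facet[OF W k]] in \<open>auto simp: R_def\<close>)
    then show ?thesis by (simp add: vec_eq_iff)
  qed
  have "bary W v x = 0" using x convex_hull_facet[OF W v] by simp
  then have "bary W v (x + s *\<^sub>R t) = 0" for s using t by (simp add: bary_def inner_simps)
  then have "R (x + s *\<^sub>R t) = 0" for s using R0 by simp
  then have "((\<lambda>s. R (x + s *\<^sub>R t)) has_derivative (\<lambda>s. 0)) (at 0)" by simp
  moreover have "((\<lambda>s. R (x + s *\<^sub>R t)) has_derivative
      (\<lambda>s. jacobian P (at x) *v (s *\<^sub>R t) - jacobian P' (at x) *v (s *\<^sub>R t))) (at 0)"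
  proof -
    have d: "((\<lambda>s. x + s *\<^sub>R t) has_derivative (\<lambda>s. s *\<^sub>R t)) (at 0)" by (auto intro!: derivative_eq_intros)
    have "(R has_derivative (\<lambda>h. jacobian P (at x) *v h - jacobian P' (at x) *v h)) (at (x + 0 *\<^sub>R t))"
      unfolding R_def using vpolys_has_derivative(1)[OF P(1)] vpolys_has_derivative(1)[OF P(2)]
      by (intro has_derivative_diff) auto
    from has_derivative_compose[OF d this] show ?thesis by simp
  qed
  ultimately have "(\<lambda>s. 0) = (\<lambda>s. jacobian P (at x) *v (s *\<^sub>R t) - jacobian P' (at x) *v (s *\<^sub>R t))"
    by (rule has_derivative_unique)
  from fun_cong[OF this, of 1] show ?thesis by simp
qed

text \<open>An affine map from the reference simplex onto the given one exists, so the choice in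
  \<open>ref_map\<close> is meaningful; it is invertible because its image has interior
  points.\<close>

lemma ref_map_affine:
  fixes W :: "(real^'n) set"
  assumes W: "full_simplex W"
  shows "\<exists>(A :: real^'n^'n) b. ref_map (convex hull W) = (\<lambda>x. A *v x + b) \<and> det A \<noteq> 0 \<and>
    (\<lambda>x. A *v x + b) ` interior ref_simplex = interior (convex hull W)"
proof -
  have finW: "finite W" by (rule full_simplex_finite[OF W])
  obtain w0 where w0: "w0 \<in> W" using other_vertex[OF W] by blast
  have "card (W - {w0}) = card (UNIV :: 'n set)" using W finW w0 by (simp add: full_simplex_def)
  then obtain f :: "'n \<Rightarrow> real^'n" where f: "bij_betw f UNIV (W - {w0})"
    using finite_same_card_bij[of "UNIV :: 'n set" "W - {w0}"] finW by auto
  define A0 :: "real^'n^'n" where "A0 = (\<chi> i j. (f j - w0) $ i)"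
  have A0: "A0 *v axis j 1 = f j - w0" for j by (simp add: A0_def matrix_vector_mult_basis column_def vec_eq_iff)
  have B: "(Basis :: (real^'n) set) = range (\<lambda>j. axis j 1)" by (auto simp: Basis_vec_def)
  have "(\<lambda>x. w0 + x) ` ((*v) A0 ` insert 0 Basis) = insert w0 (range f)"
    unfolding B by (simp add: image_image A0)
  also have "\<dots> = W" using f w0 by (auto simp: bij_betw_def)
  finally have img: "(\<lambda>x. w0 + x) ` ((*v) A0 ` insert 0 Basis) = W" .
  have "(\<lambda>x. A0 *v x + w0) ` ref_simplex = (\<lambda>x. w0 + x) ` ((*v) A0 ` ref_simplex)"
    by (simp add: image_image add.commute)
  also have "\<dots> = convex hull W"
    unfolding ref_simplex_def convex_hull_linear_image[OF matrix_vector_mul_linear]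
      convex_hull_translation[symmetric] img ..
  finally have "(\<exists>A b. (\<lambda>x. A0 *v x + w0) = (\<lambda>x. A *v x + b)) \<and> (\<lambda>x. A0 *v x + w0) ` ref_simplex = convex hull W"
    by blast
  then have "\<exists>a :: real^'n \<Rightarrow> real^'n. (\<exists>A b. a = (\<lambda>x. A *v x + b)) \<and> a ` ref_simplex = convex hull W"
    by (rule exI[of "\<lambda>a :: real^'n \<Rightarrow> real^'n. (\<exists>A b. a = (\<lambda>x. A *v x + b)) \<and> a ` ref_simplex = convex hull W"])
  then have "(\<exists>A b. ref_map (convex hull W) = (\<lambda>x. A *v x + b)) \<and> ref_map (convex hull W) ` ref_simplex = convex hull W"
    unfolding ref_map_def by (rule someI_ex)
  then obtain A b where Ab: "ref_map (convex hull W) = (\<lambda>x. A *v x + b)"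
    "(\<lambda>x. A *v x + b) ` ref_simplex = convex hull W" by (elim exE conjE) simp
  have "det A \<noteq> 0"
  proof
    assume "det A = 0"
    then have "\<not> inj ((*v) A)" using det_nz_iff_inj[OF matrix_vector_mul_linear[of A]] by simp
    then have "negligible ((*v) A ` ref_simplex)"
      by (intro negligible_linear_singular_image matrix_vector_mul_linear)
    then have "negligible ((\<lambda>x. b + x) ` ((*v) A ` ref_simplex))" by (rule negligible_translation)
    then have "negligible (convex hull W)" using Ab(2) by (simp add: image_image add.commute)
    then have "negligible (interior (convex hull W))" using interior_subset negligible_subset by blast
    then show False using interior_nonempty[OF W] open_not_negligible by blast
  qed
  then have inj: "inj ((*v) A)" using det_nz_iff_inj[OF matrix_vector_mul_linear[of A]] by simp
  have "(\<lambda>x. A *v x + b) ` interior ref_simplex = (\<lambda>x. b + x) ` ((*v) A ` interior ref_simplex)"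
    by (simp add: image_image add.commute)
  also have "\<dots> = (\<lambda>x. b + x) ` interior ((*v) A ` ref_simplex)"
    by (simp add: interior_injective_linear_image[OF matrix_vector_mul_linear inj])
  also have "\<dots> = interior ((\<lambda>x. b + x) ` ((*v) A ` ref_simplex))" by (simp add: interior_translation)
  also have "\<dots> = interior (convex hull W)" using Ab(2) by (simp add: image_image add.commute)
  finally have "ref_map (convex hull W) = (\<lambda>x. A *v x + b) \<and> det A \<noteq> 0 \<and>
    (\<lambda>x. A *v x + b) ` interior ref_simplex = interior (convex hull W)"
    using Ab(1) \<open>det A \<noteq> 0\<close> by (intro conjI)
  then show ?thesis by (intro exI)
qed

lemma vpolys_affine_transform:
  assumes "w \<in> vpolys k"
  shows "(\<lambda>x. c *\<^sub>R (A *v w (B *v x + b))) \<in> vpolys k"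
proof -
  have "pdeg k (\<lambda>x. w x $ j)" for j using assms by (auto simp: vpolys_def polys_iff_pdeg)
  then have "pdeg k (\<lambda>x. w (B *v x + b) $ j)" for j by (rule pdeg_affine_compose)
  then have "pdeg k (\<lambda>x. c * (\<Sum>j\<in>UNIV. A $ i $ j * w (B *v x + b) $ j))" for i
    by (intro pdeg_cmult pdeg_sum)
  then show ?thesis by (simp add: vpolys_def polys_iff_pdeg matrix_vector_mult_def)
qed

text \<open>A polynomial defined on the whole space, so that derivatives are available on the
  boundary of \<open>K\<close>, where \<open>deform D\<close> itself may have a kink.\<close>

definition elem_poly :: "nat \<Rightarrow> ('n::finite) disc \<Rightarrow> (real^'n) set \<Rightarrow> real^'n \<Rightarrow> real^'n" where
  "elem_poly k D K = (SOME P. P \<in> vpolys k \<and> (\<forall>x\<in>K. deform D x = P x))"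

definition elem_jac :: "nat \<Rightarrow> ('n::finite) disc \<Rightarrow> (real^'n) set \<Rightarrow> real^'n \<Rightarrow> real^'n^'n" where
  "elem_jac k D K x = jacobian (elem_poly k D K) (at x)"

text \<open>\<eta> bounds the deviation of the Jacobian determinants from 1 and is chosen in the
  final theorem from the sizes of the domains; the bound 1 / 2 keeps the determinants
  positive.\<close>

locale deformed_mesh =
  fixes D :: "('n::finite) disc" and \<Omega>ext :: "(real^'n) set" and C \<eta> :: real and k :: nat
  assumes card: "CARD('n) \<in> {2, 3}" and bg: "background_mesh C \<Omega>ext D"
    and op: "open (\<Omega> D)" and sub: "\<Omega> D \<subseteq> \<Omega>ext"
    and pl: "pl_interpolant (alf D) (lset D) (lset_h D)"
    and cont: "continuous_on (\<Union>(macro D)) (deform D)" and inj: "inj_on (deform D) (\<Union>(macro D))"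
    and poly: "\<And>K. K \<in> alf D \<Longrightarrow> \<exists>P\<in>vpolys k. \<forall>x\<in>K. deform D x = P x"
    and \<eta>: "\<eta> \<le> 1 / 2" and k: "0 < k"
    and det_interior: "\<And>K x. K \<in> alf D \<Longrightarrow> x \<in> interior K \<Longrightarrow> \<bar>det (jacobian (deform D) (at x)) - 1\<bar> \<le> \<eta>"
begin

lemma elem_poly: "K \<in> alf D \<Longrightarrow> elem_poly k D K \<in> vpolys k"
  and elem_poly_eq: "K \<in> alf D \<Longrightarrow> x \<in> K \<Longrightarrow> deform D x = elem_poly k D K x"
proof -
  have *: "elem_poly k D K \<in> vpolys k \<and> (\<forall>x\<in>K. deform D x = elem_poly k D K x)" if "K \<in> alf D"
  proof -
    have ex: "\<exists>P. P \<in> vpolys k \<and> (\<forall>x\<in>K. deform D x = P x)" using poly[OF that] by (simp only: Bex_def)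
    show ?thesis unfolding elem_poly_def by (rule someI_ex[OF ex])
  qed
  show "K \<in> alf D \<Longrightarrow> elem_poly k D K \<in> vpolys k" by (rule conjunct1[OF *])
  show "deform D x = elem_poly k D K x" if "K \<in> alf D" "x \<in> K"
    by (rule bspec[OF conjunct2[OF *[OF that(1)]] that(2)])
qed

lemmas alf_full_simplex = alf_simplex(1)[OF bg op sub]
lemmas alf_convex_hull = alf_simplex(2)[OF bg op sub]
lemmas alf_compact = compact_alf[OF bg op sub]
lemmas alf_finite = finite_alf[OF bg op sub]
lemmas alf_disjoint = alf_disjoint_interiors[OF bg op sub]
lemmas alf_Union = Union_alf[OF bg op sub]

lemma alf_interior:
  assumes "K \<in> alf D"
  shows "convex K" "interior K \<noteq> {}" "K = closure (interior K)"
proof -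
  show cv: "convex K" by (subst alf_convex_hull[OF assms]) (rule convex_convex_hull)
  show ne: "interior K \<noteq> {}"
    by (subst alf_convex_hull[OF assms]) (rule interior_nonempty[OF alf_full_simplex[OF assms]])
  show "K = closure (interior K)"
    using convex_closure_interior[OF cv ne] compact_imp_closed[OF alf_compact[OF assms]] by simp
qed

lemma alf_subset_closure: "K \<in> alf D \<Longrightarrow> K \<subseteq> closure (interior K)"
  by (rule equalityD1[OF alf_interior(3)])

lemma alf_subset: "K \<in> alf D \<Longrightarrow> K \<subseteq> \<Union>(macro D)"
  unfolding alf_Union[symmetric] by blast

lemma deform_on_alf:
  assumes "K \<in> alf D"
  shows "continuous_on K (deform D)" "inj_on (deform D) K"
  by (rule continuous_on_subset[OF cont alf_subset[OF assms]], rule inj_on_subset[OF inj alf_subset[OF assms]])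

lemma elem_jac_continuous: "K \<in> alf D \<Longrightarrow> continuous_on S (elem_jac k D K)"
  unfolding elem_jac_def[abs_def] by (rule continuous_on_jacobian[OF elem_poly])

lemma deform_derivative:
  assumes K: "K \<in> alf D" and x: "x \<in> interior K"
  shows "(deform D has_derivative (\<lambda>h. elem_jac k D K x *v h)) (at x)"
    and "jacobian (deform D) (at x) = elem_jac k D K x"
proof -
  show d: "(deform D has_derivative (\<lambda>h. elem_jac k D K x *v h)) (at x)"
    unfolding elem_jac_def
    by (rule has_derivative_transform_within_open[OF vpolys_has_derivative(1)[OF elem_poly[OF K]] open_interior x])
      (rule elem_poly_eq[OF K subsetD[OF interior_subset], symmetric])
  show "jacobian (deform D) (at x) = elem_jac k D K x"
    unfolding jacobian_def frechet_derivative_at[OF d, symmetric] by (simp add: matrix_of_matrix_vector_mul)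
qed

lemma det_elem_jac:
  assumes K: "K \<in> alf D" and x: "x \<in> K"
  shows "\<bar>det (elem_jac k D K x) - 1\<bar> \<le> \<eta>" and "0 < det (elem_jac k D K x)"
proof -
  have "closed {x. \<bar>det (elem_jac k D K x) - 1\<bar> \<le> \<eta>}"
    by (intro closed_Collect_le continuous_intros continuous_on_det elem_jac_continuous[OF K])
  moreover have "interior K \<subseteq> {x. \<bar>det (elem_jac k D K x) - 1\<bar> \<le> \<eta>}"
    using det_interior[OF K] deform_derivative(2)[OF K] by auto
  ultimately have "closure (interior K) \<subseteq> {x. \<bar>det (elem_jac k D K x) - 1\<bar> \<le> \<eta>}" by (rule closure_minimal[rotated])
  then show b: "\<bar>det (elem_jac k D K x) - 1\<bar> \<le> \<eta>" using subsetD[OF alf_subset_closure[OF K] x] by auto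
  then show "0 < det (elem_jac k D K x)" using \<eta> by linarith
qed

lemma interior_deform_image:
  assumes K: "K \<in> alf D"
  shows "interior (deform D ` K) = deform D ` interior K"
proof -
  obtain x where "x \<in> K" using alf_interior(2)[OF K] interior_subset by blast
  then show ?thesis
    using inner_trace_image(1)[OF alf_compact[OF K] alf_subset_closure[OF K] deform_on_alf[OF K], of "\<lambda>_. 0 :: real" "\<lambda>_. 0"]
    by simp
qed

lemma inner_trace_deform:
  fixes G :: "real^'n \<Rightarrow> 'b::t2_space"
  assumes K: "K \<in> alf D" and "continuous_on K G" "\<And>z. z \<in> interior K \<Longrightarrow> f (deform D z) = G z" "x \<in> K"
  shows "inner_trace (deform D ` K) f (deform D x) = G x"
  by (rule inner_trace_image(2)[OF alf_compact[OF K] alf_subset_closure[OF K] deform_on_alf[OF K] assms(2-4)])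

lemma inner_trace_flat:
  fixes G :: "real^'n \<Rightarrow> 'b::t2_space"
  assumes K: "K \<in> alf D" and "continuous_on K G" "\<And>z. z \<in> interior K \<Longrightarrow> f z = G z" "x \<in> K"
  shows "inner_trace K f x = G x"
  using inner_trace_image(2)[OF alf_compact[OF K] alf_subset_closure[OF K], of "\<lambda>x. x" G f x] assms(2-4) by simp

lemma elem_map_derivative:
  assumes K: "K \<in> alf D" and ref: "ref_map K = (\<lambda>x. A *v x + b)" and x: "A *v x + b \<in> interior K"
  shows "jacobian (elem_map D K) (at x) = elem_jac k D K (A *v x + b) ** A"
proof -
  have "((\<lambda>x. A *v x + b) has_derivative (\<lambda>h. A *v h + 0)) (at x)"
    by (intro has_derivative_add bounded_linear_imp_has_derivative matrix_vector_mul_bounded_linear has_derivative_const)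
  then have "((\<lambda>x. A *v x + b) has_derivative (\<lambda>h. A *v h)) (at x)" by simp
  from has_derivative_compose[where g = "deform D", OF this deform_derivative(1)[OF K x]]
  have d: "(elem_map D K has_derivative (\<lambda>h. elem_jac k D K (A *v x + b) *v (A *v h))) (at x)"
    by (simp add: elem_map_def ref o_def)
  show ?thesis
    unfolding jacobian_def frechet_derivative_at[OF d, symmetric]
    by (simp add: matrix_vector_mul_assoc matrix_of_matrix_vector_mul)
qed

lemma alf_ref_map:
  assumes K: "K \<in> alf D"
  shows "\<exists>A b. ref_map K = (\<lambda>x. A *v x + b) \<and> det A \<noteq> 0 \<and> (\<lambda>x. A *v x + b) ` interior ref_simplex = interior K"
  by (rule ref_map_affine[OF alf_full_simplex[OF K], folded alf_convex_hull[OF K]])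

text \<open>Piola transforms compose: the affine part of the element map turns a polynomial on the
  reference simplex into one of the same degree on \<open>K\<close>, leaving the transform by the
  deformation alone.\<close>

lemma V_h_piola:
  assumes u: "u \<in> V_h k D" and K: "K \<in> alf D"
  shows "\<exists>w\<in>vpolys k. \<forall>z\<in>interior K. u (deform D z) = (1 / det (elem_jac k D K z)) *\<^sub>R (elem_jac k D K z *v w z)"
proof -
  obtain A b where ref: "ref_map K = (\<lambda>x. A *v x + b)" and A: "det A \<noteq> 0"
    and int: "(\<lambda>x. A *v x + b) ` interior ref_simplex = interior K"
    using alf_ref_map[OF K] by (elim exE conjE) (rule that)
  obtain v where v: "v \<in> vpolys k" "\<And>x. x \<in> interior ref_simplex \<Longrightarrow> u (elem_map D K x) =
      (1 / det (jacobian (elem_map D K) (at x))) *\<^sub>R (jacobian (elem_map D K) (at x) *v v x)"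
    using u K by (auto simp: V_h_def)
  note B = matrix_inv_mult[OF A]
  define w where "w z = (1 / det A) *\<^sub>R (A *v v (matrix_inv A *v z + - (matrix_inv A *v b)))" for z
  have "w \<in> vpolys k" unfolding w_def by (rule vpolys_affine_transform[OF v(1)])
  moreover have "u (deform D z) = (1 / det (elem_jac k D K z)) *\<^sub>R (elem_jac k D K z *v w z)" if z: "z \<in> interior K" for z
  proof -
    obtain x where x: "x \<in> interior ref_simplex" "z = A *v x + b" using z int by auto
    have "matrix_inv A *v z + - (matrix_inv A *v b) = x"
      by (simp add: x(2) matrix_vector_right_distrib matrix_vector_mul_assoc B)
    then have w: "w z = (1 / det A) *\<^sub>R (A *v v x)" by (simp add: w_def)
    have "u (deform D z) = u (elem_map D K x)" by (simp add: elem_map_def ref x(2))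
    also have "\<dots> = (1 / det (elem_jac k D K z ** A)) *\<^sub>R ((elem_jac k D K z ** A) *v v x)"
      using v(2)[OF x(1)] elem_map_derivative[OF K ref, of x] z by (simp add: x(2))
    also have "\<dots> = (1 / det (elem_jac k D K z)) *\<^sub>R (elem_jac k D K z *v w z)"
      by (simp add: w det_mul matrix_vector_mult_scaleR matrix_vector_mul_assoc)
    finally show ?thesis .
  qed
  ultimately show ?thesis by blast
qed

lemma Q_h_member:
  assumes "\<And>K. K \<in> alf D \<Longrightarrow> \<exists>w. pdeg (k - 1) w \<and> (\<forall>z\<in>interior K. q (deform D z) = w z)"
  shows "q \<in> Q_h k D"
  unfolding Q_h_def
proof (intro CollectI ballI)
  fix K assume K: "K \<in> alf D"
  obtain A b where ref: "ref_map K = (\<lambda>x. A *v x + b)"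
    and int: "(\<lambda>x. A *v x + b) ` interior ref_simplex = interior K"
    using alf_ref_map[OF K] by (elim exE conjE) (rule that)
  obtain w where w: "pdeg (k - 1) w" "\<forall>z\<in>interior K. q (deform D z) = w z" using assms[OF K] by blast
  show "\<exists>w\<in>polys (k - 1). \<forall>x\<in>interior ref_simplex. q (elem_map D K x) = w x"
  proof (intro bexI[of _ "\<lambda>x. w (A *v x + b)"] ballI)
    show "(\<lambda>x. w (A *v x + b)) \<in> polys (k - 1)"
      unfolding polys_iff_pdeg by (rule pdeg_affine_compose[OF w(1)])
    fix x assume "x \<in> interior (ref_simplex :: (real^'n) set)"
    then have "A *v x + b \<in> interior K" using int by auto
    then show "q (elem_map D K x) = w (A *v x + b)" using w(2) by (simp add: elem_map_def ref)
  qed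
qed

lemma one_in_\<Sigma>_h: "(\<lambda>_. 1) \<in> \<Sigma>_h kl D"
  unfolding \<Sigma>_h_def by (auto intro!: bexI[of _ "\<lambda>_. 1"] simp: polys_iff_pdeg pdeg_const)

definition piola_field :: "(real^'n \<Rightarrow> real^'n) \<Rightarrow> (real^'n) set \<Rightarrow> real^'n \<Rightarrow> real^'n" where
  "piola_field u K = (SOME w. w \<in> vpolys k \<and>
     (\<forall>z\<in>interior K. u (deform D z) = (1 / det (elem_jac k D K z)) *\<^sub>R (elem_jac k D K z *v w z)))"

lemma piola_field:
  assumes "u \<in> V_h k D" "K \<in> alf D"
  shows "piola_field u K \<in> vpolys k"
    and "z \<in> interior K \<Longrightarrow> u (deform D z) = (1 / det (elem_jac k D K z)) *\<^sub>R (elem_jac k D K z *v piola_field u K z)"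
proof -
  have ex: "\<exists>w. w \<in> vpolys k \<and>
     (\<forall>z\<in>interior K. u (deform D z) = (1 / det (elem_jac k D K z)) *\<^sub>R (elem_jac k D K z *v w z))"
    using V_h_piola[OF assms] by (simp only: Bex_def)
  have *: "piola_field u K \<in> vpolys k \<and>
     (\<forall>z\<in>interior K. u (deform D z) = (1 / det (elem_jac k D K z)) *\<^sub>R (elem_jac k D K z *v piola_field u K z))"
    unfolding piola_field_def by (rule someI_ex[OF ex])
  show "piola_field u K \<in> vpolys k" by (rule conjunct1[OF *])
  show "z \<in> interior K \<Longrightarrow> u (deform D z) = (1 / det (elem_jac k D K z)) *\<^sub>R (elem_jac k D K z *v piola_field u K z)"
    by (rule bspec[OF conjunct2[OF *]])
qed

lemma trace_V_h:
  assumes u: "u \<in> V_h k D" and K: "K \<in> alf D" and x: "x \<in> K"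
  shows "inner_trace (deform D ` K) u (deform D x)
    = (1 / det (elem_jac k D K x)) *\<^sub>R (elem_jac k D K x *v piola_field u K x)"
proof (rule inner_trace_deform[where G = "\<lambda>x. (1 / det (elem_jac k D K x)) *\<^sub>R (elem_jac k D K x *v piola_field u K x)",
      OF K _ piola_field(2)[OF u K] x])
  have "continuous_on K (\<lambda>x. elem_jac k D K x *v piola_field u K x)"
    by (rule bounded_bilinear.continuous_on[OF bounded_bilinear_matrix_vector_mult elem_jac_continuous[OF K]
        continuous_on_vpolys[OF piola_field(1)[OF u K]]])
  moreover have "continuous_on K (\<lambda>x. 1 / det (elem_jac k D K x))"
    using det_elem_jac(2)[OF K]
    by (intro continuous_on_divide continuous_on_const continuous_on_det elem_jac_continuous[OF K]) (auto simp: less_le)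
  ultimately show "continuous_on K (\<lambda>x. (1 / det (elem_jac k D K x)) *\<^sub>R (elem_jac k D K x *v piola_field u K x))"
    by (intro continuous_on_scaleR)
qed

text \<open>The Jacobians may jump across the facet, so only normal components can match. They do at
  the nodes, since the traces of \<open>u\<close> agree there and the Jacobians agree on tangential
  vectors; being polynomials of degree \<open>k\<close>, they then agree on the facet.\<close>

lemma piola_field_conforming:
  assumes u: "u \<in> V_h k D" and K: "K \<in> alf D" "K' \<in> alf D" and v: "v \<in> vertices K" "v' \<in> vertices K'"
    and eq: "vertices K - {v} = vertices K' - {v'}" and x: "x \<in> convex hull (vertices K - {v})"
  shows "outer_normal (vertices K) v \<bullet> piola_field u K x = outer_normal (vertices K) v \<bullet> piola_field u K' x"
proof -
  define W where "W = vertices K"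
  define W' where "W' = vertices K'"
  note W = alf_full_simplex[OF K(1), folded W_def] and W' = alf_full_simplex[OF K(2), folded W'_def]
  note KW = alf_convex_hull[OF K(1), folded W_def] and KW' = alf_convex_hull[OF K(2), folded W'_def]
  note v = v[folded W_def W'_def] and eq = eq[folded W_def W'_def] and x = x[folded W_def]
  define g where "g = bary_grad W v"
  have FK: "convex hull (W - {v}) \<subseteq> K" unfolding KW by (intro hull_mono) auto
  have FK': "convex hull (W - {v}) \<subseteq> K'" unfolding KW' eq by (intro hull_mono) auto
  have node: "g \<bullet> piola_field u K z = g \<bullet> piola_field u K' z"
    if z: "z \<in> convex hull (W - {v})" "z \<in> lagrange_nodes k K" for z
  proof (rule piola_normal_component_eq)
    have zK: "z \<in> K" "z \<in> K'" using z(1) FK FK' by auto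
    show "det (elem_jac k D K z) \<noteq> 0" "det (elem_jac k D K' z) \<noteq> 0"
      using det_elem_jac(2)[OF K(1) zK(1)] det_elem_jac(2)[OF K(2) zK(2)] by auto
    show "g \<noteq> 0" unfolding g_def by (rule bary_grad_nonzero[OF W v(1)])
    show "elem_jac k D K z *v t = elem_jac k D K' z *v t" if "g \<bullet> t = 0" for t
      unfolding elem_jac_def
    proof (rule vpolys_diff_facet[OF W v(1) k elem_poly[OF K(1)] elem_poly[OF K(2)] _ z(1)])
      show "elem_poly k D K y = elem_poly k D K' y" if "y \<in> convex hull (W - {v})" for y
        using elem_poly_eq[OF K(1) subsetD[OF FK that]] elem_poly_eq[OF K(2) subsetD[OF FK' that]] by simp
    qed (use that in \<open>simp add: g_def\<close>)
    have "inner_trace (deform D ` K) u (deform D z) = inner_trace (deform D ` K') u (deform D z)"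
      using u unfolding V_h_def mem_Collect_eq using K z(2) zK by blast
    then show "(1 / det (elem_jac k D K z)) *\<^sub>R (elem_jac k D K z *v piola_field u K z) =
      (1 / det (elem_jac k D K' z)) *\<^sub>R (elem_jac k D K' z *v piola_field u K' z)"
      using trace_V_h[OF u K(1) zK(1)] trace_V_h[OF u K(2) zK(2)] by simp
  qed
  have "g \<bullet> piola_field u K x - g \<bullet> piola_field u K' x = 0"
  proof (rule pdeg_zero_on_facet_plane[where p = "\<lambda>x. g \<bullet> piola_field u K x - g \<bullet> piola_field u K' x" and x = x,
      OF W v(1) k])
    have "pdeg k (\<lambda>x. piola_field u K x $ i)" "pdeg k (\<lambda>x. piola_field u K' x $ i)" for i
      using piola_field(1)[OF u K(1)] piola_field(1)[OF u K(2)] by (auto simp: vpolys_def polys_iff_pdeg)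
    then show "pdeg k (\<lambda>x. g \<bullet> piola_field u K x - g \<bullet> piola_field u K' x)"
      unfolding inner_vec_def inner_real_def by (intro pdeg_minus pdeg_sum pdeg_cmult)
    show "bary W v x = 0" using x convex_hull_facet[OF W v(1)] by simp
    show "g \<bullet> piola_field u K (\<Sum>u\<in>W - {v}. (real (\<alpha> u) / real k) *\<^sub>R u)
      - g \<bullet> piola_field u K' (\<Sum>u\<in>W - {v}. (real (\<alpha> u) / real k) *\<^sub>R u) = 0" if "sum \<alpha> (W - {v}) = k" for \<alpha>
      using node[OF facet_node_in_facet[OF W k that]] facet_node[OF W v(1) k that] KW by simp
  qed
  then show ?thesis by (simp add: outer_normal_def sgn_div_norm g_def W_def)
qed

end

section \<open>Integrals over the deformed mesh, pulled back to flat simplices\<close>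

lemma absolutely_integrable_continuous_compact:
  fixes f :: "'a::euclidean_space \<Rightarrow> real"
  assumes "compact S" "continuous_on S f"
  shows "f absolutely_integrable_on S"
  using borel_integrable_compact[OF assms] by (simp add: set_integrable_def integrable_completion)

context deformed_mesh
begin

lemma negligible_alf_frontier: "K \<in> alf D \<Longrightarrow> negligible (K - interior K)"
  by (rule negligible_subset[OF negligible_convex_frontier[OF alf_interior(1)]])
    (auto simp: frontier_def intro: subsetD[OF closure_subset])

text \<open>Variables are changed on the open elements only. The remaining mesh skeleton is the
  image of null sets under the smooth maps \<open>elem_poly\<close>, hence null, so the values of
  \<open>g\<close> on it do not matter.\<close>

lemma has_integral_deformed_mesh:
  fixes g :: "real^'n \<Rightarrow> real"
  assumes G: "\<And>K. K \<in> alf D \<Longrightarrow> continuous_on K (G K)"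
    and eq: "\<And>K z. K \<in> alf D \<Longrightarrow> z \<in> interior K \<Longrightarrow> det (elem_jac k D K z) * g (deform D z) = G K z"
  shows "(g has_integral (\<Sum>K\<in>alf D. integral K (G K))) (\<Omega>_mesh D)"
proof -
  have each: "(g has_integral integral K (G K)) (deform D ` interior K)" if K: "K \<in> alf D" for K
  proof -
    have Gint: "G K absolutely_integrable_on K"
      by (rule absolutely_integrable_continuous_compact[OF alf_compact[OF K] G[OF K]])
    then have "G K absolutely_integrable_on interior K"
      by (rule set_integrable_subset) (auto simp: interior_subset)
    moreover have "\<bar>det (matrix (\<lambda>h. elem_jac k D K z *v h))\<bar> * g (deform D z) = G K z" if "z \<in> interior K" for z
      using eq[OF K that] det_elem_jac(2)[OF K subsetD[OF interior_subset that]]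
      by (simp add: matrix_of_matrix_vector_mul)
    ultimately have int: "(\<lambda>z. \<bar>det (matrix (\<lambda>h. elem_jac k D K z *v h))\<bar> * g (deform D z)) absolutely_integrable_on interior K"
      and eq': "integral (interior K) (\<lambda>z. \<bar>det (matrix (\<lambda>h. elem_jac k D K z *v h))\<bar> * g (deform D z)) = integral (interior K) (G K)"
      by (simp_all cong: set_integrable_cong integral_cong)
    note cv = change_of_variables_dim_2_3[OF card _ has_derivative_at_withinI[OF deform_derivative(1)[OF K]]
        inj_on_subset[OF deform_on_alf(2)[OF K] interior_subset] int]
    have "integral (interior K) (G K) = integral K (G K)"
      by (rule integral_subset_negligible[OF interior_subset negligible_alf_frontier[OF K]])
    then show ?thesis
      using cv eq' by (simp add: has_integral_iff absolutely_integrable_on_def)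
  qed
  have "(g has_integral (\<Sum>K\<in>alf D. integral K (G K))) (\<Union>K\<in>alf D. deform D ` interior K)"
  proof (rule has_integral_UN[OF alf_finite each])
    show "pairwise (\<lambda>K K'. negligible (deform D ` interior K \<inter> deform D ` interior K')) (alf D)"
    proof (rule pairwiseI)
      fix K K' assume K: "K \<in> alf D" "K' \<in> alf D" "K \<noteq> K'"
      have "interior K \<subseteq> \<Union>(macro D)" "interior K' \<subseteq> \<Union>(macro D)"
        using alf_subset[OF K(1)] alf_subset[OF K(2)] interior_subset by (meson order_trans)+
      then have "deform D ` interior K \<inter> deform D ` interior K' = deform D ` (interior K \<inter> interior K')"
        by (rule inj_on_image_Int[OF inj, symmetric])
      then show "negligible (deform D ` interior K \<inter> deform D ` interior K')"
        using alf_disjoint[OF K] by simp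
    qed
  qed
  moreover have "negligible {x \<in> (\<Union>K\<in>alf D. deform D ` interior K) - \<Omega>_mesh D. g x \<noteq> 0}"
  proof -
    have "(\<Union>K\<in>alf D. deform D ` interior K) - \<Omega>_mesh D = {}"
      unfolding \<Omega>_mesh_def alf_Union[symmetric] using interior_subset by blast
    then have "{x \<in> (\<Union>K\<in>alf D. deform D ` interior K) - \<Omega>_mesh D. g x \<noteq> 0} = {}" by blast
    then show ?thesis by (simp only: negligible_empty)
  qed
  moreover have "negligible {x \<in> \<Omega>_mesh D - (\<Union>K\<in>alf D. deform D ` interior K). g x \<noteq> 0}"
  proof -
    have "\<Omega>_mesh D - (\<Union>K\<in>alf D. deform D ` interior K) \<subseteq> (\<Union>K\<in>alf D. elem_poly k D K ` (K - interior K))"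
    proof
      fix y assume y: "y \<in> \<Omega>_mesh D - (\<Union>K\<in>alf D. deform D ` interior K)"
      then obtain K z where z: "K \<in> alf D" "z \<in> K" "y = deform D z" unfolding \<Omega>_mesh_def alf_Union[symmetric] by blast
      then have "z \<notin> interior K" using y by blast
      then show "y \<in> (\<Union>K\<in>alf D. elem_poly k D K ` (K - interior K))"
        using z elem_poly_eq[OF z(1,2)] by blast
    qed
    moreover have "negligible (\<Union>K\<in>alf D. elem_poly k D K ` (K - interior K))"
    proof (intro negligible_Union finite_imageI alf_finite)
      fix Y assume "Y \<in> (\<lambda>K. elem_poly k D K ` (K - interior K)) ` alf D"
      then obtain K where K: "K \<in> alf D" "Y = elem_poly k D K ` (K - interior K)" by blast
      show "negligible Y" unfolding K(2)
      proof (rule negligible_differentiable_image_negligible[OF _ negligible_alf_frontier[OF K(1)]])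
        show "elem_poly k D K differentiable_on (K - interior K)"
          using vpolys_has_derivative(1)[OF elem_poly[OF K(1)]]
          by (meson differentiable_at_imp_differentiable_on differentiable_def)
      qed simp
    qed
    ultimately have "negligible (\<Omega>_mesh D - (\<Union>K\<in>alf D. deform D ` interior K))" by (rule negligible_subset[rotated])
    then show ?thesis by (rule negligible_subset) auto
  qed
  ultimately show ?thesis using has_integral_spike_set_eq by blast
qed

lemma divergence_V_h:
  assumes u: "u \<in> V_h k D" and K: "K \<in> alf D" and z: "z \<in> interior K"
  shows "divergence u (deform D z) = divergence (piola_field u K) z / det (elem_jac k D K z)"
proof -
  have eq: "elem_poly k D K x = deform D x" if "x \<in> interior K" for x
    using elem_poly_eq[OF K subsetD[OF interior_subset that]] by simp
  have "divergence u (elem_poly k D K z) = divergence (piola_field u K) z / det (jacobian (elem_poly k D K) (at z))"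
  proof (rule divergence_piola[OF elem_poly[OF K] piola_field(1)[OF u K] open_interior z])
    show "inj_on (elem_poly k D K) (interior K)"
      using inj_on_cong[of "interior K" "elem_poly k D K" "deform D"] eq
        inj_on_subset[OF deform_on_alf(2)[OF K] interior_subset] by blast
    show "det (jacobian (elem_poly k D K) (at z)) \<noteq> 0"
      using det_elem_jac(2)[OF K subsetD[OF interior_subset z]] by (simp add: elem_jac_def)
    show "u (elem_poly k D K x) = (1 / det (jacobian (elem_poly k D K) (at x))) *\<^sub>R
        (jacobian (elem_poly k D K) (at x) *v piola_field u K x)" if "x \<in> interior K" for x
      using piola_field(2)[OF u K that] eq[OF that] by (simp add: elem_jac_def)
  qed
  then show ?thesis using eq[OF z] by (simp add: elem_jac_def)
qed

lemma b_h_flat: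
  assumes u: "u \<in> V_h k D" and Q: "\<And>K. K \<in> alf D \<Longrightarrow> continuous_on K (Q K)"
    and q: "\<And>K z. K \<in> alf D \<Longrightarrow> z \<in> interior K \<Longrightarrow> q (deform D z) = Q K z"
  shows "b_h D q u = - (\<Sum>K\<in>alf D. integral K (\<lambda>z. Q K z * divergence (piola_field u K) z))"
proof -
  have "((\<lambda>y. q y * divergence u y) has_integral (\<Sum>K\<in>alf D. integral K (\<lambda>z. Q K z * divergence (piola_field u K) z))) (\<Omega>_mesh D)"
  proof (rule has_integral_deformed_mesh)
    fix K assume K: "K \<in> alf D"
    show "continuous_on K (\<lambda>z. Q K z * divergence (piola_field u K) z)"
      by (intro continuous_on_mult Q[OF K] pdeg_continuous_on[OF pdeg_divergence[OF piola_field(1)[OF u K]]])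
    fix z assume z: "z \<in> interior K"
    show "det (elem_jac k D K z) * (q (deform D z) * divergence u (deform D z)) = Q K z * divergence (piola_field u K) z"
      using det_elem_jac(2)[OF K subsetD[OF interior_subset z]] by (simp add: divergence_V_h[OF u K z] q[OF K z])
  qed
  then show ?thesis by (simp add: b_h_def integral_unique)
qed

text \<open>Open elements are disjoint and the deformation is injective, so elementwise
  prescriptions do not conflict; this supplies the pressure test functions.\<close>

lemma piecewise_function:
  fixes Q :: "(real^'n) set \<Rightarrow> real^'n \<Rightarrow> real"
  obtains q where "\<And>K z. K \<in> alf D \<Longrightarrow> z \<in> interior K \<Longrightarrow> q (deform D z) = Q K z"
proof -
  define q where "q y = Q (SOME K. K \<in> alf D \<and> y \<in> deform D ` interior K) (inv_into (\<Union>(macro D)) (deform D) y)" for y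
  have "q (deform D z) = Q K z" if K: "K \<in> alf D" and z: "z \<in> interior K" for K z
  proof -
    have zm: "z \<in> \<Union>(macro D)" using alf_subset[OF K] interior_subset z by blast
    have "(SOME K. K \<in> alf D \<and> deform D z \<in> deform D ` interior K) = K"
    proof (rule some_equality)
      show "K \<in> alf D \<and> deform D z \<in> deform D ` interior K" using K z by blast
      fix K' assume K': "K' \<in> alf D \<and> deform D z \<in> deform D ` interior K'"
      then obtain z' where z': "z' \<in> interior K'" "deform D z = deform D z'" by blast
      then have "z' \<in> \<Union>(macro D)" using alf_subset[of K'] K' interior_subset by blast
      then have "z = z'" using inj_onD[OF inj z'(2) zm] by simp
      then show "K' = K" using alf_disjoint[of K' K] K' K z z'(1) by blast
    qed
    moreover have "inv_into (\<Union>(macro D)) (deform D) (deform D z) = z" using inj zm by simp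
    ultimately show ?thesis by (simp add: q_def)
  qed
  then show ?thesis using that by blast
qed

text \<open>With B = J^(-T) \<nu>, the normal is B / |B|, the surface element is det J |B|, and
  \<open>u\<close> is J w / det J. In the product everything cancels except B \<bullet> J w = \<nu>
  \<bullet> w.\<close>

lemma c_h_flat:
  assumes u: "u \<in> V_h k D"
  shows "c_h D (\<lambda>_. 1) u = (\<Sum>K | K \<in> alf D \<and> (\<exists>x\<in>K. lset_h D x < 0).
        plane_integral (flat_normal D K) {x \<in> K. lset_h D x = 0} (\<lambda>x. flat_normal D K \<bullet> piola_field u K x))"
  unfolding c_h_def surf_integral_def
proof (rule sum.cong[OF refl])
  fix K assume "K \<in> {K. K \<in> alf D \<and> (\<exists>x\<in>K. lset_h D x < 0)}"
  then have K: "K \<in> alf D" and neg: "\<exists>x\<in>K. lset_h D x < 0" by auto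
  obtain \<alpha> \<beta> where ab: "\<And>x. x \<in> K \<Longrightarrow> lset_h D x = \<alpha> \<bullet> x + \<beta>" using lset_h_affine[OF pl K] by blast
  have fn: "flat_normal D K = sgn \<alpha>"
    using flat_normal_eq[OF alf_full_simplex[OF K], folded alf_convex_hull[OF K], of D \<alpha> \<beta>] ab by blast
  define \<nu> where "\<nu> = sgn \<alpha>"
  define w where "w = piola_field u K"
  define J where "J = elem_jac k D K"
  define B where "B z = transpose (matrix_inv (J z)) *v \<nu>" for z
  let ?S = "{x \<in> K. lset_h D x = 0}"
  let ?g = "\<lambda>x. 1 * inner_trace (deform D ` K) (\<lambda>y. n_h D y \<bullet> u y) (deform D x) *
     inner_trace K (\<lambda>z. \<bar>det (jacobian (deform D) (at z))\<bar> *
       norm (transpose (matrix_inv (jacobian (deform D) (at z))) *v flat_normal D K)) x"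
  show "plane_integral (flat_normal D K) ?S ?g = plane_integral (flat_normal D K) ?S (\<lambda>x. flat_normal D K \<bullet> piola_field u K x)"
  \<comment> \<open>Here the level set function is a negative constant on \<open>K\<close>, so there
    is no interface piece.\<close>
  proof (cases "\<alpha> = 0")
    case True
    then have e: "?S = {}" using ab neg by auto
    show ?thesis unfolding e by (simp add: plane_integral_def)
  next
    case False
    have \<nu>: "norm \<nu> = 1" using False by (simp add: \<nu>_def norm_sgn)
    have det0: "det (J z) > 0" if "z \<in> K" for z unfolding J_def by (rule det_elem_jac(2)[OF K that])
    have inv: "J z ** matrix_inv (J z) = mat 1" "matrix_inv (J z) ** J z = mat 1" if "z \<in> K" for z
      using matrix_inv_mult[of "J z"] det0[OF that] by auto
    have inner_B: "(transpose (matrix_inv (J z)) *v a) \<bullet> h = a \<bullet> (matrix_inv (J z) *v h)" for a h z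
      by (simp add: transpose_matrix_vector dot_lmul_matrix)
    have B0: "B z \<noteq> 0" if "z \<in> K" for z
    proof
      assume "B z = 0"
      then have "\<nu> \<bullet> (matrix_inv (J z) *v (J z *v \<nu>)) = 0" using inner_B[of z \<nu> "J z *v \<nu>"] by (simp add: B_def)
      then have "\<nu> \<bullet> \<nu> = 0" using inv[OF that] by (simp add: matrix_vector_mul_assoc)
      then show False using \<nu> by simp
    qed
    have Jc: "continuous_on K J" unfolding J_def by (rule elem_jac_continuous[OF K])
    have Bc: "continuous_on K B"
    proof -
      have "continuous_on K (\<lambda>z. transpose (matrix_inv (J z)))"
      proof -
        have mi: "continuous_on K (\<lambda>z. matrix_inv (J z))"
          by (rule continuous_on_matrix_inv[OF Jc]) (use det0 in force)
        show ?thesis unfolding transpose_def by (intro continuous_on_vec_lambda continuous_on_component mi)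
      qed
      then show ?thesis unfolding B_def[abs_def]
        by (rule bounded_bilinear.continuous_on[OF bounded_bilinear_matrix_vector_mult _ continuous_on_const])
    qed
    have wc: "continuous_on K w" unfolding w_def by (rule continuous_on_vpolys[OF piola_field(1)[OF u K]])
    define G where "G x = (\<nu> \<bullet> w x) / (det (J x) * norm (B x))" for x
    have Gc: "continuous_on K G"
      unfolding G_def using det0 B0
      by (intro continuous_on_divide continuous_on_mult continuous_on_inner continuous_on_const wc
          continuous_on_det Jc continuous_on_norm Bc) force
    have nh: "n_h D (deform D z) \<bullet> u (deform D z) = G z" if z: "z \<in> interior K" for z
    proof -
      have zK: "z \<in> K" using z interior_subset by blast
      have subm: "interior K \<subseteq> \<Union>(macro D)" using alf_subset[OF K] interior_subset by blast
      have invd: "inv_deform D (deform D x) = x" if "x \<in> interior K" for x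
        unfolding inv_deform_def using inj subm that by (auto intro: inv_into_f_f)
      have comp: "(*v) (J z) \<circ> (*v) (matrix_inv (J z)) = id"
        using inv[OF zK] by (auto simp: matrix_vector_mul_assoc)
      have d: "(inv_deform D has_derivative (*v) (matrix_inv (J z))) (at (deform D z))"
        by (rule has_derivative_inverse_strong[OF open_interior z continuous_on_subset[OF deform_on_alf(1)[OF K] interior_subset]
            invd deform_derivative(1)[OF K z, folded J_def] comp])
      have "((\<lambda>y. \<alpha> \<bullet> inv_deform D y + \<beta>) has_derivative (\<lambda>h. \<alpha> \<bullet> (matrix_inv (J z) *v h) + 0)) (at (deform D z))"
        by (intro has_derivative_add has_derivative_inner_right d has_derivative_const)
      then have "((\<lambda>y. \<alpha> \<bullet> inv_deform D y + \<beta>) has_derivative (\<lambda>h. (transpose (matrix_inv (J z)) *v \<alpha>) \<bullet> h)) (at (deform D z))"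
        by (simp add: inner_B del: transpose_matrix_vector)
      then have "((\<lambda>y. lset_h D (inv_deform D y)) has_derivative (\<lambda>h. (transpose (matrix_inv (J z)) *v \<alpha>) \<bullet> h)) (at (deform D z))"
      proof (rule has_derivative_transform_within_open)
        show "open (deform D ` interior K)" unfolding interior_deform_image[OF K, symmetric] by (rule open_interior)
        show "deform D z \<in> deform D ` interior K" using z by blast
        fix y assume "y \<in> deform D ` interior K"
        then obtain x where x: "x \<in> interior K" "y = deform D x" by blast
        then show "\<alpha> \<bullet> inv_deform D y + \<beta> = lset_h D (inv_deform D y)"
          using invd[OF x(1)] ab[OF subsetD[OF interior_subset x(1)]] by simp
      qed
      then have "grad (\<lambda>y. lset_h D (inv_deform D y)) (deform D z) = transpose (matrix_inv (J z)) *v \<alpha>" by (rule grad_unique)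
      also have "\<alpha> = norm \<alpha> *\<^sub>R \<nu>" using False by (simp add: \<nu>_def sgn_div_norm)
      finally have "n_h D (deform D z) = sgn (norm \<alpha> *\<^sub>R B z)"
        by (simp add: n_h_def B_def matrix_vector_mult_scaleR del: transpose_matrix_vector)
      then have "n_h D (deform D z) = (1 / norm (B z)) *\<^sub>R B z"
        using False by (simp add: sgn_scaleR) (simp add: sgn_div_norm divide_inverse)
      moreover have "u (deform D z) = (1 / det (J z)) *\<^sub>R (J z *v w z)"
        unfolding J_def w_def by (rule piola_field(2)[OF u K z])
      moreover have "B z \<bullet> (J z *v w z) = \<nu> \<bullet> w z"
        unfolding B_def inner_B using inv[OF zK] by (simp add: matrix_vector_mul_assoc)
      ultimately show ?thesis by (simp add: G_def)
    qed
    have t1: "inner_trace (deform D ` K) (\<lambda>y. n_h D y \<bullet> u y) (deform D x) = G x" if "x \<in> K" for x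
      by (rule inner_trace_deform[where f = "\<lambda>y. n_h D y \<bullet> u y", OF K Gc nh that])
    have t2: "inner_trace K (\<lambda>z. \<bar>det (jacobian (deform D) (at z))\<bar> *
       norm (transpose (matrix_inv (jacobian (deform D) (at z))) *v flat_normal D K)) x = det (J x) * norm (B x)"
      if "x \<in> K" for x
    proof (rule inner_trace_flat[where G = "\<lambda>x. det (J x) * norm (B x)", OF K _ _ that])
      show "continuous_on K (\<lambda>x. det (J x) * norm (B x))"
        by (intro continuous_on_mult continuous_on_det Jc continuous_on_norm Bc)
      show "\<bar>det (jacobian (deform D) (at z))\<bar> *
         norm (transpose (matrix_inv (jacobian (deform D) (at z))) *v flat_normal D K) = det (J z) * norm (B z)"
        if "z \<in> interior K" for z
        using deform_derivative(2)[OF K that] det0[OF subsetD[OF interior_subset that]]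
        by (simp add: J_def[symmetric] B_def fn \<nu>_def)
    qed
    show ?thesis
    proof (rule plane_integral_cong[where \<beta> = "- \<beta> / norm \<alpha>"])
      show "norm (flat_normal D K) = 1" using \<nu> fn by (simp add: \<nu>_def)
      show "?S \<subseteq> {x. flat_normal D K \<bullet> x = - \<beta> / norm \<alpha>}"
      proof
        fix x assume "x \<in> ?S"
        then have "\<alpha> \<bullet> x = - \<beta>" using ab by auto
        then show "x \<in> {x. flat_normal D K \<bullet> x = - \<beta> / norm \<alpha>}" by (simp add: fn sgn_div_norm divide_inverse)
      qed
      fix x assume "x \<in> ?S"
      then have x: "x \<in> K" by simp
      show "?g x = flat_normal D K \<bullet> piola_field u K x"
        unfolding t1[OF x] t2[OF x] using det0[OF x] B0[OF x] by (simp add: G_def fn \<nu>_def w_def)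
    qed
  qed
qed

lemma alf_lmeasurable: "K \<in> alf D \<Longrightarrow> K \<in> lmeasurable"
  by (rule lmeasurable_compact[OF alf_compact])

lemma sum_measure_alf: "(\<Sum>K\<in>alf D. measure lebesgue K) = measure lebesgue (\<Union>(macro D))"
proof -
  have "measure lebesgue (\<Union>(alf D)) = (\<Sum>K\<in>alf D. measure lebesgue K)"
  proof (rule measure_negligible_finite_Union[OF alf_finite alf_lmeasurable])
    show "pairwise (\<lambda>S T. negligible (S \<inter> T)) (alf D)"
    proof (rule pairwiseI)
      fix K K' assume K: "K \<in> alf D" "K' \<in> alf D" "K \<noteq> K'"
      have "K \<inter> K' \<subseteq> (K - interior K) \<union> (K' - interior K')" using alf_disjoint[OF K] by blast
      then show "negligible (K \<inter> K')"
        using negligible_alf_frontier[OF K(1)] negligible_alf_frontier[OF K(2)] negligible_Un negligible_subset by metis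
    qed
  qed
  then show ?thesis by (simp add: alf_Union)
qed

lemma cut_lmeasurable:
  assumes K: "K \<in> alf D"
  shows "{x \<in> K. lset_h D x < 0} \<in> lmeasurable"
proof -
  obtain \<alpha> \<beta> where ab: "\<And>x. x \<in> K \<Longrightarrow> lset_h D x = \<alpha> \<bullet> x + \<beta>" using lset_h_affine[OF pl K] by blast
  then have eq: "{x \<in> K. lset_h D x < 0} = K \<inter> {x. \<alpha> \<bullet> x + \<beta> < 0}" by auto
  have "open {x. \<alpha> \<bullet> x + \<beta> < 0}" by (intro open_Collect_less continuous_intros)
  then have "{x. \<alpha> \<bullet> x + \<beta> < 0} \<in> sets lebesgue" using borel_open by auto
  then show ?thesis unfolding eq by (rule fmeasurable_Int_fmeasurable[OF alf_lmeasurable[OF K]])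
qed

text \<open>The pressure test functions determine \<open>\<nabla> \<cdot> u\<close> up to one constant \<open>m\<close>: the flat divergences are
  close to \<open>m\<close>, as the Jacobians of the deformation are close to 1. The multiplier \<open>\<mu> = 1\<close> says that
  the mean over the discrete domain vanishes, so \<open>m = 0\<close> unless that domain is too small.\<close>

theorem divergence_free:
  assumes u: "u \<in> V_h k D" and b0: "\<And>q. q \<in> Q0_h k D \<Longrightarrow> b_h D q u = 0" and c0: "c_h D (\<lambda>_. 1) u = 0"
    and \<eta>0: "0 < \<eta>" and small: "\<eta> * measure lebesgue (\<Union>(macro D)) < measure lebesgue (\<Union>K\<in>alf D. {x \<in> K. lset_h D x < 0})"
    and K0: "K0 \<in> alf D" and y: "y \<in> interior (deform D ` K0)"
  shows "divergence u y = 0"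
proof -
  define \<delta> where "\<delta> K = divergence (piola_field u K)" for K
  define J where "J K z = det (elem_jac k D K z)" for K z
  define N where "N K = {x \<in> K. lset_h D x < 0}" for K
  have \<delta>p: "pdeg (k - 1) (\<delta> K)" if "K \<in> alf D" for K
    unfolding \<delta>_def by (rule pdeg_divergence[OF piola_field(1)[OF u that]])
  have \<delta>c: "continuous_on S (\<delta> K)" if "K \<in> alf D" for K S by (rule pdeg_continuous_on[OF \<delta>p[OF that]])
  have Jc: "continuous_on S (J K)" if "K \<in> alf D" for K S
    unfolding J_def[abs_def] by (rule continuous_on_det[OF elem_jac_continuous[OF that]])
  have Jb: "\<bar>J K z - 1\<bar> \<le> \<eta>" if "K \<in> alf D" "z \<in> K" for K z
    unfolding J_def by (rule det_elem_jac(1)[OF that])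
  have ci: "f absolutely_integrable_on K" if "continuous_on K f" "K \<in> alf D" for f :: "real^'n \<Rightarrow> real" and K
    using absolutely_integrable_continuous_compact[OF alf_compact[OF that(2)] that(1)] .
  have cI: "f integrable_on K" if "continuous_on K f" "K \<in> alf D" for f :: "real^'n \<Rightarrow> real" and K
    using ci[OF that] by (simp add: absolutely_integrable_on_def)
  have cc: "continuous_on S (\<lambda>z. \<delta> K z - m)" if "K \<in> alf D" for K S and m :: real
    by (intro continuous_on_diff \<delta>c[OF that] continuous_on_const)
  \<comment> \<open>The mean value condition on the deformed mesh becomes a mean weighted by the
    Jacobian, while \<open>b_h\<close> carries no weight. This mismatch is the source of the factor
    \<open>J K\<close> in \<open>proj\<close>.\<close>
  have test: "(\<Sum>K\<in>alf D. integral K (\<lambda>z. Q K z * \<delta> K z)) = 0"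
    if Q: "\<And>K. K \<in> alf D \<Longrightarrow> pdeg (k - 1) (Q K)" and mean: "(\<Sum>K\<in>alf D. integral K (\<lambda>z. J K z * Q K z)) = 0" for Q
  proof -
    obtain q where q: "\<And>K z. K \<in> alf D \<Longrightarrow> z \<in> interior K \<Longrightarrow> q (deform D z) = Q K z"
      using piecewise_function[of Q] by metis
    have "(q has_integral (\<Sum>K\<in>alf D. integral K (\<lambda>z. J K z * Q K z))) (\<Omega>_mesh D)"
    proof (rule has_integral_deformed_mesh)
      show "continuous_on K (\<lambda>z. J K z * Q K z)" if K: "K \<in> alf D" for K
        by (intro continuous_on_mult Jc[OF K] pdeg_continuous_on[OF Q[OF K]])
    qed (simp add: J_def q)
    then have "integral (\<Omega>_mesh D) q = 0" using mean by (simp add: integral_unique)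
    moreover have "q \<in> Q_h k D" by (rule Q_h_member) (use Q q in blast)
    ultimately have "b_h D q u = 0" by (intro b0) (simp add: Q0_h_def)
    moreover have "b_h D q u = - (\<Sum>K\<in>alf D. integral K (\<lambda>z. Q K z * \<delta> K z))"
      unfolding \<delta>_def by (rule b_h_flat[OF u pdeg_continuous_on[OF Q] q])
    ultimately show ?thesis by simp
  qed
  define v1 where "v1 = (\<Sum>K\<in>alf D. integral K (J K))"
  define l1 where "l1 = (\<Sum>K\<in>alf D. integral K (\<delta> K))"
  define A where "A = measure lebesgue (\<Union>(macro D))"
  have A: "A = (\<Sum>K\<in>alf D. measure lebesgue K)" by (simp add: A_def sum_measure_alf)
  have const: "integral K (\<lambda>z. c) = c * measure lebesgue K" if "K \<in> alf D" for K and c :: real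
    using lmeasure_integral[OF alf_lmeasurable[OF that]] integral_mult_right[of K c "\<lambda>_. 1"] by simp
  have v1: "v1 > 0"
  proof -
    have "(\<Sum>K\<in>alf D. 1 / 2 * measure lebesgue K) \<le> v1"
      unfolding v1_def
    proof (rule sum_mono)
      fix K assume K: "K \<in> alf D"
      have "integral K (\<lambda>z. 1 / 2) \<le> integral K (J K)"
      proof (rule integral_le[OF cI[OF continuous_on_const K] cI[OF Jc[OF K] K]])
        show "1 / 2 \<le> J K z" if "z \<in> K" for z using Jb[OF K that] \<eta> by linarith
      qed
      then show "1 / 2 * measure lebesgue K \<le> integral K (J K)" by (simp only: const[OF K])
    qed
    moreover have "0 < measure lebesgue K0"
    proof -
      have "\<not> negligible K0" using alf_interior(2)[OF K0] open_not_negligible[OF open_interior] negligible_subset[OF _ interior_subset] by blast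
      then show ?thesis using alf_lmeasurable[OF K0] by (simp add: negligible_iff_measure order_less_le)
    qed
    then have "0 < (\<Sum>K\<in>alf D. 1 / 2 * measure lebesgue K)"
      using K0 alf_finite by (intro sum_pos2[of _ K0]) auto
    ultimately show ?thesis by linarith
  qed
  \<comment> \<open>\<open>v1\<close> is the volume of the deformed mesh and \<open>l1\<close> the
    integral of the divergence of \<open>u\<close> over it, so \<open>m\<close> is the mean
    divergence.\<close>
  define m where "m = l1 / v1"
  \<comment> \<open>An arbitrary \<open>Q\<close> becomes admissible after subtracting its weighted
    mean \<open>c\<close>. The result says that \<delta> - m J is orthogonal to all piecewise
    polynomials of degree \<open>k - 1\<close>.\<close>
  have proj: "(\<Sum>K\<in>alf D. integral K (\<lambda>z. Q K z * \<delta> K z)) = m * (\<Sum>K\<in>alf D. integral K (\<lambda>z. J K z * Q K z))"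
    if Q: "\<And>K. K \<in> alf D \<Longrightarrow> pdeg (k - 1) (Q K)" for Q
  proof -
    define s where "s = (\<Sum>K\<in>alf D. integral K (\<lambda>z. J K z * Q K z))"
    define c where "c = s / v1"
    have Qc: "continuous_on K (Q K)" if "K \<in> alf D" for K by (rule pdeg_continuous_on[OF Q[OF that]])
    have "(\<Sum>K\<in>alf D. integral K (\<lambda>z. J K z * (Q K z - c))) = (\<Sum>K\<in>alf D. integral K (\<lambda>z. J K z * Q K z) - c * integral K (J K))"
    proof (rule sum.cong[OF refl])
      fix K assume K: "K \<in> alf D"
      have "(\<lambda>z. J K z * (Q K z - c)) = (\<lambda>z. J K z * Q K z - c * J K z)" by (auto simp: algebra_simps)
      then have "integral K (\<lambda>z. J K z * (Q K z - c)) = integral K (\<lambda>z. J K z * Q K z) - integral K (\<lambda>z. c * J K z)"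
        using K by (simp add: integral_diff cI continuous_on_mult Jc Qc continuous_on_const)
      then show "integral K (\<lambda>z. J K z * (Q K z - c)) = integral K (\<lambda>z. J K z * Q K z) - c * integral K (J K)" by simp
    qed
    also have "\<dots> = s - c * v1" by (simp only: sum_subtractf sum_distrib_left v1_def s_def)
    also have "\<dots> = 0" using v1 by (simp add: c_def)
    finally have "(\<Sum>K\<in>alf D. integral K (\<lambda>z. (Q K z - c) * \<delta> K z)) = 0"
      by (rule test[rotated]) (intro pdeg_minus Q pdeg_const)
    moreover have "(\<Sum>K\<in>alf D. integral K (\<lambda>z. (Q K z - c) * \<delta> K z)) = (\<Sum>K\<in>alf D. integral K (\<lambda>z. Q K z * \<delta> K z) - c * integral K (\<delta> K))"
    proof (rule sum.cong[OF refl])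
      fix K assume K: "K \<in> alf D"
      have "(\<lambda>z. (Q K z - c) * \<delta> K z) = (\<lambda>z. Q K z * \<delta> K z - c * \<delta> K z)" by (auto simp: algebra_simps)
      then have "integral K (\<lambda>z. (Q K z - c) * \<delta> K z) = integral K (\<lambda>z. Q K z * \<delta> K z) - integral K (\<lambda>z. c * \<delta> K z)"
        using K by (simp add: integral_diff cI continuous_on_mult \<delta>c Qc continuous_on_const)
      then show "integral K (\<lambda>z. (Q K z - c) * \<delta> K z) = integral K (\<lambda>z. Q K z * \<delta> K z) - c * integral K (\<delta> K)" by simp
    qed
    moreover have "\<dots> = (\<Sum>K\<in>alf D. integral K (\<lambda>z. Q K z * \<delta> K z)) - c * l1"
      by (simp only: sum_subtractf sum_distrib_left l1_def)
    ultimately have "(\<Sum>K\<in>alf D. integral K (\<lambda>z. Q K z * \<delta> K z)) = c * l1" by linarith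
    then show ?thesis by (simp add: c_def m_def s_def)
  qed
  define X where "X K z = \<delta> K z - m" for K z
  have Xc: "continuous_on S (X K)" if "K \<in> alf D" for K S unfolding X_def[abs_def] by (rule cc[OF that])
  \<comment> \<open>\<open>X\<close> is itself such a polynomial. Testing with it turns the integral
    of X^2 into that of m (J - 1) X, which Young's inequality bounds by half of the left-hand side
    plus half of the claimed bound.\<close>
  have X2: "(\<Sum>K\<in>alf D. integral K (\<lambda>z. (X K z)\<^sup>2)) \<le> (m * \<eta>)\<^sup>2 * A"
  proof -
    have "(\<Sum>K\<in>alf D. integral K (\<lambda>z. (X K z)\<^sup>2)) = (\<Sum>K\<in>alf D. integral K (\<lambda>z. X K z * \<delta> K z) - m * integral K (X K))"
    proof (rule sum.cong[OF refl])
      fix K assume K: "K \<in> alf D"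
      have "(\<lambda>z. (X K z)\<^sup>2) = (\<lambda>z. X K z * \<delta> K z - m * X K z)" by (auto simp: X_def power2_eq_square algebra_simps)
      then have "integral K (\<lambda>z. (X K z)\<^sup>2) = integral K (\<lambda>z. X K z * \<delta> K z) - integral K (\<lambda>z. m * X K z)"
        using K by (simp add: integral_diff cI continuous_on_mult \<delta>c Xc continuous_on_const)
      then show "integral K (\<lambda>z. (X K z)\<^sup>2) = integral K (\<lambda>z. X K z * \<delta> K z) - m * integral K (X K)" by simp
    qed
    also have "\<dots> = m * (\<Sum>K\<in>alf D. integral K (\<lambda>z. J K z * X K z)) - m * (\<Sum>K\<in>alf D. integral K (X K))"
      using proj[of X] \<delta>p by (simp add: sum_subtractf sum_distrib_left X_def[abs_def] pdeg_minus pdeg_const)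
    also have "\<dots> = (\<Sum>K\<in>alf D. integral K (\<lambda>z. m * ((J K z - 1) * X K z)))"
      unfolding sum_distrib_left sum_subtractf[symmetric]
    proof (rule sum.cong[OF refl])
      fix K assume K: "K \<in> alf D"
      have "(\<lambda>z. m * ((J K z - 1) * X K z)) = (\<lambda>z. m * (J K z * X K z) - m * X K z)" by (auto simp: algebra_simps)
      then have "integral K (\<lambda>z. m * ((J K z - 1) * X K z)) = integral K (\<lambda>z. m * (J K z * X K z)) - integral K (\<lambda>z. m * X K z)"
        using K by (simp add: integral_diff cI continuous_on_mult Jc Xc continuous_on_const)
      then show "m * integral K (\<lambda>z. J K z * X K z) - m * integral K (X K) = integral K (\<lambda>z. m * ((J K z - 1) * X K z))" by simp
    qed
    also have "\<dots> \<le> (\<Sum>K\<in>alf D. 1 / 2 * integral K (\<lambda>z. (X K z)\<^sup>2) + 1 / 2 * (m * \<eta>)\<^sup>2 * measure lebesgue K)"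
    proof (rule sum_mono)
      fix K assume K: "K \<in> alf D"
      have "integral K (\<lambda>z. m * ((J K z - 1) * X K z)) \<le> integral K (\<lambda>z. 1 / 2 * (X K z)\<^sup>2 + 1 / 2 * (m * \<eta>)\<^sup>2)"
      proof (rule integral_le)
        show "(\<lambda>z. m * ((J K z - 1) * X K z)) integrable_on K"
          by (intro cI[OF _ K] continuous_on_mult continuous_on_diff continuous_on_const Jc Xc K)
        show "(\<lambda>z. 1 / 2 * (X K z)\<^sup>2 + 1 / 2 * (m * \<eta>)\<^sup>2) integrable_on K"
          by (intro cI[OF _ K] continuous_on_mult continuous_on_add continuous_on_power continuous_on_const Xc K)
        fix z assume z: "z \<in> K"
        define p where "p = m * (J K z - 1)"
        have "\<bar>p\<bar> \<le> \<bar>m\<bar> * \<eta>" unfolding p_def abs_mult using Jb[OF K z] by (intro mult_left_mono) auto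
        also have "\<dots> = \<bar>m * \<eta>\<bar>" using \<eta>0 by (simp add: abs_mult)
        finally have "p\<^sup>2 \<le> (m * \<eta>)\<^sup>2" by (simp add: abs_le_square_iff)
        moreover have "2 * (p * X K z) \<le> p\<^sup>2 + (X K z)\<^sup>2"
          using zero_le_power2[of "p - X K z"] by (simp add: power2_diff)
        moreover have "m * ((J K z - 1) * X K z) = p * X K z" by (simp add: p_def)
        ultimately show "m * ((J K z - 1) * X K z) \<le> 1 / 2 * (X K z)\<^sup>2 + 1 / 2 * (m * \<eta>)\<^sup>2" by linarith
      qed
      also have "\<dots> = integral K (\<lambda>z. 1 / 2 * (X K z)\<^sup>2) + integral K (\<lambda>z. 1 / 2 * (m * \<eta>)\<^sup>2)"
        by (intro integral_add cI[OF _ K] continuous_on_mult continuous_on_power continuous_on_const Xc K)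
      also have "integral K (\<lambda>z. 1 / 2 * (X K z)\<^sup>2) = 1 / 2 * integral K (\<lambda>z. (X K z)\<^sup>2)" by (rule integral_mult_right)
      also have "integral K (\<lambda>z. 1 / 2 * (m * \<eta>)\<^sup>2) = 1 / 2 * (m * \<eta>)\<^sup>2 * measure lebesgue K" by (rule const[OF K])
      finally show "integral K (\<lambda>z. m * ((J K z - 1) * X K z)) \<le> 1 / 2 * integral K (\<lambda>z. (X K z)\<^sup>2) + 1 / 2 * (m * \<eta>)\<^sup>2 * measure lebesgue K" .
    qed
    also have "\<dots> = 1 / 2 * (\<Sum>K\<in>alf D. integral K (\<lambda>z. (X K z)\<^sup>2)) + 1 / 2 * (m * \<eta>)\<^sup>2 * A"
      by (simp add: A sum.distrib sum_distrib_left)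
    finally show ?thesis by simp
  qed
  have NL: "N K \<in> lmeasurable" if "K \<in> alf D" for K unfolding N_def by (rule cut_lmeasurable[OF that])
  have Nm: "N K \<in> sets lebesgue" "N K \<subseteq> K" if K: "K \<in> alf D" for K
    using fmeasurableD[OF NL[OF K]] by (auto simp: N_def)
  have NI: "f integrable_on N K" if "continuous_on K f" "K \<in> alf D" for f :: "real^'n \<Rightarrow> real" and K
    using set_integrable_subset[OF ci[OF that] Nm(1)[OF that(2)] Nm(2)[OF that(2)]] by (simp add: absolutely_integrable_on_def)
  have Nsum: "(\<Sum>K\<in>alf D. integral (N K) (\<delta> K)) = 0"
    using flat_divergence_theorem[OF bg op sub card pl piola_field(1)[OF u] piola_field_conforming[OF u]]
      c_h_flat[OF u] c0 by (simp add: N_def \<delta>_def)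
  have m0: "m = 0"
  proof (rule ccontr)
    assume "m \<noteq> 0"
    \<comment> \<open>The balancing weight in |X| \<le> X^2 / (2 t) + t / 2, which replaces the
      Cauchy-Schwarz inequality: with this choice both terms contribute at most t A / 2.\<close>
    define t where "t = \<bar>m\<bar> * \<eta>"
    have t: "t > 0" using \<open>m \<noteq> 0\<close> \<eta>0 by (simp add: t_def)
    have t2: "(m * \<eta>)\<^sup>2 = t\<^sup>2" by (simp add: t_def power_mult_distrib)
    have absX: "(\<Sum>K\<in>alf D. integral K (\<lambda>z. \<bar>X K z\<bar>)) \<le> t * A"
    proof -
      have "(\<Sum>K\<in>alf D. integral K (\<lambda>z. \<bar>X K z\<bar>)) \<le> (\<Sum>K\<in>alf D. 1 / (2 * t) * integral K (\<lambda>z. (X K z)\<^sup>2) + t / 2 * measure lebesgue K)"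
      proof (rule sum_mono)
        fix K assume K: "K \<in> alf D"
        have "integral K (\<lambda>z. \<bar>X K z\<bar>) \<le> integral K (\<lambda>z. 1 / (2 * t) * (X K z)\<^sup>2 + t / 2)"
        proof (rule integral_le)
          show "(\<lambda>z. \<bar>X K z\<bar>) integrable_on K" by (intro cI[OF _ K] continuous_on_rabs Xc K)
          show "(\<lambda>z. 1 / (2 * t) * (X K z)\<^sup>2 + t / 2) integrable_on K"
            by (intro cI[OF _ K] continuous_on_mult continuous_on_add continuous_on_power continuous_on_const Xc K)
          fix z
          have "0 \<le> (\<bar>X K z\<bar> - t)\<^sup>2" by simp
          also have "\<dots> = (X K z)\<^sup>2 + t * t - 2 * t * \<bar>X K z\<bar>"
            unfolding power2_diff power2_abs by (simp add: power2_eq_square)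
          finally have "\<bar>X K z\<bar> * (2 * t) \<le> (X K z)\<^sup>2 + t * t" by (simp add: mult_ac)
          then have "\<bar>X K z\<bar> \<le> ((X K z)\<^sup>2 + t * t) / (2 * t)"
            using t by (subst pos_le_divide_eq) auto
          also have "\<dots> = 1 / (2 * t) * (X K z)\<^sup>2 + t / 2" using t by (simp add: add_divide_distrib)
          finally show "\<bar>X K z\<bar> \<le> 1 / (2 * t) * (X K z)\<^sup>2 + t / 2" .
        qed
        also have "\<dots> = integral K (\<lambda>z. 1 / (2 * t) * (X K z)\<^sup>2) + integral K (\<lambda>z. t / 2)"
          by (intro integral_add cI[OF _ K] continuous_on_mult continuous_on_power continuous_on_const Xc K)
        also have "integral K (\<lambda>z. 1 / (2 * t) * (X K z)\<^sup>2) = 1 / (2 * t) * integral K (\<lambda>z. (X K z)\<^sup>2)" by (rule integral_mult_right)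
        also have "integral K (\<lambda>z. t / 2) = t / 2 * measure lebesgue K" by (rule const[OF K])
        finally show "integral K (\<lambda>z. \<bar>X K z\<bar>) \<le> 1 / (2 * t) * integral K (\<lambda>z. (X K z)\<^sup>2) + t / 2 * measure lebesgue K" .
      qed
      also have "\<dots> = 1 / (2 * t) * (\<Sum>K\<in>alf D. integral K (\<lambda>z. (X K z)\<^sup>2)) + t / 2 * A"
        by (simp only: A sum.distrib sum_distrib_left)
      also have "\<dots> \<le> 1 / (2 * t) * (t\<^sup>2 * A) + t / 2 * A"
        using X2 t unfolding t2 by (intro add_mono mult_left_mono) auto
      also have "\<dots> = t * A" using t by (simp add: power2_eq_square)
      finally show ?thesis .
    qed
    \<comment> \<open>The integral of \<delta> over the negative set is zero by \<open>Nsum\<close>,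
      so m times the measure of that set is minus the integral of \<open>X\<close> there, which
      \<open>absX\<close> bounds by |m| \<eta> A. Cancelling |m| contradicts
      \<open>small\<close>.\<close>
    have "\<bar>m\<bar> * (\<Sum>K\<in>alf D. measure lebesgue (N K)) = \<bar>\<Sum>K\<in>alf D. m * measure lebesgue (N K)\<bar>"
      by (simp add: sum_distrib_left[symmetric] abs_mult sum_nonneg)
    also have "(\<Sum>K\<in>alf D. m * measure lebesgue (N K)) = - (\<Sum>K\<in>alf D. integral (N K) (X K))"
    proof -
      have "integral (N K) (X K) = integral (N K) (\<delta> K) - m * measure lebesgue (N K)" if K: "K \<in> alf D" for K
      proof -
        have "integral (N K) (X K) = integral (N K) (\<delta> K) - integral (N K) (\<lambda>_. m)"
          unfolding X_def by (intro integral_diff NI \<delta>c continuous_on_const K)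
        also have "integral (N K) (\<lambda>_. m) = m * measure lebesgue (N K)"
          using lmeasure_integral[OF NL[OF K]] integral_mult_right[of "N K" m "\<lambda>_. 1"] by simp
        finally show ?thesis .
      qed
      then have "(\<Sum>K\<in>alf D. integral (N K) (X K)) = (\<Sum>K\<in>alf D. integral (N K) (\<delta> K) - m * measure lebesgue (N K))"
        by (intro sum.cong) auto
      then show ?thesis using Nsum by (simp add: sum_subtractf)
    qed
    also have "\<bar>- (\<Sum>K\<in>alf D. integral (N K) (X K))\<bar> \<le> (\<Sum>K\<in>alf D. \<bar>integral (N K) (X K)\<bar>)"
      unfolding abs_minus_cancel by (rule sum_abs)
    also have "\<dots> \<le> (\<Sum>K\<in>alf D. integral K (\<lambda>z. \<bar>X K z\<bar>))"
    proof (rule sum_mono)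
      fix K assume K: "K \<in> alf D"
      have ac: "continuous_on K (\<lambda>z. \<bar>X K z\<bar>)" by (intro continuous_on_rabs Xc K)
      have "\<bar>integral (N K) (X K)\<bar> \<le> integral (N K) (\<lambda>z. \<bar>X K z\<bar>)"
        using integral_norm_bound_integral[OF NI[OF Xc[OF K] K] NI[OF ac K]] by simp
      also have "\<dots> \<le> integral K (\<lambda>z. \<bar>X K z\<bar>)"
        by (rule integral_subset_le[OF Nm(2)[OF K] NI[OF ac K] cI[OF ac K]]) simp
      finally show "\<bar>integral (N K) (X K)\<bar> \<le> integral K (\<lambda>z. \<bar>X K z\<bar>)" .
    qed
    also note absX
    finally have "\<bar>m\<bar> * (\<Sum>K\<in>alf D. measure lebesgue (N K)) \<le> \<bar>m\<bar> * (\<eta> * A)" by (simp add: t_def mult.assoc)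
    then have "(\<Sum>K\<in>alf D. measure lebesgue (N K)) \<le> \<eta> * A" using \<open>m \<noteq> 0\<close> by simp
    moreover have "measure lebesgue (\<Union>K\<in>alf D. N K) \<le> (\<Sum>K\<in>alf D. measure lebesgue (N K))"
      using alf_finite Nm(1) by (rule measure_UNION_le)
    ultimately show False using small by (simp add: N_def A_def)
  qed
  \<comment> \<open>For m = 0 the function \<open>X\<close> is \<delta> itself and the bound in
    \<open>X2\<close> is zero.\<close>
  have le0: "(\<Sum>K\<in>alf D. integral K (\<lambda>z. (\<delta> K z)\<^sup>2)) \<le> 0" using X2 m0 by (simp add: X_def)
  have nn: "0 \<le> integral K (\<lambda>z. (\<delta> K z)\<^sup>2)" if K: "K \<in> alf D" for K
    by (rule integral_nonneg[OF cI[OF continuous_on_power[OF \<delta>c[OF K]] K]]) simp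
  have "0 \<le> (\<Sum>K\<in>alf D. integral K (\<lambda>z. (\<delta> K z)\<^sup>2))" by (rule sum_nonneg) (rule nn)
  with le0 have "(\<Sum>K\<in>alf D. integral K (\<lambda>z. (\<delta> K z)\<^sup>2)) = 0" by (rule antisym)
  then have "integral K0 (\<lambda>z. (\<delta> K0 z)\<^sup>2) = 0"
    using sum_nonneg_eq_0_iff[OF alf_finite, of "\<lambda>K. integral K (\<lambda>z. (\<delta> K z)\<^sup>2)"] nn K0 by blast
  moreover have c2: "continuous_on K0 (\<lambda>z. (\<delta> K0 z)\<^sup>2)" by (intro continuous_on_power \<delta>c K0)
  ultimately have int0: "((\<lambda>z. (\<delta> K0 z)\<^sup>2) has_integral 0) K0"
    using cI[OF c2 K0] by (metis integrable_integral)
  obtain z where z: "z \<in> interior K0" "y = deform D z" using y interior_deform_image[OF K0] by blast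
  have clo: "closure (interior K0) = K0" using alf_interior(3)[OF K0] by (rule sym)
  have zK: "z \<in> K0" using z(1) interior_subset by blast
  have emK: "emeasure lborel K0 = emeasure lborel (interior K0)"
  proof -
    have b: "K0 \<in> sets borel" using compact_imp_closed[OF alf_compact[OF K0]] by (rule borel_closed)
    have n: "K0 - interior K0 \<in> null_sets lborel"
      using negligible_alf_frontier[OF K0] b by (simp add: negligible_iff_null_sets null_sets_completion_iff)
    have "emeasure lborel (interior K0 \<union> (K0 - interior K0)) = emeasure lborel (interior K0)"
      by (rule emeasure_Un_null_set[OF _ n]) simp
    moreover have "interior K0 \<union> (K0 - interior K0) = K0" using interior_subset by blast
    ultimately show ?thesis by simp
  qed
  have "(\<delta> K0 z)\<^sup>2 = 0"
  proof (rule has_integral_0_closure_imp_0[where S = "interior K0" and f = "\<lambda>z. (\<delta> K0 z)\<^sup>2"])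
    show "0 < emeasure lborel (interior K0)"
      using open_not_negligible[OF open_interior alf_interior(2)[OF K0]]
      by (simp add: negligible_iff_null_sets null_sets_completion_iff null_sets_def zero_less_iff_neq_zero)
    show "emeasure lborel (interior K0) < \<infinity>"
      using emeasure_compact_finite[OF alf_compact[OF K0]] emK by simp
  qed (use clo c2 int0 zK emK in auto)
  then show ?thesis using divergence_V_h[OF u K0 z(1)] z(2) by (simp add: \<delta>_def)
qed

section \<open>Test functions and mesh-independent bounds for the final theorem\<close>

lemma zero_in_Q0_h: "(\<lambda>_. 0) \<in> Q0_h k D"
  unfolding Q0_h_def Q_h_def by (auto intro!: bexI[of _ "\<lambda>_. 0"] simp: polys_iff_pdeg pdeg_const)

lemma zero_in_\<Sigma>_h: "(\<lambda>_. 0) \<in> \<Sigma>_h kl D"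
  unfolding \<Sigma>_h_def by (auto intro!: bexI[of _ "\<lambda>_. 0"] simp: polys_iff_pdeg pdeg_const)

text \<open>The vertices of an element containing \<open>x\<close> are at most one mesh size away,
  hence in \<open>\<Omega> D\<close>. The interpolant is negative at them and, being affine, on the
  whole element.\<close>

lemma lset_h_neg_if_\<Omega>_cball:
  assumes x: "cball x (mesh_size D) \<subseteq> \<Omega> D" "x \<in> \<Omega> D"
  shows "\<exists>K\<in>alf D. x \<in> K \<and> lset_h D x < 0"
proof -
  obtain T0 where "T0 \<in> macro D" "x \<in> T0" using \<Omega>_covered[OF bg op sub x(2)] by blast
  then have "x \<in> \<Union>(alf D)" using alf_Union by auto
  then obtain K where K: "K \<in> alf D" "x \<in> K" by blast
  obtain T where T: "T \<in> macro D" "K \<subseteq> T" using alf_subset_macro[OF bg op sub K(1)] by blast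
  have Tb: "T \<in> bg_mesh D" using subsetD[OF macro_subset[OF bg op sub] T(1)] .
  have bT: "bounded T"
    by (subst bg_mesh_simplex(2)[OF bg op sub Tb])
      (rule compact_imp_bounded[OF compact_full_simplex[OF bg_mesh_simplex(1)[OF bg op sub Tb]]])
  have dT: "diameter T \<le> mesh_size D"
    unfolding mesh_size_def using finite_bg_mesh[OF bg op sub] Tb by (intro Max_ge) auto
  obtain \<alpha> \<beta> where ab: "\<And>x. x \<in> K \<Longrightarrow> lset_h D x = \<alpha> \<bullet> x + \<beta>" using lset_h_affine[OF pl K(1)] by blast
  have neg: "\<alpha> \<bullet> v + \<beta> < 0" if v: "v \<in> vertices K" for v
  proof -
    have vK: "v \<in> K" using v by (auto simp: vertices_def extreme_point_of_def)
    then have "dist x v \<le> mesh_size D"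
      using diameter_bounded_bound[OF bT, of x v] K(2) T(2) dT by force
    then have "lset D v < 0" using x(1) by (auto simp: \<Omega>_def)
    then have "lset_h D v < 0" using pl K(1) v by (simp add: pl_interpolant_def)
    then show ?thesis using ab[OF vK] by simp
  qed
  have "convex hull (vertices K) \<subseteq> {y. \<alpha> \<bullet> y < - \<beta>}"
    using neg by (intro hull_minimal convex_halfspace_lt) force
  then have "K \<subseteq> {y. \<alpha> \<bullet> y < - \<beta>}" unfolding alf_simplex(2)[OF bg op sub K(1), symmetric] .
  then have "x \<in> {y. \<alpha> \<bullet> y < - \<beta>}" using K(2) by (rule subsetD)
  then have "lset_h D x < 0" using ab[OF K(2)] by simp
  then show ?thesis using K by blast
qed

lemma measure_macro_le:
  assumes "bounded \<Omega>ext"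
  shows "measure lebesgue (\<Union>(macro D)) \<le> measure lebesgue (closure \<Omega>ext)"
proof (rule measure_mono_fmeasurable)
  show "\<Union>(macro D) \<subseteq> closure \<Omega>ext" 
    using bg Union_mono[OF macro_subset[OF bg op sub]] by (simp add: background_mesh_def)
  have "compact (\<Union>(alf D))" using alf_finite alf_compact by (rule compact_Union)
  then show "\<Union>(macro D) \<in> sets lebesgue" using lmeasurable_compact by (auto simp: alf_Union)
  show "closure \<Omega>ext \<in> lmeasurable" using assms by (intro lmeasurable_compact) (simp add: compact_closure)
qed

lemma c_h_zero: "c_h D (\<lambda>_. 0) v = 0"
  by (simp add: c_h_def surf_integral_def plane_integral_def)

end

text \<open>The stabilisation does not see constant multipliers, so testing with 1 isolates the
  total flux in \<open>c_h\<close>.\<close>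

lemma j_h_const:
  fixes D :: "('n::finite) disc"
  shows "j_h \<gamma>l D l (\<lambda>_. c) = 0"
proof -
  have "grad (\<lambda>_. c) x = 0" for x :: "real^'n" by (rule grad_unique) simp
  then show ?thesis by (simp add: j_h_def)
qed

lemma onorm_jacobian_le:
  fixes P :: "real^'n \<Rightarrow> real^'n"
  assumes "P \<in> vpolys k" "\<And>x. x \<in> K \<Longrightarrow> g x = P x" "x \<in> interior K"
    and "onorm (\<lambda>y. frechet_derivative g (at x) y - y) \<le> c"
  shows "onorm (\<lambda>y. jacobian g (at x) *v y - y) \<le> c"
proof -
  have "(g has_derivative (\<lambda>h. jacobian P (at x) *v h)) (at x)"
    by (rule has_derivative_transform_within_open[OF vpolys_has_derivative(1)[OF assms(1)] open_interior assms(3)])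
      (rule assms(2)[OF subsetD[OF interior_subset], symmetric])
  then have d: "g differentiable (at x)" by (auto simp: differentiable_def)
  then have "linear (frechet_derivative g (at x))" by (rule linear_frechet_derivative)
  then have "frechet_derivative g (at x) = (\<lambda>y. jacobian g (at x) *v y)"
    by (auto simp: jacobian_def matrix_works)
  then show ?thesis using assms(4) by simp
qed

theorem lemma4p1:
  fixes \<phi> :: "real^'n \<Rightarrow> real" and \<Omega>ext :: "(real^'n) set"
    and k kl :: nat and C \<gamma>n \<gamma>gp \<gamma>l :: real
  assumes "CARD('n) \<in> {2, 3}" and "CARD('n) \<le> k" and "kl \<in> {k - 1, k}"
    and "0 < \<gamma>n" and "0 < \<gamma>gp" and "0 < \<gamma>l"
    and "level_set_function \<phi>"
    and "polytopal_domain \<Omega>ext" and "{x. \<phi> x < 0} \<subseteq> \<Omega>ext"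
    and "0 < C"
  shows "\<exists>h0>0. \<forall>D :: 'n disc.
    lset D = \<phi> \<and> admissible C k \<Omega>ext D \<and> mesh_size D \<le> h0 \<longrightarrow>
    (\<forall>f u p l.
       square_integrable (\<Omega>_h D) f \<and> u \<in> V_h k D \<and> p \<in> Q0_h k D \<and> l \<in> \<Sigma>_h kl D \<and>
       (\<forall>v \<in> V_h k D. \<forall>q \<in> Q0_h k D. \<forall>\<mu> \<in> \<Sigma>_h kl D.
          a_h \<gamma>n D u v + i_h \<gamma>gp D u v + b_h D p v + b_h D q u + c_h D l v + c_h D \<mu> u + j_h \<gamma>l D l \<mu>
          = integral (\<Omega>_h D) (\<lambda>x. f x \<bullet> v x)) \<longrightarrow>
       (\<forall>K \<in> alf D. \<forall>x \<in> interior (deform D ` K). divergence u x = 0))"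
proof -
  have "\<phi> differentiable (at x)" for x
    using assms(7) unfolding level_set_function_def smooth_def by (metis pderivs.simps(1))
  then have "continuous_on UNIV \<phi>"
    by (intro continuous_at_imp_continuous_on ballI differentiable_imp_continuous_within)
  then have open\<phi>: "open {x. \<phi> x < 0}" by (intro open_Collect_less continuous_on_const)
  obtain x0 where "\<phi> x0 < 0" using assms(7) unfolding level_set_function_def by blast
  then obtain r where r: "0 < r" "ball x0 r \<subseteq> {x. \<phi> x < 0}"
    using open\<phi> by (metis mem_Collect_eq open_contains_ball)
  have bounded_ext: "bounded \<Omega>ext"
  proof -
    obtain \<P> where \<P>: "finite \<P>" "\<forall>P\<in>\<P>. polytope P" "closure \<Omega>ext = \<Union>\<P>"
      using assms(8) unfolding polytopal_domain_def by blast
    have "bounded (\<Union>\<P>)" using \<P>(1,2) polytope_imp_bounded by (intro bounded_Union) auto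
    then show ?thesis unfolding \<P>(3)[symmetric] by (rule bounded_subset) (rule closure_subset)
  qed
  define M where "M = measure lebesgue (closure \<Omega>ext)"
  define c where "c = measure lebesgue (ball x0 (r / 2))"
  \<comment> \<open>\<open>c\<close> will bound the measure of the negative set from below and
    \<open>M\<close> that of the active mesh from above; \<eta> is chosen to give \<eta> M < c. The
    added 1 keeps the quotient meaningful without showing that \<open>M\<close> is positive.\<close>
  define \<eta> where "\<eta> = min (1 / 2) (c / (2 * (M + 1)))"
  have M: "0 \<le> M" by (simp add: M_def)
  have c: "0 < c" using r(1) content_ball_pos[of "r / 2" x0] by (simp add: c_def)
  have \<eta>_bounds: "0 < \<eta>" "\<eta> \<le> 1 / 2" unfolding \<eta>_def using c M by (simp, intro min.cobounded1)
  have "\<eta> * M \<le> c / (2 * (M + 1)) * M" using M by (intro mult_right_mono) (auto simp: \<eta>_def)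
  also have "\<dots> < c"
  proof -
    have "0 < M * c + c * 2" using M c by (intro add_nonneg_pos) auto
    then show ?thesis using M c by (simp add: field_simps)
  qed
  finally have \<eta>M: "\<eta> * M < c" .
  obtain \<delta> where \<delta>: "0 < \<delta>" "\<And>A :: real^'n^'n. onorm (\<lambda>y. A *v y - y) \<le> \<delta> \<Longrightarrow> \<bar>det A - 1\<bar> \<le> \<eta>"
    using det_close_to_1[OF \<eta>_bounds(1)] by metis
  \<comment> \<open>The first bound makes the Jacobians \<eta>-close to 1; the second places the
    ball of radius r / 2 in the negative set of the discrete level set function.\<close>
  define h0 where "h0 = min (\<delta> / C) (r / 2)"
  have h0: "0 < h0" "C * h0 \<le> \<delta>" "h0 \<le> r / 2"
    using \<delta>(1) r(1) assms(10) by (auto simp: h0_def min_def field_simps)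
  show ?thesis
  proof (intro exI[of _ h0] conjI allI impI ballI h0(1))
    fix D :: "'n disc" and f u p l K x
    assume D: "lset D = \<phi> \<and> admissible C k \<Omega>ext D \<and> mesh_size D \<le> h0"
    assume H: "square_integrable (\<Omega>_h D) f \<and> u \<in> V_h k D \<and> p \<in> Q0_h k D \<and> l \<in> \<Sigma>_h kl D \<and>
       (\<forall>v \<in> V_h k D. \<forall>q \<in> Q0_h k D. \<forall>\<mu> \<in> \<Sigma>_h kl D.
          a_h \<gamma>n D u v + i_h \<gamma>gp D u v + b_h D p v + b_h D q u + c_h D l v + c_h D \<mu> u + j_h \<gamma>l D l \<mu>
          = integral (\<Omega>_h D) (\<lambda>x. f x \<bullet> v x))"
    assume K: "K \<in> alf D" and x: "x \<in> interior (deform D ` K)"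
    have \<Omega>: "\<Omega> D = {x. \<phi> x < 0}" using D by (simp add: \<Omega>_def)
    have md: "mesh_deformation C k D" and bgm: "background_mesh C \<Omega>ext D"
      and pli: "pl_interpolant (alf D) (lset D) (lset_h D)"
      using D unfolding admissible_def by blast+
    have defm: "continuous_on (\<Union>(macro D)) (deform D)" "inj_on (deform D) (\<Union>(macro D))"
      "\<forall>K\<in>alf D. \<exists>P\<in>vpolys k. \<forall>x\<in>K. deform D x = P x"
      "\<forall>K\<in>alf D. \<forall>x\<in>interior K.
        onorm (\<lambda>y. frechet_derivative (deform D) (at x) y - y) \<le> C * mesh_size D"
      using md unfolding mesh_deformation_def by - (elim conjE, assumption)+
    interpret deformed_mesh D \<Omega>ext C \<eta> k
    proof
      fix K x assume K: "K \<in> alf D" and x: "x \<in> interior K"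
      obtain P where P: "P \<in> vpolys k" "\<And>x. x \<in> K \<Longrightarrow> deform D x = P x"
        using defm(3) K by blast
      have "onorm (\<lambda>y. frechet_derivative (deform D) (at x) y - y) \<le> C * mesh_size D"
        using defm(4) K x by (elim ballE) auto
      also have "\<dots> \<le> C * h0" using D assms(10) by simp
      also note h0(2)
      finally show "\<bar>det (jacobian (deform D) (at x)) - 1\<bar> \<le> \<eta>"
        by (intro \<delta>(2) onorm_jacobian_le[OF P x])
    qed (use assms(1,2,9) open\<phi> \<Omega> bgm pli defm \<eta>_bounds in auto)
    have uV: "u \<in> V_h k D" using H by blast
    \<comment> \<open>The velocity test function is held at \<open>u\<close>, a member of
      \<open>V_h\<close> at hand. Subtracting two instances of the equation removes the source and
      every term free of \<open>q\<close> and \<mu>.\<close>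
    have eq: "b_h D q u + c_h D \<mu> u + j_h \<gamma>l D l \<mu> = b_h D q' u + c_h D \<mu>' u + j_h \<gamma>l D l \<mu>'"
      if "q \<in> Q0_h k D" "\<mu> \<in> \<Sigma>_h kl D" "q' \<in> Q0_h k D" "\<mu>' \<in> \<Sigma>_h kl D" for q \<mu> q' \<mu>'
    proof -
      have "a_h \<gamma>n D u u + i_h \<gamma>gp D u u + b_h D p u + b_h D q u + c_h D l u + c_h D \<mu> u + j_h \<gamma>l D l \<mu>
          = integral (\<Omega>_h D) (\<lambda>x. f x \<bullet> u x)"
        if "q \<in> Q0_h k D" "\<mu> \<in> \<Sigma>_h kl D" for q \<mu>
        using H uV that by blast
      from this[OF that(1,2)] this[OF that(3,4)] show ?thesis by linarith
    qed
    have b0: "b_h D (\<lambda>_. 0) u = 0" by (simp add: b_h_def)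
    show "divergence u x = 0"
    proof (rule divergence_free[OF uV _ _ \<eta>_bounds(1) _ K x])
      show "b_h D q u = 0" if "q \<in> Q0_h k D" for q
        using eq[OF that zero_in_\<Sigma>_h zero_in_Q0_h zero_in_\<Sigma>_h] b0 by simp
      show "c_h D (\<lambda>_. 1) u = 0"
        using eq[OF zero_in_Q0_h one_in_\<Sigma>_h zero_in_Q0_h zero_in_\<Sigma>_h] by (simp add: b0 c_h_zero j_h_const)
      have "\<eta> * measure lebesgue (\<Union>(macro D)) \<le> \<eta> * M"
        unfolding M_def using \<eta>_bounds(1) measure_macro_le[OF bounded_ext] by (intro mult_left_mono) auto
      also note \<eta>M
      also have "c \<le> measure lebesgue (\<Union>K\<in>alf D. {x \<in> K. lset_h D x < 0})"
        unfolding c_def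
      proof (rule measure_mono_fmeasurable)
        show "ball x0 (r / 2) \<subseteq> (\<Union>K\<in>alf D. {x \<in> K. lset_h D x < 0})"
        proof
          fix y assume y: "y \<in> ball x0 (r / 2)"
          have "cball y (mesh_size D) \<subseteq> ball x0 r"
          proof
            fix z assume "z \<in> cball y (mesh_size D)"
            then have "dist y z \<le> r / 2" using D h0(3) by auto
            then show "z \<in> ball x0 r" using y dist_triangle[of x0 z y] by auto
          qed
          also note r(2)
          finally have "cball y (mesh_size D) \<subseteq> \<Omega> D" unfolding \<Omega> .
          moreover have "y \<in> \<Omega> D" unfolding \<Omega> using y r(1) by (intro subsetD[OF r(2)]) simp
          ultimately have "\<exists>K\<in>alf D. y \<in> K \<and> lset_h D y < 0" by (rule lset_h_neg_if_\<Omega>_cball)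
          then show "y \<in> (\<Union>K\<in>alf D. {x \<in> K. lset_h D x < 0})" by blast
        qed
        show "(\<Union>K\<in>alf D. {x \<in> K. lset_h D x < 0}) \<in> lmeasurable"
          using alf_finite cut_lmeasurable by (intro fmeasurable.finite_UN)
      qed simp
      finally show "\<eta> * measure lebesgue (\<Union>(macro D)) < measure lebesgue (\<Union>K\<in>alf D. {x \<in> K. lset_h D x < 0})" .
    qed
  qed
qed

end
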